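(* Let $\mathcal{R}$ be a Borel equivalence relation with countable classes on a standard Borel space $X$ and let $\mathcal{A}$ be an $\mathcal{R}$-arboretum on $X$. Then there exists a desingularization of the action of $\mathcal{R}$ on $\mathcal{A}$.
   Context: Fibred spaces and actions. A fibred standard space over $X$ is a standard Borel space $F$ with a surjective Borel map $\pi:F\to X$ with countable preimages; $F_x=\pi^{-1}(x)$. An $\mathcal{R}$-action on $F$ (then $F$ is an $\mathcal{R}$-fibred standard space) is a Borel map assigning to $(x,y)\in\mathcal{R}$ and $f\in F_y$ an element $(x,y)\cdot f\in F_x$, with $(y,y)\cdot f=f$ and $(x,y)\cdot((y,z)\cdot f)=(x,z)\cdot f$. $\mathcal{R}_F$ is the orbit equivalence relation on $F$: $f_x\in F_x$, $f_y\in F_y$ are equivalent iff $(x,y)\in\mathcal{R}$ and $(x,y)\cdot f_y=f_x$. Morphisms are equivariant fibre-preserving Borel maps. A partial section is a Borel map $s:B\to F$, $B\subset X$ Borel, with $\pi\circ s=\mathrm{id}_B$; $\mathrm{Stab}_{\mathcal{R}}(s)$ is the sub-relation of $\mathcal{R}$ on $B$: $x\sim y$ iff $(x,y)\in\mathcal R$ and $(y,x)\cdot s(x)=s(y)$. $[[\mathcal{R}]]$ is the set of Borel isomorphisms between Borel subsets of $X$ with graph contained in $\mathcal{R}$. A fundamental domain of a Borel equivalence relation is a Borel set meeting each class in exactly one point. The saturation of a set under an equivalence relation is the set of points equivalent to some point of it. Arboretums. Graphs are in the sense of Serre (edges $a$ with origin $o(a)$, terminal vertex $t(a)$, opposite edge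 $\bar a$). A Borel $\mathcal{R}$-field of graphs $\mathcal{A}$ on $X$ is a graph whose vertex space $\mathcal{A}^0$ and edge space $\mathcal{A}^1$ are $\mathcal{R}$-fibred standard spaces and for which $o,t,\bar{\ }$ are morphisms; it is an $\mathcal{R}$-arboretum if each fibre $\mathcal{A}_x$ is a tree. An arboretum (without $\mathcal{R}$) is the same notion for the trivial relation; a sub-arboretum of the restriction $\mathcal{A}|_Y$ to a Borel $Y\subset X$ is a Borel subgraph, all of whose fibres over $Y$ are trees (no invariance required). Graphs of relations. A graph of relations $G^r$ consists of a countable graph $G$, a Borel equivalence relation $\mathcal{R}_P$ on a standard Borel space $X_P$ for each vertex $P$, a Borel equivalence relation $\mathcal{R}_a$ on a standard Borel space $X_a$ for each edge $a$ with $\mathcal{R}_a=\mathcal{R}_{\bar a}$ (and $X_a=X_{\bar a}$), and for each edge $a$ an injective morphism from $\mathcal{R}_a$ to $\mathcal{R}_{t(a)}$, i.e. an injective Borel map $j_a:X_a\to X_{t(a)}$ sending equivalent points to equivalent points. Each edge $a$ thus carries the partial isomorphism $j_a\circ j_{\bar a}^{-1}$ from a Borel subset of $X_{o(a)}$ to a Borel subset of $X_{t(a)}$. If $G$ is a tree (tree of relations), these partial isomorphisms generate a Borel equivalence relation on $\bigsqcup_P X_P$; $G^r$ is rooted at a vertex $P_0$ (the root) if $X_{P_0}$ is a fundamental domain of this relation. A rooted tree of relations defines an arboretum on $X_{P_0}$, with vertex space $\bigsqcup_PX_P$, edge space $\bigsqcup_aX_a$, the endpoints of a point $u\in X_a$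 being $j_{\bar a}(u)\in X_{o(a)}$ and $j_a(u)\in X_{t(a)}$, and projection sending a vertex to the unique equivalent point of $X_{P_0}$. Representation. A representation of a rooted tree of relations $G^r$ in $\mathcal{A}$ is a Borel isomorphism of $X_{P_0}$ onto a Borel subset $Y\subset X$ and, over it, an isomorphism $\chi$ from the arboretum defined by $G^r$ onto a sub-arboretum of $\mathcal{A}|_Y$, such that $\chi$ induces isomorphisms of $\mathcal{R}_P$ onto $\mathcal{R}_{\mathcal{A}^0}|_{\chi(X_P)}$ for each vertex $P$ and of $\mathcal{R}_a$ onto $\mathcal{R}_{\mathcal{A}^1}|_{\chi(X_a)}$ for each edge $a$. The sets $\chi(X_P),\chi(X_a)$ are called the representations of $X_P,X_a$. An arboretum of representatives of the action is a rooted tree of relations with a representation $\chi$ in $\mathcal{A}$ such that the $\mathcal{R}_{\mathcal{A}^0}$-saturations of the $\chi(X_P)$ form a partition of $\mathcal{A}^0$. Via $\pi\circ\chi$, $X_P$ is identified with a Borel subset of $X$ and $\mathcal{R}_P$ with a sub-relation of $\mathcal{R}$ on it. Desingularization. A desingularization of the action of $\mathcal{R}$ on $\mathcal{A}$ consists of a graph of relations $G^r$ whose underlying graph $G$ is oriented, a rooted maximal subtree $A_m$ of $G$, and for each edge $a$ of the orientation not in $A_m$ an element $\phi_a\in[[\mathcal{R}]]$, such that: (1) the rooted tree of relations induced by $G^r$ on $A_m$, with a representation $\chi$, is an arboretum of representatives for which the space carried by the root is identified with $X$ (i.e. $Y=X$); (2) for each edge $a$ of the orientation not in $A_m$ there is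 a partial section of edges $s_a$ defined on the source of $\phi_a$ such that $o(s_a(x))\in\chi(X_{o(a)})$ and $(\phi_a(x),x)\cdot t(s_a(x))\in\chi(X_{t(a)})$ for all $x$; as for vertices, the image of $s_a$ is called a representation of the standard Borel space carried by the edge; (3) for each such $a$, $\chi$ induces an isomorphism between $\mathrm{Stab}_{\mathcal{R}}(s_a)$, viewed as a sub-relation of the representation of $\mathcal{R}_{o(a)}$, and the image of $\mathcal{R}_{\bar a}$ in $\mathcal{R}_{t(\bar a)}=\mathcal{R}_{o(a)}$ by the injective morphism associated with $\bar a$; and an isomorphism between $\phi_a\mathrm{Stab}_{\mathcal{R}}(s_a)\phi_a^{-1}$ (the relation transported by $\phi_a$ to its range), viewed as a sub-relation of the representation of $\mathcal{R}_{t(a)}$, and the image of $\mathcal{R}_a$ in $\mathcal{R}_{t(a)}$ by the injective morphism associated with $a$; (4) the $\mathcal{R}_{\mathcal{A}^1}$-saturations of the representations of the standard Borel spaces carried by the edges of $G^r$ form a partition of the edge space $\mathcal{A}^1$. *)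

theory Defs
  imports "HOL-Analysis.Analysis"
begin

section \<open>Standard Borel spaces and Borel equivalence relations\<close>

text \<open>A Borel space is a value of type \<open>'a measure\<close>, of which only the underlying set and the
  sigma-algebra matter.\<close>

definition standard_borel :: "'a measure \<Rightarrow> bool" where
  "standard_borel M \<longleftrightarrow>
     (\<exists>T. topspace T = space M \<and> completely_metrizable_space T \<and> second_countable T \<and>
          sets M = sigma_sets (space M) {U. openin T U})"

definition borel_iso :: "'a measure \<Rightarrow> 'b measure \<Rightarrow> ('a \<Rightarrow> 'b) \<Rightarrow> bool" where
  "borel_iso M N f \<longleftrightarrow>
     f \<in> measurable M N \<and> bij_betw f (space M) (space N) \<and>
     the_inv_into (space M) f \<in> measurable N M"

definition borel_equiv :: "'a measure \<Rightarrow> ('a \<times> 'a) set \<Rightarrow> bool" where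
  "borel_equiv M R \<longleftrightarrow> equiv (space M) R \<and> R \<in> sets (M \<Otimes>\<^sub>M M)"

definition rel_iso ::
  "'a measure \<Rightarrow> ('a \<times> 'a) set \<Rightarrow> 'b measure \<Rightarrow> ('b \<times> 'b) set \<Rightarrow> ('a \<Rightarrow> 'b) \<Rightarrow> bool" where
  "rel_iso M R N S f \<longleftrightarrow>
     borel_iso M N f \<and>
     (\<forall>u\<in>space M. \<forall>v\<in>space M. (u, v) \<in> R \<longleftrightarrow> (f u, f v) \<in> S)"

definition fundamental_domain :: "'a measure \<Rightarrow> ('a \<times> 'a) set \<Rightarrow> 'a set \<Rightarrow> bool" where
  "fundamental_domain M R D \<longleftrightarrow>
     D \<in> sets M \<and> (\<forall>x\<in>space M. \<exists>!y. y \<in> D \<and> (x, y) \<in> R)"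

text \<open>Membership in \<open>[[R]]\<close> of the partial isomorphism with source \<open>B\<close> given by \<open>f\<close> on \<open>B\<close>.\<close>

definition full_pseudogroup :: "'a measure \<Rightarrow> ('a \<times> 'a) set \<Rightarrow> 'a set \<Rightarrow> ('a \<Rightarrow> 'a) \<Rightarrow> bool" where
  "full_pseudogroup X R B f \<longleftrightarrow>
     B \<in> sets X \<and> f ` B \<in> sets X \<and>
     borel_iso (restrict_space X B) (restrict_space X (f ` B)) f \<and>
     (\<forall>x\<in>B. (x, f x) \<in> R)"

definition borel_sum :: "'i set \<Rightarrow> ('i \<Rightarrow> 'a measure) \<Rightarrow> ('i \<times> 'a) measure" where
  "borel_sum I M =
     sigma (SIGMA i:I. space (M i))
       {S. S \<subseteq> (SIGMA i:I. space (M i)) \<and> (\<forall>i\<in>I. Pair i -` S \<in> sets (M i))}"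


section \<open>Fibred spaces and actions\<close>

text \<open>\<open>act F x y f\<close> is \<open>(x,y) \<cdot> f\<close>; it is meaningful only for \<open>(x,y) \<in> R\<close> and \<open>f\<close> over \<open>y\<close>.\<close>

record ('x, 'f) fibred =
  total_space :: "'f measure"
  proj :: "'f \<Rightarrow> 'x"
  act :: "'x \<Rightarrow> 'x \<Rightarrow> 'f \<Rightarrow> 'f"

definition fibred_standard_space :: "'x measure \<Rightarrow> ('x, 'f) fibred \<Rightarrow> bool" where
  "fibred_standard_space X F \<longleftrightarrow>
     standard_borel (total_space F) \<and>
     proj F \<in> measurable (total_space F) X \<and>
     proj F ` space (total_space F) = space X \<and>
     (\<forall>x\<in>space X. countable {f \<in> space (total_space F). proj F f = x})"

definition is_action :: "'x measure \<Rightarrow> ('x \<times> 'x) set \<Rightarrow> ('x, 'f) fibred \<Rightarrow> bool" where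
  "is_action X R F \<longleftrightarrow>
     (\<lambda>((x, y), f). act F x y f) \<in>
       measurable
         (restrict_space ((X \<Otimes>\<^sub>M X) \<Otimes>\<^sub>M total_space F)
            {((x, y), f). (x, y) \<in> R \<and> f \<in> space (total_space F) \<and> proj F f = y})
         (total_space F) \<and>
     (\<forall>x y f. (x, y) \<in> R \<and> f \<in> space (total_space F) \<and> proj F f = y \<longrightarrow>
        proj F (act F x y f) = x) \<and>
     (\<forall>f\<in>space (total_space F). act F (proj F f) (proj F f) f = f) \<and>
     (\<forall>x y z f. (x, y) \<in> R \<and> (y, z) \<in> R \<and> f \<in> space (total_space F) \<and> proj F f = z \<longrightarrow>
        act F x y (act F y z f) = act F x z f)"

definition R_fibred_standard_space ::
  "'x measure \<Rightarrow> ('x \<times> 'x) set \<Rightarrow> ('x, 'f) fibred \<Rightarrow> bool" where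
  "R_fibred_standard_space X R F \<longleftrightarrow> fibred_standard_space X F \<and> is_action X R F"

definition orbit_rel :: "('x \<times> 'x) set \<Rightarrow> ('x, 'f) fibred \<Rightarrow> ('f \<times> 'f) set" where
  "orbit_rel R F =
     {(f, g). f \<in> space (total_space F) \<and> g \<in> space (total_space F) \<and>
        (proj F f, proj F g) \<in> R \<and> act F (proj F f) (proj F g) g = f}"

definition saturation :: "('a \<times> 'a) set \<Rightarrow> 'a set \<Rightarrow> 'a set" where
  "saturation R S = {x. \<exists>y\<in>S. (x, y) \<in> R}"

definition R_morphism ::
  "('x \<times> 'x) set \<Rightarrow> ('x, 'f) fibred \<Rightarrow> ('x, 'g) fibred \<Rightarrow> ('f \<Rightarrow> 'g) \<Rightarrow> bool" where
  "R_morphism R F F' h \<longleftrightarrow>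
     h \<in> measurable (total_space F) (total_space F') \<and>
     (\<forall>f\<in>space (total_space F). proj F' (h f) = proj F f) \<and>
     (\<forall>x y f. (x, y) \<in> R \<and> f \<in> space (total_space F) \<and> proj F f = y \<longrightarrow>
        h (act F x y f) = act F' x y (h f))"

definition partial_section ::
  "'x measure \<Rightarrow> ('x, 'f) fibred \<Rightarrow> 'x set \<Rightarrow> ('x \<Rightarrow> 'f) \<Rightarrow> bool" where
  "partial_section X F B s \<longleftrightarrow>
     B \<in> sets X \<and> s \<in> measurable (restrict_space X B) (total_space F) \<and>
     (\<forall>x\<in>B. proj F (s x) = x)"

definition Stab ::
  "('x \<times> 'x) set \<Rightarrow> ('x, 'f) fibred \<Rightarrow> 'x set \<Rightarrow> ('x \<Rightarrow> 'f) \<Rightarrow> ('x \<times> 'x) set" where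
  "Stab R F B s = {(x, y). x \<in> B \<and> y \<in> B \<and> (x, y) \<in> R \<and> act F y x (s x) = s y}"


section \<open>Graphs in the sense of Serre\<close>

record ('v, 'e) sgraph =
  verts :: "'v set"
  edges :: "'e set"
  org :: "'e \<Rightarrow> 'v"
  ter :: "'e \<Rightarrow> 'v"
  opp :: "'e \<Rightarrow> 'e"

definition serre_graph :: "('v, 'e) sgraph \<Rightarrow> bool" where
  "serre_graph G \<longleftrightarrow>
     (\<forall>a\<in>edges G. org G a \<in> verts G \<and> ter G a \<in> verts G \<and> opp G a \<in> edges G \<and>
        opp G (opp G a) = a \<and> opp G a \<noteq> a \<and> org G (opp G a) = ter G a)"

fun walk :: "('v, 'e) sgraph \<Rightarrow> 'v \<Rightarrow> 'e list \<Rightarrow> 'v \<Rightarrow> bool" where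
  "walk G u [] v \<longleftrightarrow> u \<in> verts G \<and> u = v"
| "walk G u (a # p) v \<longleftrightarrow> a \<in> edges G \<and> org G a = u \<and> walk G (ter G a) p v"

definition graph_connected :: "('v, 'e) sgraph \<Rightarrow> bool" where
  "graph_connected G \<longleftrightarrow>
     verts G \<noteq> {} \<and> (\<forall>u\<in>verts G. \<forall>v\<in>verts G. \<exists>p. walk G u p v)"

text \<open>Loops are circuits of length 1; two distinct edges \<open>a, b\<close> with the same endpoints give the
  circuit \<open>[a, opp G b]\<close> of length 2.\<close>

definition circuit :: "('v, 'e) sgraph \<Rightarrow> 'e list \<Rightarrow> bool" where
  "circuit G p \<longleftrightarrow>
     p \<noteq> [] \<and> (\<exists>u. walk G u p u) \<and> distinct (map (ter G) p) \<and>
     (\<forall>i. Suc i < length p \<longrightarrow> p ! Suc i \<noteq> opp G (p ! i))"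

definition is_tree :: "('v, 'e) sgraph \<Rightarrow> bool" where
  "is_tree G \<longleftrightarrow> serre_graph G \<and> graph_connected G \<and> \<not> (\<exists>p. circuit G p)"

definition restrict_graph :: "('v, 'e) sgraph \<Rightarrow> 'v set \<Rightarrow> 'e set \<Rightarrow> ('v, 'e) sgraph" where
  "restrict_graph G V E = G\<lparr>verts := V, edges := E\<rparr>"

definition is_subtree :: "('v, 'e) sgraph \<Rightarrow> 'v set \<Rightarrow> 'e set \<Rightarrow> bool" where
  "is_subtree G V E \<longleftrightarrow> V \<subseteq> verts G \<and> E \<subseteq> edges G \<and> is_tree (restrict_graph G V E)"

definition maximal_subtree :: "('v, 'e) sgraph \<Rightarrow> 'v set \<Rightarrow> 'e set \<Rightarrow> bool" where
  "maximal_subtree G V E \<longleftrightarrow>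
     is_subtree G V E \<and>
     (\<forall>V' E'. is_subtree G V' E' \<and> V \<subseteq> V' \<and> E \<subseteq> E' \<longrightarrow> V' = V \<and> E' = E)"

definition orientation :: "('v, 'e) sgraph \<Rightarrow> 'e set \<Rightarrow> bool" where
  "orientation G Ep \<longleftrightarrow> Ep \<union> opp G ` Ep = edges G \<and> Ep \<inter> opp G ` Ep = {}"


section \<open>Fields of graphs and arboretums\<close>

record ('x, 'v, 'e) graph_field =
  vfib :: "('x, 'v) fibred"
  efib :: "('x, 'e) fibred"
  forg :: "'e \<Rightarrow> 'v"
  fter :: "'e \<Rightarrow> 'v"
  fopp :: "'e \<Rightarrow> 'e"

definition graph_on ::
  "('x, 'v, 'e) graph_field \<Rightarrow> 'v set \<Rightarrow> 'e set \<Rightarrow> ('v, 'e) sgraph" where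
  "graph_on A V E = \<lparr>verts = V, edges = E, org = forg A, ter = fter A, opp = fopp A\<rparr>"

definition fibre_on ::
  "('x, 'v, 'e) graph_field \<Rightarrow> 'v set \<Rightarrow> 'e set \<Rightarrow> 'x \<Rightarrow> ('v, 'e) sgraph" where
  "fibre_on A V E x =
     graph_on A {v \<in> V. proj (vfib A) v = x} {e \<in> E. proj (efib A) e = x}"

definition R_graph_field ::
  "'x measure \<Rightarrow> ('x \<times> 'x) set \<Rightarrow> ('x, 'v, 'e) graph_field \<Rightarrow> bool" where
  "R_graph_field X R A \<longleftrightarrow>
     R_fibred_standard_space X R (vfib A) \<and> R_fibred_standard_space X R (efib A) \<and>
     serre_graph (graph_on A (space (total_space (vfib A))) (space (total_space (efib A)))) \<and>
     R_morphism R (efib A) (vfib A) (forg A) \<and>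
     R_morphism R (efib A) (vfib A) (fter A) \<and>
     R_morphism R (efib A) (efib A) (fopp A)"

definition R_arboretum ::
  "'x measure \<Rightarrow> ('x \<times> 'x) set \<Rightarrow> ('x, 'v, 'e) graph_field \<Rightarrow> bool" where
  "R_arboretum X R A \<longleftrightarrow>
     R_graph_field X R A \<and>
     (\<forall>x\<in>space X.
        is_tree (fibre_on A (space (total_space (vfib A))) (space (total_space (efib A))) x))"

definition sub_arboretum ::
  "('x, 'v, 'e) graph_field \<Rightarrow> 'x set \<Rightarrow> 'v set \<Rightarrow> 'e set \<Rightarrow> bool" where
  "sub_arboretum A Y V E \<longleftrightarrow>
     V \<in> sets (total_space (vfib A)) \<and> E \<in> sets (total_space (efib A)) \<and>
     proj (vfib A) ` V \<subseteq> Y \<and> proj (efib A) ` E \<subseteq> Y \<and>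
     serre_graph (graph_on A V E) \<and>
     (\<forall>x\<in>Y. is_tree (fibre_on A V E x))"


section \<open>Graphs of relations\<close>

text \<open>\<open>ginj G a\<close> is the injective morphism \<open>j\<^sub>a\<close> attached to the edge \<open>a\<close>, with values in the space
  carried by the terminal vertex of \<open>a\<close>.\<close>

record ('v, 'e, 'p, 'q) rel_graph =
  graph :: "('v, 'e) sgraph"
  vspace :: "'v \<Rightarrow> 'p measure"
  vrel :: "'v \<Rightarrow> ('p \<times> 'p) set"
  espace :: "'e \<Rightarrow> 'q measure"
  erel :: "'e \<Rightarrow> ('q \<times> 'q) set"
  ginj :: "'e \<Rightarrow> 'q \<Rightarrow> 'p"

definition graph_of_relations :: "('v, 'e, 'p, 'q) rel_graph \<Rightarrow> bool" where
  "graph_of_relations G \<longleftrightarrow>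
     serre_graph (graph G) \<and> countable (verts (graph G)) \<and> countable (edges (graph G)) \<and>
     (\<forall>P\<in>verts (graph G). standard_borel (vspace G P) \<and> borel_equiv (vspace G P) (vrel G P)) \<and>
     (\<forall>a\<in>edges (graph G).
        standard_borel (espace G a) \<and> borel_equiv (espace G a) (erel G a) \<and>
        sets (espace G (opp (graph G) a)) = sets (espace G a) \<and>
        erel G (opp (graph G) a) = erel G a \<and>
        ginj G a \<in> measurable (espace G a) (vspace G (ter (graph G) a)) \<and>
        inj_on (ginj G a) (space (espace G a)) \<and>
        (\<forall>(u, v)\<in>erel G a. (ginj G a u, ginj G a v) \<in> vrel G (ter (graph G) a)))"

definition restrict_rel_graph ::
  "('v, 'e, 'p, 'q) rel_graph \<Rightarrow> 'v set \<Rightarrow> 'e set \<Rightarrow> ('v, 'e, 'p, 'q) rel_graph" where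
  "restrict_rel_graph G V E = G\<lparr>graph := restrict_graph (graph G) V E\<rparr>"

definition vsum :: "('v, 'e, 'p, 'q) rel_graph \<Rightarrow> ('v \<times> 'p) measure" where
  "vsum G = borel_sum (verts (graph G)) (vspace G)"

definition esum :: "('v, 'e, 'p, 'q) rel_graph \<Rightarrow> ('e \<times> 'q) measure" where
  "esum G = borel_sum (edges (graph G)) (espace G)"

definition sum_org :: "('v, 'e, 'p, 'q) rel_graph \<Rightarrow> 'e \<times> 'q \<Rightarrow> 'v \<times> 'p" where
  "sum_org G = (\<lambda>(a, u). (org (graph G) a, ginj G (opp (graph G) a) u))"

definition sum_ter :: "('v, 'e, 'p, 'q) rel_graph \<Rightarrow> 'e \<times> 'q \<Rightarrow> 'v \<times> 'p" where
  "sum_ter G = (\<lambda>(a, u). (ter (graph G) a, ginj G a u))"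

text \<open>The graph of the partial isomorphism carried by \<open>a\<close> is the set of pairs
  \<open>(sum_org G (a, u), sum_ter G (a, u))\<close> with \<open>u\<close> in the space carried by \<open>a\<close>.\<close>

definition generated_rel ::
  "('v, 'e, 'p, 'q) rel_graph \<Rightarrow> (('v \<times> 'p) \<times> ('v \<times> 'p)) set" where
  "generated_rel G =
     (let S = (\<lambda>e. (sum_org G e, sum_ter G e)) ` space (esum G)
      in (S \<union> S\<inverse>)\<^sup>* \<inter> (space (vsum G) \<times> space (vsum G)))"

definition rooted_tree_of_relations :: "('v, 'e, 'p, 'q) rel_graph \<Rightarrow> 'v \<Rightarrow> bool" where
  "rooted_tree_of_relations G P0 \<longleftrightarrow>
     graph_of_relations G \<and> is_tree (graph G) \<and> P0 \<in> verts (graph G) \<and>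
     fundamental_domain (vsum G) (generated_rel G) ({P0} \<times> space (vspace G P0))"

definition root_proj :: "('v, 'e, 'p, 'q) rel_graph \<Rightarrow> 'v \<Rightarrow> 'v \<times> 'p \<Rightarrow> 'p" where
  "root_proj G P0 w =
     (THE z. z \<in> space (vspace G P0) \<and> (w, (P0, z)) \<in> generated_rel G)"

text \<open>The arboretum over the space carried by the root; its action is that of the trivial
  relation.\<close>

definition tree_arboretum ::
  "('v, 'e, 'p, 'q) rel_graph \<Rightarrow> 'v \<Rightarrow> ('p, 'v \<times> 'p, 'e \<times> 'q) graph_field" where
  "tree_arboretum G P0 =
     \<lparr>vfib = \<lparr>total_space = vsum G, proj = root_proj G P0, act = (\<lambda>x y w. w)\<rparr>,
      efib = \<lparr>total_space = esum G, proj = root_proj G P0 \<circ> sum_org G, act = (\<lambda>x y e. e)\<rparr>,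
      forg = sum_org G,
      fter = sum_ter G,
      fopp = (\<lambda>(a, u). (opp (graph G) a, u))\<rparr>"


section \<open>Representations\<close>

definition arboretum_iso_over ::
  "('p \<Rightarrow> 'x) \<Rightarrow> ('p, 'v, 'e) graph_field \<Rightarrow> ('x, 'w, 'f) graph_field \<Rightarrow> 'w set \<Rightarrow> 'f set \<Rightarrow>
   ('v \<Rightarrow> 'w) \<Rightarrow> ('e \<Rightarrow> 'f) \<Rightarrow> bool" where
  "arboretum_iso_over \<theta> T A V E \<chi>0 \<chi>1 \<longleftrightarrow>
     borel_iso (total_space (vfib T)) (restrict_space (total_space (vfib A)) V) \<chi>0 \<and>
     borel_iso (total_space (efib T)) (restrict_space (total_space (efib A)) E) \<chi>1 \<and>
     (\<forall>w\<in>space (total_space (vfib T)). proj (vfib A) (\<chi>0 w) = \<theta> (proj (vfib T) w)) \<and>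
     (\<forall>e\<in>space (total_space (efib T)).
        proj (efib A) (\<chi>1 e) = \<theta> (proj (efib T) e) \<and>
        forg A (\<chi>1 e) = \<chi>0 (forg T e) \<and>
        fter A (\<chi>1 e) = \<chi>0 (fter T e) \<and>
        fopp A (\<chi>1 e) = \<chi>1 (fopp T e))"

definition vrep ::
  "('v, 'e, 'p, 'q) rel_graph \<Rightarrow> ('v \<times> 'p \<Rightarrow> 'w) \<Rightarrow> 'v \<Rightarrow> 'w set" where
  "vrep G \<chi>0 P = \<chi>0 ` ({P} \<times> space (vspace G P))"

definition erep ::
  "('v, 'e, 'p, 'q) rel_graph \<Rightarrow> ('e \<times> 'q \<Rightarrow> 'f) \<Rightarrow> 'e \<Rightarrow> 'f set" where
  "erep G \<chi>1 a = \<chi>1 ` ({a} \<times> space (espace G a))"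

definition representation ::
  "'x measure \<Rightarrow> ('x \<times> 'x) set \<Rightarrow> ('x, 'w, 'f) graph_field \<Rightarrow>
   ('v, 'e, 'p, 'q) rel_graph \<Rightarrow> 'v \<Rightarrow> 'x set \<Rightarrow>
   ('p \<Rightarrow> 'x) \<Rightarrow> ('v \<times> 'p \<Rightarrow> 'w) \<Rightarrow> ('e \<times> 'q \<Rightarrow> 'f) \<Rightarrow> bool" where
  "representation X R A G P0 Y \<theta> \<chi>0 \<chi>1 \<longleftrightarrow>
     Y \<in> sets X \<and>
     borel_iso (vspace G P0) (restrict_space X Y) \<theta> \<and>
     (\<exists>V E. sub_arboretum A Y V E \<and>
        arboretum_iso_over \<theta> (tree_arboretum G P0) A V E \<chi>0 \<chi>1) \<and>
     (\<forall>P\<in>verts (graph G).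
        rel_iso (vspace G P) (vrel G P)
          (restrict_space (total_space (vfib A)) (vrep G \<chi>0 P))
          (Restr (orbit_rel R (vfib A)) (vrep G \<chi>0 P))
          (\<lambda>u. \<chi>0 (P, u))) \<and>
     (\<forall>a\<in>edges (graph G).
        rel_iso (espace G a) (erel G a)
          (restrict_space (total_space (efib A)) (erep G \<chi>1 a))
          (Restr (orbit_rel R (efib A)) (erep G \<chi>1 a))
          (\<lambda>u. \<chi>1 (a, u)))"

text \<open>Parts of a Borel partition are allowed to be empty.\<close>

definition arboretum_of_representatives ::
  "'x measure \<Rightarrow> ('x \<times> 'x) set \<Rightarrow> ('x, 'w, 'f) graph_field \<Rightarrow>
   ('v, 'e, 'p, 'q) rel_graph \<Rightarrow> 'v \<Rightarrow> 'x set \<Rightarrow>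
   ('p \<Rightarrow> 'x) \<Rightarrow> ('v \<times> 'p \<Rightarrow> 'w) \<Rightarrow> ('e \<times> 'q \<Rightarrow> 'f) \<Rightarrow> bool" where
  "arboretum_of_representatives X R A G P0 Y \<theta> \<chi>0 \<chi>1 \<longleftrightarrow>
     rooted_tree_of_relations G P0 \<and>
     representation X R A G P0 Y \<theta> \<chi>0 \<chi>1 \<and>
     disjoint_family_on (\<lambda>P. saturation (orbit_rel R (vfib A)) (vrep G \<chi>0 P)) (verts (graph G)) \<and>
     (\<Union>P\<in>verts (graph G). saturation (orbit_rel R (vfib A)) (vrep G \<chi>0 P))
       = space (total_space (vfib A))"


section \<open>Desingularizations\<close>

text \<open>\<open>tverts\<close> and \<open>tedges\<close> are the vertices and edges of the maximal subtree, \<open>root\<close> its root and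
  \<open>root_iso\<close> the identification of the space of the root with the base space. For an edge \<open>a\<close> of
  the orientation outside the subtree, \<open>src a\<close> is the source of the partial isomorphism \<open>phi a\<close>,
  and \<open>sect a\<close> the partial section of edges.\<close>

record ('x, 'w, 'f, 'v, 'e, 'p, 'q) desing =
  rgraph :: "('v, 'e, 'p, 'q) rel_graph"
  orient :: "'e set"
  tverts :: "'v set"
  tedges :: "'e set"
  root :: "'v"
  root_iso :: "'p \<Rightarrow> 'x"
  vchi :: "'v \<times> 'p \<Rightarrow> 'w"
  echi :: "'e \<times> 'q \<Rightarrow> 'f"
  src :: "'e \<Rightarrow> 'x set"
  phi :: "'e \<Rightarrow> 'x \<Rightarrow> 'x"
  sect :: "'e \<Rightarrow> 'x \<Rightarrow> 'f"

text \<open>The space carried by \<open>opp a\<close> is that carried by \<open>a\<close>, represented by the opposite edges (for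
  the edges of the subtree this is a property of \<open>echi\<close>).\<close>

definition edge_rep ::
  "('x, 'w, 'f) graph_field \<Rightarrow> ('x, 'w, 'f, 'v, 'e, 'p, 'q) desing \<Rightarrow> 'e \<Rightarrow> 'f set" where
  "edge_rep A D a =
     (if a \<in> tedges D then erep (rgraph D) (echi D) a
      else if a \<in> orient D then sect D a ` src D a
      else fopp A ` sect D (opp (graph (rgraph D)) a) ` src D (opp (graph (rgraph D)) a))"

definition image_rel :: "('a \<Rightarrow> 'b) \<Rightarrow> ('a \<times> 'a) set \<Rightarrow> ('b \<times> 'b) set" where
  "image_rel f R = (\<lambda>(u, v). (f u, f v)) ` R"

text \<open>In the third block, sub-relations of \<open>R\<close> are compared with sub-relations of the \<open>vrel G P\<close>
  through the identification of \<open>vspace G P\<close> with a Borel subset of \<open>X\<close> by the projection of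
  \<open>vchi\<close>.

  In the last block the parts are indexed by all edges of \<open>G\<close>, and parts of distinct edges are
  disjoint, with one proviso: the parts of two opposite edges may coincide. No action identifies
  an edge with its opposite within a fibre, but an edge \<open>e\<close> over \<open>x\<close> may be equivalent to the
  opposite of \<open>e'\<close> over \<open>y\<close>, with \<open>e, e'\<close> in the image of the same section. Take for instance a
  free action of the integers on \<open>X\<close> whose even subgroup acts ergodically, all fibres being one
  segment that odd integers flip: any saturated Borel set of edges is then null or conull, as is
  the set of opposite edges, and it cannot be disjoint from it unless null. This
  concerns only loops of \<open>G\<close>: for the other edges the endpoints force disjointness.\<close>

definition desingularization ::
  "'x measure \<Rightarrow> ('x \<times> 'x) set \<Rightarrow> ('x, 'w, 'f) graph_field \<Rightarrow>
   ('x, 'w, 'f, 'v, 'e, 'p, 'q) desing \<Rightarrow> bool" where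
  "desingularization X R A D \<longleftrightarrow>
     (let G = rgraph D; g = graph G; sat = saturation (orbit_rel R (efib A)) in
       graph_of_relations G \<and> graph_connected g \<and> orientation g (orient D) \<and>
       maximal_subtree g (tverts D) (tedges D) \<and> root D \<in> tverts D \<and>
       (\<forall>a \<in> orient D - tedges D. full_pseudogroup X R (src D a) (phi D a)) \<and>

       arboretum_of_representatives X R A (restrict_rel_graph G (tverts D) (tedges D))
         (root D) (space X) (root_iso D) (vchi D) (echi D) \<and>

       (\<forall>a \<in> orient D - tedges D.
          partial_section X (efib A) (src D a) (sect D a) \<and>
          (\<forall>x\<in>src D a.
             forg A (sect D a x) \<in> vrep G (vchi D) (org g a) \<and>
             act (vfib A) (phi D a x) x (fter A (sect D a x)) \<in> vrep G (vchi D) (ter g a))) \<and>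

       (\<forall>a \<in> orient D - tedges D.
          rel_iso
            (restrict_space (vspace G (org g a)) (ginj G (opp g a) ` space (espace G (opp g a))))
            (image_rel (ginj G (opp g a)) (erel G (opp g a)))
            (restrict_space X (src D a))
            (Stab R (efib A) (src D a) (sect D a))
            (\<lambda>u. proj (vfib A) (vchi D (org g a, u))) \<and>
          rel_iso
            (restrict_space (vspace G (ter g a)) (ginj G a ` space (espace G a)))
            (image_rel (ginj G a) (erel G a))
            (restrict_space X (phi D a ` src D a))
            (image_rel (phi D a) (Stab R (efib A) (src D a) (sect D a)))
            (\<lambda>u. proj (vfib A) (vchi D (ter g a, u)))) \<and>

       (\<Union>a\<in>edges g. sat (edge_rep A D a)) = space (total_space (efib A)) \<and>
       (\<forall>a\<in>edges g. \<forall>b\<in>edges g. a \<noteq> b \<longrightarrow>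
          sat (edge_rep A D a) \<inter> sat (edge_rep A D b) = {} \<or>
          b = opp g a \<and> sat (edge_rep A D a) = sat (edge_rep A D b)))"

end

theory Submission
  imports Defs
begin

text \<open>Choose a Borel section of the vertices and let the tree grow: attach to the vertices already chosen
  the edges that lead to a new orbit, one partial section at a time. By connectedness of the fibres
  every orbit of vertices is reached, once. The remaining edges are translated so that they start at
  a chosen vertex, sorted by a countable family of partial sections and by the element of the
  pseudogroup that carries their end to a chosen vertex, and thinned out to one part per orbit.

  All this needs that countable-to-one Borel maps split into countably many injective ones, and that
  injective Borel images are Borel. Both are obtained on codings by closed sets of sequences of
  integers, which can be refined until countably many given Borel sets become clopen.\<close>

section \<open>Codings of standard Borel spaces\<close>

text \<open>Finite prefixes are what makes codings convenient: there are only countably many of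
  them, so choices made for each prefix, or for each pair of prefixes, can be recombined by
  countable unions and intersections of Borel sets, while closedness of the code supplies the limit
  points.

  In the construction itself every space carried by a vertex or an edge is a Borel subset of
  \<open>X\<close>, a section being replaced by its projection. The partial isomorphisms of tree
  edges are then restrictions of the identity, and the relation that they generate compares base
  points only. The other edges start at a chosen vertex but reach one only after a displacement in
  \<open>[[R]]\<close>, which is why only their second morphism moves points.

  The numbering of the vertex sets is also what makes the graph a tree: tree edge number
  \<open>n\<close> joins \<open>p n \<le> n\<close> to \<open>Suc n\<close>. Parts may be empty, so
  the index set is always that of all natural numbers and no construction has to stop.\<close>

text \<open>A coding identifies the space with a closed subset of the Baire space; a set is decided when it is
  clopen for that topology.\<close>

definition closed_code :: "'a set \<Rightarrow> ('a \<Rightarrow> nat \<Rightarrow> nat) \<Rightarrow> bool" where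
  "closed_code S c \<longleftrightarrow> (\<forall>\<alpha>. (\<forall>n. \<exists>z\<in>S. \<forall>i<n. c z i = \<alpha> i) \<longrightarrow> (\<exists>z\<in>S. c z = \<alpha>))"

definition coding :: "'a measure \<Rightarrow> ('a \<Rightarrow> nat \<Rightarrow> nat) \<Rightarrow> bool" where
  "coding M c \<longleftrightarrow>
     (\<forall>n. (\<lambda>z. c z n) \<in> measurable M (count_space UNIV)) \<and> inj_on c (space M) \<and>
     closed_code (space M) c \<and>
     sets M \<subseteq> sigma_sets (space M) {{z \<in> space M. c z n = m} |n m. True}"

definition agree :: "('a \<Rightarrow> nat \<Rightarrow> nat) \<Rightarrow> nat \<Rightarrow> 'a \<Rightarrow> 'a \<Rightarrow> bool" where
  "agree c n z w \<longleftrightarrow> (\<forall>i<n. c z i = c w i)"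

definition decides :: "('a \<Rightarrow> nat \<Rightarrow> nat) \<Rightarrow> 'a set \<Rightarrow> 'a set \<Rightarrow> bool" where
  "decides c S B \<longleftrightarrow>
     (\<exists>n. \<forall>z\<in>S. \<forall>w\<in>S. agree c n z w \<longrightarrow> (z \<in> B \<longleftrightarrow> w \<in> B))"

text \<open>For the usual ultrametric on sequences this is uniform continuity of \<open>c0\<close>
  as a function of \<open>c\<close>: \<open>N\<close> depends on the coordinate alone. In
  \<open>decides\<close>, too, one prefix length serves all points, which is more than clopen and
  survives every refinement.\<close>

definition refines :: "'a set \<Rightarrow> ('a \<Rightarrow> nat \<Rightarrow> nat) \<Rightarrow> ('a \<Rightarrow> nat \<Rightarrow> nat) \<Rightarrow> bool" where
  "refines S c0 c \<longleftrightarrow>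
     (\<forall>n. \<exists>N. \<forall>z\<in>S. \<forall>w\<in>S. agree c N z w \<longrightarrow> c0 z n = c0 w n)"

text \<open>Injectivity and generation of the sigma-algebra are inherited from \<open>c0\<close>,
  see \<open>coding_refinement\<close>.\<close>

definition refinement :: "'a measure \<Rightarrow> ('a \<Rightarrow> nat \<Rightarrow> nat) \<Rightarrow> ('a \<Rightarrow> nat \<Rightarrow> nat) \<Rightarrow> bool" where
  "refinement M c0 c \<longleftrightarrow>
     (\<forall>n. (\<lambda>z. c z n) \<in> measurable M (count_space UNIV)) \<and> closed_code (space M) c \<and>
     refines (space M) c0 c"

lemma agree_mono: "agree c n z w \<Longrightarrow> m \<le> n \<Longrightarrow> agree c m z w"
  by (simp add: agree_def)

lemma coding_inj: "coding M c \<Longrightarrow> inj_on c (space M)"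
  and coding_closed: "coding M c \<Longrightarrow> closed_code (space M) c"
  and coding_measurable: "coding M c \<Longrightarrow> (\<lambda>z. c z n) \<in> measurable M (count_space UNIV)"
  and coding_generates: "coding M c \<Longrightarrow> sets M \<subseteq> sigma_sets (space M) {{z \<in> space M. c z n = m} |n m. True}"
  unfolding coding_def by simp_all

lemma code_sets: "coding M c \<Longrightarrow> {z \<in> space M. c z n = m} \<in> sets M"
  using measurable_sets[OF coding_measurable, of M c "{m}" n]
  by (simp add: vimage_def Int_def conj_commute)

lemma coding_sets:
  assumes "coding M c"
  shows "sets M = sigma_sets (space M) {{z \<in> space M. c z n = m} |n m. True}"
proof (rule subset_antisym[OF coding_generates[OF assms]], rule sets.sigma_sets_subset)
  show "{{z \<in> space M. c z n = m} |n m. True} \<subseteq> sets M"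
    using code_sets[OF assms] by blast
qed

lemma refines_prefix:
  assumes "refines S c0 c"
  shows "\<exists>N. \<forall>z\<in>S. \<forall>w\<in>S. agree c N z w \<longrightarrow> agree c0 n z w"
proof (induction n)
  case 0
  show ?case by (simp add: agree_def)
next
  case (Suc n)
  then obtain N where N: "\<And>z w. z\<in>S \<Longrightarrow> w\<in>S \<Longrightarrow> agree c N z w \<Longrightarrow> agree c0 n z w"
    by blast
  obtain K where K: "\<And>z w. z\<in>S \<Longrightarrow> w\<in>S \<Longrightarrow> agree c K z w \<Longrightarrow> c0 z n = c0 w n"
    using assms unfolding refines_def by blast
  have "agree c0 (Suc n) z w" if "z \<in> S" "w \<in> S" "agree c (max N K) z w" for z w
    using N[of z w] K[of z w] that agree_mono[OF that(3)]
    by (simp add: agree_def less_Suc_eq)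
  then show ?case by blast
qed

lemma refines_trans:
  assumes "refines S c0 c" "refines S c c'"
  shows "refines S c0 c'"
  unfolding refines_def
proof
  fix n
  obtain N where N: "\<And>z w. z\<in>S \<Longrightarrow> w\<in>S \<Longrightarrow> agree c N z w \<Longrightarrow> c0 z n = c0 w n"
    using assms(1) unfolding refines_def by blast
  obtain K where K: "\<And>z w. z\<in>S \<Longrightarrow> w\<in>S \<Longrightarrow> agree c' K z w \<Longrightarrow> agree c N z w"
    using refines_prefix[OF assms(2), of N] by blast
  show "\<exists>N. \<forall>z\<in>S. \<forall>w\<in>S. agree c' N z w \<longrightarrow> c0 z n = c0 w n"
    using N K by blast
qed

lemma decides_refines:
  assumes "decides c S B" "refines S c c'"
  shows "decides c' S B"
proof -
  obtain n where n: "\<And>z w. z\<in>S \<Longrightarrow> w\<in>S \<Longrightarrow> agree c n z w \<Longrightarrow> (z \<in> B \<longleftrightarrow> w \<in> B)"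
    using assms(1) unfolding decides_def by blast
  obtain K where K: "\<And>z w. z\<in>S \<Longrightarrow> w\<in>S \<Longrightarrow> agree c' K z w \<Longrightarrow> agree c n z w"
    using refines_prefix[OF assms(2), of n] by blast
  show ?thesis
    unfolding decides_def using n K by blast
qed

definition join_code :: "(nat \<Rightarrow> 'a \<Rightarrow> nat \<Rightarrow> nat) \<Rightarrow> 'a \<Rightarrow> nat \<Rightarrow> nat" where
  "join_code c z k = c (fst (prod_decode k)) z (snd (prod_decode k))"

lemma join_code_encode [simp]: "join_code c z (prod_encode (i, m)) = c i z m"
  by (simp add: join_code_def)

lemma prod_encode_bound: "\<exists>N. \<forall>m<n. prod_encode (i, m) < (N::nat)"
proof
  show "\<forall>m<n. prod_encode (i, m) < Suc (\<Sum>m<n. prod_encode (i, m))"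
    by (auto simp: less_Suc_eq_le intro!: member_le_sum)
qed

lemma refines_join: "refines S (c i) (join_code c)"
  unfolding refines_def
proof
  fix n
  have "c i z n = c i w n" if "agree (join_code c) (Suc (prod_encode (i, n))) z w" for z w
    using that[unfolded agree_def, rule_format, of "prod_encode (i, n)"] by simp
  then show "\<exists>N. \<forall>z\<in>S. \<forall>w\<in>S. agree (join_code c) N z w \<longrightarrow> c i z n = c i w n"
    by blast
qed

text \<open>The limits found for the single codings coincide because they have the same \<open>c0\<close>-coordinates.\<close>

lemma closed_code_join:
  assumes inj: "inj_on c0 S" and cl: "\<And>i. closed_code S (c i)" and ref: "\<And>i. refines S c0 (c i)"
  shows "closed_code S (join_code c)"
  unfolding closed_code_def
proof (intro allI impI)
  fix \<alpha> assume \<alpha>: "\<forall>n. \<exists>z\<in>S. \<forall>i<n. join_code c z i = \<alpha> i"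
  have "\<exists>z\<in>S. c i z = (\<lambda>m. \<alpha> (prod_encode (i, m)))" for i
  proof (rule cl[unfolded closed_code_def, rule_format])
    fix n
    obtain N where N: "\<forall>m<n. prod_encode (i, m) < N"
      using prod_encode_bound by blast
    obtain z where "z \<in> S" "\<forall>k<N. join_code c z k = \<alpha> k"
      using \<alpha> by blast
    then show "\<exists>z\<in>S. \<forall>m<n. c i z m = \<alpha> (prod_encode (i, m))"
      using N by (metis join_code_encode)
  qed
  then obtain z where z: "\<And>i. z i \<in> S" "\<And>i. c i (z i) = (\<lambda>m. \<alpha> (prod_encode (i, m)))"
    by metis
  have "z i = z 0" for i
  proof -
    have "c0 (z i) n = c0 (z 0) n" for n
    proof -
      obtain K where K: "\<And>u w. u\<in>S \<Longrightarrow> w\<in>S \<Longrightarrow> agree (c i) K u w \<Longrightarrow> c0 u n = c0 w n"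
        using ref[of i] unfolding refines_def by blast
      obtain L where L: "\<And>u w. u\<in>S \<Longrightarrow> w\<in>S \<Longrightarrow> agree (c 0) L u w \<Longrightarrow> c0 u n = c0 w n"
        using ref[of 0] unfolding refines_def by blast
      obtain N1 where N1: "\<forall>m<K. prod_encode (i, m) < N1"
        using prod_encode_bound by blast
      obtain N2 where N2: "\<forall>m<L. prod_encode (0, m) < N2"
        using prod_encode_bound by blast
      \<comment> \<open>A single \<open>w\<close> that follows \<open>\<alpha>\<close> far enough
        agrees with both limits on the prefixes that fix coordinate \<open>n\<close> of
        \<open>c0\<close>.\<close>
      obtain w where w: "w \<in> S" "\<forall>k<max N1 N2. join_code c w k = \<alpha> k"
        using \<alpha> by blast
      have "c i w m = c i (z i) m" if "m < K" for m
        using w(2)[rule_format, of "prod_encode (i, m)"] N1 that z(2)[of i] by auto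
      then have "agree (c i) K (z i) w" by (simp add: agree_def)
      moreover have "c 0 w m = c 0 (z 0) m" if "m < L" for m
        using w(2)[rule_format, of "prod_encode (0, m)"] N2 that z(2)[of 0] by auto
      then have "agree (c 0) L (z 0) w" by (simp add: agree_def)
      ultimately show ?thesis
        using K[OF z(1)[of i] w(1)] L[OF z(1)[of 0] w(1)] by simp
    qed
    then show ?thesis
      by (intro inj_onD[OF inj] ext z(1))
  qed
  then have "c i (z 0) m = \<alpha> (prod_encode (i, m))" for i m
    using z(2)[of i] by metis
  then have "join_code c (z 0) k = \<alpha> k" for k
    by (simp add: join_code_def)
  then show "\<exists>z\<in>S. join_code c z = \<alpha>"
    using z(1)[of 0] by blast
qed

lemma refinement_join:
  assumes "inj_on c0 (space M)" "\<And>i. refinement M c0 (c i)"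
  shows "refinement M c0 (join_code c)"
  unfolding refinement_def
proof (intro conjI allI)
  show "(\<lambda>z. join_code c z n) \<in> measurable M (count_space UNIV)" for n
    using assms(2) unfolding refinement_def join_code_def by blast
  show "closed_code (space M) (join_code c)"
    using assms closed_code_join unfolding refinement_def by blast
  show "refines (space M) c0 (join_code c)"
    using assms(2)[of 0] refines_trans refines_join unfolding refinement_def by blast
qed

text \<open>A new coordinate records the first \<open>B i\<close> containing the point. It passes to limits because every
  \<open>B i\<close> is already decided.\<close>

lemma decides_Union:
  fixes B :: "nat \<Rightarrow> 'a set"
  assumes c: "refinement M c0 c" and B: "\<And>i. B i \<in> sets M" and dec: "\<And>i. decides c (space M) (B i)"
  shows "\<exists>c'. refinement M c0 c' \<and> decides c' (space M) (\<Union>i. B i)"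
proof -
  let ?S = "space M"
  \<comment> \<open>The value 0 is reserved for points outside the union; hence the shift of the
    index by one.\<close>
  define g where "g z = (if z \<in> (\<Union>i. B i) then Suc (LEAST i. z \<in> B i) else 0)" for z
  define c' where "c' z = case_nat (g z) (c z)" for z
  note [measurable] = B
  have [measurable]: "g \<in> measurable M (count_space UNIV)"
    unfolding g_def by measurable
  have "(\<lambda>z. c' z n) \<in> measurable M (count_space UNIV)" for n
    using c by (cases n) (auto simp: c'_def refinement_def)
  moreover have ref: "refines ?S c c'"
    unfolding refines_def
  proof
    fix n
    have "c z n = c w n" if "agree c' (Suc (Suc n)) z w" for z w
      using that[unfolded agree_def, rule_format, of "Suc n"] by (simp add: c'_def)
    then show "\<exists>N. \<forall>z\<in>?S. \<forall>w\<in>?S. agree c' N z w \<longrightarrow> c z n = c w n"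
      by blast
  qed
  moreover have "closed_code ?S c'"
    unfolding closed_code_def
  proof (intro allI impI)
    fix \<alpha> assume \<alpha>: "\<forall>n. \<exists>z\<in>?S. \<forall>i<n. c' z i = \<alpha> i"
    have "\<exists>z\<in>?S. \<forall>i<n. c z i = \<alpha> (Suc i)" for n
    proof -
      obtain z where "z \<in> ?S" "\<forall>i<Suc n. c' z i = \<alpha> i"
        using \<alpha> by blast
      moreover have "c z i = \<alpha> (Suc i)" if "i < n" for i
        using \<open>\<forall>i<Suc n. c' z i = \<alpha> i\<close>[rule_format, of "Suc i"] that by (simp add: c'_def)
      ultimately show ?thesis by blast
    qed
    then obtain z where z: "z \<in> ?S" "c z = (\<lambda>i. \<alpha> (Suc i))"
      using c unfolding refinement_def closed_code_def by (metis (no_types, lifting))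
    have near: "\<exists>w\<in>?S. g w = \<alpha> 0 \<and> (z \<in> B i \<longleftrightarrow> w \<in> B i)" for i
    proof -
      obtain n where n: "\<And>z w. z\<in>?S \<Longrightarrow> w\<in>?S \<Longrightarrow> agree c n z w \<Longrightarrow> (z \<in> B i \<longleftrightarrow> w \<in> B i)"
        using dec unfolding decides_def by blast
      obtain w where w: "w \<in> ?S" "\<forall>i<Suc n. c' w i = \<alpha> i"
        using \<alpha> by blast
      have "agree c n z w"
        unfolding agree_def
      proof (intro allI impI)
        fix i assume "i < n"
        then show "c z i = c w i"
          using w(2)[rule_format, of "Suc i"] z(2) by (simp add: c'_def)
      qed
      moreover have "g w = \<alpha> 0"
        using w(2)[rule_format, of 0] by (simp add: c'_def)
      ultimately show ?thesis
        using n[OF z(1) w(1)] w(1) by blast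
    qed
    have "g z = \<alpha> 0"
    proof (cases "\<alpha> 0")
      case 0
      have "z \<notin> B i" for i
        using near[of i] 0 by (auto simp: g_def split: if_splits)
      then show ?thesis
        using 0 by (simp add: g_def)
    next
      case (Suc m)
      have least: "w \<in> B m \<and> (\<forall>i<m. w \<notin> B i)" if "g w = \<alpha> 0" for w
        using that Suc by (auto simp: g_def split: if_splits intro: LeastI dest: not_less_Least)
      have "z \<in> B m" using near[of m] least by blast
      moreover have "z \<notin> B i" if "i < m" for i using near[of i] least that by blast
      ultimately have "(LEAST i. z \<in> B i) = m"
        by (intro Least_equality) (auto simp: not_less[symmetric])
      then show ?thesis
        using Suc \<open>z \<in> B m\<close> by (auto simp: g_def)
    qed
    then have "c' z = \<alpha>"
      using z(2) by (auto simp: c'_def fun_eq_iff split: nat.split)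
    then show "\<exists>z\<in>?S. c' z = \<alpha>"
      using z(1) by blast
  qed
  moreover have "decides c' ?S (\<Union>i. B i)"
    unfolding decides_def
  proof (intro exI[of _ "Suc 0"] ballI impI)
    fix z w assume "agree c' (Suc 0) z w"
    then have "g z = g w" by (simp add: c'_def agree_def)
    then show "(z \<in> (\<Union>i. B i)) = (w \<in> (\<Union>i. B i))"
      by (auto simp: g_def split: if_splits)
  qed
  ultimately show ?thesis
    using c refines_trans unfolding refinement_def by blast
qed

lemma refines_refl: "refines S c c"
  unfolding refines_def
proof
  fix n
  show "\<exists>N. \<forall>z\<in>S. \<forall>w\<in>S. agree c N z w \<longrightarrow> c z n = c w n"
    by (rule exI[of _ "Suc n"]) (simp add: agree_def)
qed

lemma refinement_refl: "coding M c \<Longrightarrow> refinement M c c"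
  by (simp add: coding_def refinement_def refines_refl)

text \<open>Induction on the Borel set, starting from the sets \<open>c0 z n = m\<close>, which
  \<open>c0\<close> itself decides. A complement is decided by the same refinement. For a union the
  refinements of the members are joined, so that all members are decided at once, and
  \<open>decides_Union\<close> adds one coordinate.\<close>

lemma exists_deciding_sets:
  assumes c0: "coding M c0" and "B \<in> sets M"
  shows "\<exists>c. refinement M c0 c \<and> decides c (space M) B"
proof -
  note meas = code_sets[OF c0]
  have "B \<in> sigma_sets (space M) {{z \<in> space M. c0 z n = m} |n m. True}"
    using coding_generates[OF c0] \<open>B \<in> sets M\<close> by (rule subsetD)
  \<comment> \<open>Measurability is carried along because \<open>decides_Union\<close> asks for it
    of the members.\<close>
  then have "B \<in> sets M \<and> (\<exists>c. refinement M c0 c \<and> decides c (space M) B)"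
  proof induction
    case (Basic a)
    then obtain n m where a: "a = {z \<in> space M. c0 z n = m}" by auto
    have "decides c0 (space M) a"
      unfolding decides_def a by (rule exI[of _ "Suc n"]) (auto simp: agree_def)
    then show ?case using meas[of n m] refinement_refl[OF c0] a
      by (intro conjI exI[of _ c0]) simp_all
  next
    case Empty
    have "decides c0 (space M) {}" by (simp add: decides_def)
    then show ?case using refinement_refl[OF c0] by blast
  next
    case (Compl a)
    then obtain c where "refinement M c0 c" "decides c (space M) a" by auto
    then have "decides c (space M) (space M - a)"
      by (auto simp: decides_def)
    then show ?case using Compl.IH \<open>refinement M c0 c\<close> by (intro conjI exI[of _ c]) auto
  next
    case (Union a)
    have "\<forall>i. \<exists>c. refinement M c0 c \<and> decides c (space M) (a i)"
      by (intro allI conjunct2[OF Union.IH])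
    from choice[OF this] obtain c where c: "\<forall>i. refinement M c0 (c i) \<and> decides (c i) (space M) (a i)" ..
    then have c: "refinement M c0 (c i)" "decides (c i) (space M) (a i)" for i by simp_all
    have 1: "refinement M c0 (join_code c)"
      by (rule refinement_join[OF coding_inj[OF c0] c(1)])
    have 2: "decides (join_code c) (space M) (a i)" for i
      by (rule decides_refines[OF c(2) refines_join])
    have 3: "a i \<in> sets M" for i by (rule conjunct1[OF Union.IH])
    then have "(\<Union>i. a i) \<in> sets M" by (intro sets.countable_nat_UN image_subsetI)
    with decides_Union[OF 1 3 2] show ?case by (intro conjI)
  qed
  then show ?thesis by (rule conjunct2)
qed

text \<open>A set where \<open>c0 z n = m\<close> is a union of cylinders of \<open>c\<close>, since
  some prefix length of \<open>c\<close> fixes that coordinate. As there are only countably many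
  prefixes, the old generators lie in the new sigma-algebra.\<close>

lemma coding_refinement:
  assumes c0: "coding M c0" and c: "refinement M c0 c"
  shows "coding M c"
  unfolding coding_def
proof (intro conjI)
  let ?S = "space M"
  let ?G = "sigma_sets ?S {{z \<in> ?S. c z n = m} |n m. True}"
  show "\<forall>n. (\<lambda>z. c z n) \<in> measurable M (count_space UNIV)" "closed_code ?S c"
    using c unfolding refinement_def by blast+
  show "inj_on c ?S"
  proof (rule inj_onI)
    fix z w assume zw: "z \<in> ?S" "w \<in> ?S" "c z = c w"
    then have "c0 z n = c0 w n" for n
      using c unfolding refinement_def refines_def agree_def by metis
    then show "z = w"
      using zw by (intro inj_onD[OF coding_inj[OF c0]] ext)
  qed
  interpret G: sigma_algebra ?S ?G
    by (intro sigma_algebra_sigma_sets) auto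
  have cyl: "{z \<in> ?S. \<forall>i<length \<sigma>. c z i = \<sigma> ! i} \<in> ?G" for \<sigma> :: "nat list"
  proof -
    have "{z \<in> ?S. \<forall>i\<in>{..<length \<sigma>}. c z i = \<sigma> ! i} \<in> ?G"
      by (rule G.sets_Collect_finite_All) (auto intro: sigma_sets.Basic)
    then show ?thesis by (simp add: Ball_def lessThan_iff)
  qed
  have "{z \<in> ?S. c0 z n = m} \<in> ?G" for n m
  proof -
    obtain N where N: "\<And>z w. z \<in> ?S \<Longrightarrow> w \<in> ?S \<Longrightarrow> agree c N z w \<Longrightarrow> c0 z n = c0 w n"
      using c unfolding refinement_def refines_def by blast
    let ?T = "(\<lambda>z. map (c z) [0..<N]) ` {z \<in> ?S. c0 z n = m}"
    have "{z \<in> ?S. c0 z n = m} = (\<Union>\<sigma>\<in>?T. {z \<in> ?S. \<forall>i<length \<sigma>. c z i = \<sigma> ! i})"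
    proof (intro subset_antisym subsetI)
      fix z assume "z \<in> {z \<in> ?S. c0 z n = m}"
      then show "z \<in> (\<Union>\<sigma>\<in>?T. {z \<in> ?S. \<forall>i<length \<sigma>. c z i = \<sigma> ! i})"
        by (intro UN_I[of "map (c z) [0..<N]"]) auto
    next
      fix z assume "z \<in> (\<Union>\<sigma>\<in>?T. {z \<in> ?S. \<forall>i<length \<sigma>. c z i = \<sigma> ! i})"
      then obtain w where w: "w \<in> ?S" "c0 w n = m" "z \<in> ?S"
        "agree c N z w" by (auto simp: agree_def)
      then show "z \<in> {z \<in> ?S. c0 z n = m}"
        using N[of z w] by auto
    qed
    also have "\<dots> \<in> ?G"
      using cyl by (intro G.countable_UN') (auto simp: countable_subset[OF subset_UNIV])
    finally show ?thesis .
  qed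
  then have "sigma_sets ?S {{z \<in> ?S. c0 z n = m} |n m. True} \<subseteq> ?G"
    by (intro sigma_sets_mono) auto
  with coding_generates[OF c0] show "sets M \<subseteq> ?G"
    by (rule subset_trans)
qed

text \<open>One refinement per set, all joined: \<open>join_code\<close> refines each of them and so
  keeps every decision.\<close>

lemma exists_deciding_coding:
  fixes B :: "nat \<Rightarrow> 'a set"
  assumes c0: "coding M c0" and "\<And>i. B i \<in> sets M"
  shows "\<exists>c. coding M c \<and> (\<forall>i. decides c (space M) (B i))"
proof -
  have "\<forall>i. \<exists>c. refinement M c0 c \<and> decides c (space M) (B i)"
    by (intro allI exists_deciding_sets[OF c0 assms(2)])
  from choice[OF this] obtain c where c: "\<forall>i. refinement M c0 (c i) \<and> decides (c i) (space M) (B i)" ..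
  then have c: "refinement M c0 (c i)" "decides (c i) (space M) (B i)" for i by simp_all
  have "refinement M c0 (join_code c)"
    by (rule refinement_join[OF coding_inj[OF c0] c(1)])
  moreover have "decides (join_code c) (space M) (B i)" for i
    by (rule decides_refines[OF c(2) refines_join])
  ultimately show ?thesis
    using coding_refinement[OF c0] by blast
qed

section \<open>Cylinders and maps between coded spaces\<close>

definition cyl :: "('a \<Rightarrow> nat \<Rightarrow> nat) \<Rightarrow> 'a set \<Rightarrow> nat list \<Rightarrow> 'a set" where
  "cyl c S \<sigma> = {z \<in> S. \<forall>i<length \<sigma>. c z i = \<sigma> ! i}"

definition extends :: "nat list \<Rightarrow> nat list \<Rightarrow> bool" where
  "extends \<sigma> \<rho> \<longleftrightarrow> length \<sigma> < length \<rho> \<and> (\<forall>i<length \<sigma>. \<rho> ! i = \<sigma> ! i)"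

lemma cyl_subset: "cyl c S \<sigma> \<subseteq> S"
  by (auto simp: cyl_def)

lemma mem_cyl_code: "z \<in> S \<Longrightarrow> z \<in> cyl c S (map (c z) [0..<n])"
  by (simp add: cyl_def)

lemma extends_code: "z \<in> cyl c S \<sigma> \<Longrightarrow> length \<sigma> < n \<Longrightarrow> extends \<sigma> (map (c z) [0..<n])"
  by (auto simp: cyl_def extends_def)

lemma cyl_agree:
  assumes "z \<in> cyl c S \<sigma>" "w \<in> cyl c S \<sigma>" "n \<le> length \<sigma>"
  shows "agree c n z w"
  using assms by (auto simp: cyl_def agree_def)

lemma closed_codeD:
  assumes "closed_code S c" "\<And>n. \<exists>z\<in>S. \<forall>i<n. c z i = \<alpha> i"
  shows "\<exists>z\<in>S. c z = \<alpha>"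
  using assms by (simp add: closed_code_def)

text \<open>Strict extensions have unbounded length, so the lists converge to one sequence. Its
  prefixes are realized by points of the nonempty cylinders, and closedness of the code turns it
  into the code of a point.\<close>

lemma branch_point:
  assumes cl: "closed_code S c"
    and ext: "\<And>n. extends (\<tau> n) (\<tau> (Suc n))"
    and ne: "\<And>n. cyl c S (\<tau> n) \<noteq> {}"
  obtains z where "\<And>n. z \<in> cyl c S (\<tau> n)"
proof -
  have len: "n \<le> length (\<tau> n)" for n
  proof (induction n)
    case (Suc n)
    then show ?case using ext[of n] by (simp add: extends_def)
  qed simp
  have coh: "i < length (\<tau> (m + k)) \<and> \<tau> (m + k) ! i = \<tau> m ! i" if "i < length (\<tau> m)" for m k i
  proof (induction k)
    case (Suc k)
    then have "i < length (\<tau> (Suc (m + k)))" "\<tau> (Suc (m + k)) ! i = \<tau> (m + k) ! i"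
      using ext[of "m + k"] by (simp_all add: extends_def)
    with Suc show ?case by simp
  qed (use that in simp)
  \<comment> \<open>Entry \<open>i\<close> is present from stage \<open>Suc i\<close> on, since
    stage \<open>n\<close> has length at least \<open>n\<close>.\<close>
  define \<beta> where "\<beta> i = \<tau> (Suc i) ! i" for i
  have \<beta>: "\<beta> i = \<tau> n ! i" if "i < length (\<tau> n)" for i n
  proof -
    have "i < length (\<tau> (Suc i))"
      using len[of "Suc i"] by simp
    then show ?thesis
      using coh[of i "Suc i" n] coh[of i n "Suc i"] that by (simp add: \<beta>_def add.commute)
  qed
  have "\<exists>z\<in>S. \<forall>i<n. c z i = \<beta> i" for n
  proof -
    obtain z where "z \<in> cyl c S (\<tau> n)" using ne by blast
    then show ?thesis
      using len[of n] \<beta>[of _ n] by (intro bexI[of _ z]) (auto simp: cyl_def)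
  qed
  from closed_codeD[OF cl this] obtain z where "z \<in> S" "c z = \<beta>" by blast
  then have "z \<in> cyl c S (\<tau> n)" for n
    using \<beta> by (simp add: cyl_def)
  then show thesis using that by blast
qed

lemma sets_Collect_ball_mem:
  assumes "countable P" "\<And>p. p \<in> P \<Longrightarrow> A p \<in> sets M"
  shows "{x \<in> space M. \<forall>p\<in>P. x \<in> A p} \<in> sets M"
proof -
  have "{x \<in> space M. \<forall>p\<in>P. x \<in> A p} = space M - (\<Union>p\<in>P. space M - A p)"
    by auto
  also have "\<dots> \<in> sets M"
    using assms by (intro sets.Diff sets.top sets.countable_UN'') auto
  finally show ?thesis .
qed

lemma cyl_sets:
  assumes c: "coding M c"
  shows "cyl c (space M) \<sigma> \<in> sets M"
proof -
  have "{z \<in> space M. \<forall>i\<in>{..<length \<sigma>}. c z i = \<sigma> ! i} \<in> sets M"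
    using code_sets[OF c] by (intro sets.sets_Collect_finite_All) auto
  moreover have "cyl c (space M) \<sigma> = {z \<in> space M. \<forall>i\<in>{..<length \<sigma>}. c z i = \<sigma> ! i}"
    by (auto simp: cyl_def)
  ultimately show ?thesis by simp
qed

text \<open>The last assumption makes \<open>f\<close> continuous for the topologies of the two
  codings: each coordinate of \<open>d (f z)\<close> is fixed near \<open>z\<close> by a prefix of
  \<open>c\<close>.\<close>

locale coded_map =
  fixes M :: "'a measure" and N :: "'b measure" and c :: "'a \<Rightarrow> nat \<Rightarrow> nat" and d :: "'b \<Rightarrow> nat \<Rightarrow> nat"
    and f :: "'a \<Rightarrow> 'b"
  assumes c: "coding M c" and d: "coding N d" and f: "f \<in> measurable M N"
    and dec: "\<And>n m. decides c (space M) {z \<in> space M. d (f z) n = m}"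
begin

abbreviation cy :: "nat list \<Rightarrow> 'a set" where
  "cy \<equiv> cyl c (space M)"

lemma f_space: "z \<in> space M \<Longrightarrow> f z \<in> space N"
  using f by (rule measurable_space)

text \<open>Take a coordinate \<open>n\<close> in which the codes of \<open>f z\<close> and
  \<open>f w\<close> differ. On long cylinders around \<open>z\<close> it has the value at
  \<open>z\<close>, on long cylinders around \<open>w\<close> never; the set where it has this value
  separates.\<close>

lemma separate_images:
  assumes z: "z \<in> space M" and w: "w \<in> space M" and ne: "f z \<noteq> f w"
  shows "\<exists>B\<in>sets N. \<exists>K. \<forall>\<sigma>. K \<le> length \<sigma> \<longrightarrow>
    (z \<in> cy \<sigma> \<longrightarrow> f ` cy \<sigma> \<subseteq> B) \<and> (w \<in> cy \<sigma> \<longrightarrow> f ` cy \<sigma> \<inter> B = {})"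
proof -
  have "d (f z) \<noteq> d (f w)"
    using inj_onD[OF coding_inj[OF d]] f_space z w ne by blast
  then obtain n where n: "d (f z) n \<noteq> d (f w) n"
    by blast
  define B where "B = {x \<in> space N. d x n = d (f z) n}"
  obtain K where K: "\<And>u v. u \<in> space M \<Longrightarrow> v \<in> space M \<Longrightarrow> agree c K u v \<Longrightarrow>
      (d (f u) n = d (f z) n) = (d (f v) n = d (f z) n)"
    using dec[of n "d (f z) n"] unfolding decides_def by blast
  have "f ` cy \<sigma> \<subseteq> B" if "K \<le> length \<sigma>" "z \<in> cy \<sigma>" for \<sigma>
    using K[OF z] cyl_agree[OF that(2) _ that(1)] f_space cyl_subset[of c "space M" \<sigma>]
    by (auto simp: B_def)
  moreover have "f ` cy \<sigma> \<inter> B = {}" if "K \<le> length \<sigma>" "w \<in> cy \<sigma>" for \<sigma>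
    using K[OF w] cyl_agree[OF that(2) _ that(1)] n cyl_subset[of c "space M" \<sigma>]
    by (auto simp: B_def)
  moreover have "B \<in> sets N"
    unfolding B_def by (rule code_sets[OF d])
  ultimately show ?thesis by (intro bexI[of _ B] exI[of _ K]) simp_all
qed

text \<open>The bound \<open>k\<close> makes the two prefixes strict extensions of a given list of
  length \<open>k\<close>.\<close>

lemma code_length_differs:
  assumes "z \<in> space M" "w \<in> space M" "z \<noteq> w"
  obtains n where "n > k" "map (c z) [0..<n] \<noteq> map (c w) [0..<n]"
proof -
  obtain i where i: "c z i \<noteq> c w i"
    using inj_onD[OF coding_inj[OF c]] assms by blast
  have "map (c z) [0..<Suc (max i k)] ! i \<noteq> map (c w) [0..<Suc (max i k)] ! i"
    using i by (simp del: upt_Suc)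
  then show thesis
    by (intro that[of "Suc (max i k)"]) (auto simp del: upt_Suc)
qed

section \<open>The Lusin-Novikov theorem\<close>

text \<open>\<open>small (space M)\<close> is the decomposition that the Lusin-Novikov theorem
  asserts. Stability under countable unions is what allows small sets to be discarded over and
  over.\<close>

definition small :: "'a set \<Rightarrow> bool" where
  "small S \<longleftrightarrow> (\<exists>B::nat \<Rightarrow> 'a set. (\<forall>k. B k \<in> sets M \<and> inj_on f (B k)) \<and> S = (\<Union>k. B k))"

lemma small_single: "B \<in> sets M \<Longrightarrow> inj_on f B \<Longrightarrow> small B"
  unfolding small_def by (intro exI[of _ "\<lambda>k. B"]) auto

lemma small_UN:
  fixes S :: "nat \<Rightarrow> 'a set"
  assumes "\<And>i. small (S i)"
  shows "small (\<Union>i. S i)"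
proof -
  have "\<forall>i. \<exists>B. (\<forall>k::nat. B k \<in> sets M \<and> inj_on f (B k)) \<and> S i = (\<Union>k. B k)"
    using assms by (simp add: small_def)
  from choice[OF this] obtain B where
    B: "\<forall>i. (\<forall>k::nat. B i k \<in> sets M \<and> inj_on f (B i k)) \<and> S i = (\<Union>k. B i k)" ..
  let ?B = "\<lambda>n. B (fst (prod_decode n)) (snd (prod_decode n))"
  have eq: "S i = (\<Union>k. B i k)" for i using B by simp
  have "(\<Union>i. S i) = (\<Union>n. ?B n)"
  proof (intro subset_antisym subsetI)
    fix z assume "z \<in> (\<Union>i. S i)"
    then obtain i k where "z \<in> B i k" unfolding eq by blast
    then show "z \<in> (\<Union>n. ?B n)"
      by (intro UN_I[of "prod_encode (i, k)"]) auto
  next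
    fix z assume "z \<in> (\<Union>n. ?B n)"
    then show "z \<in> (\<Union>i. S i)" unfolding eq by blast
  qed
  moreover have "\<forall>n. ?B n \<in> sets M \<and> inj_on f (?B n)" using B by simp
  ultimately show ?thesis
    unfolding small_def by (intro exI[of _ ?B] conjI)
qed

lemma small_empty: "small {}"
  by (rule small_single) auto

lemma small_countable_UN:
  assumes "countable I" "\<And>i. i \<in> I \<Longrightarrow> small (S i)"
  shows "small (\<Union>i\<in>I. S i)"
proof (cases "I = {}")
  case False
  have "(\<Union>n. S (from_nat_into I n)) = (\<Union>i\<in>range (from_nat_into I). S i)" by simp
  also have "\<dots> = (\<Union>i\<in>I. S i)"
    unfolding range_from_nat_into[OF False assms(1)] ..
  finally show ?thesis
    using small_UN[of "\<lambda>n. S (from_nat_into I n)"] assms(2)[OF from_nat_into[OF False]] by simp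
qed (simp add: small_empty)

lemma small_Un: "small S \<Longrightarrow> small T \<Longrightarrow> small (S \<union> T)"
  using small_countable_UN[of "{S, T}" "\<lambda>x. x"] by auto

text \<open>Allowing Borel sets \<open>L i\<close> rather than the images themselves makes the separation theorem for
  analytic sets unnecessary. A tuple that is not bad can be split; were the whole space not small,
  this would produce a Cantor scheme inside one fibre.\<close>

definition bad :: "'i set \<Rightarrow> ('i \<Rightarrow> nat list) \<Rightarrow> bool" where
  "bad I T \<longleftrightarrow> (\<exists>S L. small S \<and> (\<forall>i\<in>I. L i \<in> sets N \<and> f ` (cy (T i) - S) \<subseteq> L i) \<and>
     (\<Inter>i\<in>I. L i) = {})"

lemma badI:
  assumes "small S" "\<And>i. i \<in> I \<Longrightarrow> L i \<in> sets N" "\<And>i. i \<in> I \<Longrightarrow> f ` (cy (T i) - S) \<subseteq> L i"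
    "(\<Inter>i\<in>I. L i) = {}"
  shows "bad I T"
  unfolding bad_def using assms by (intro exI[of _ S] exI[of _ L]) simp

lemma not_bad_nonempty:
  assumes "\<not> bad I T" "i \<in> I"
  shows "cy (T i) \<noteq> {}"
proof
  assume *: "cy (T i) = {}"
  have "bad I T"
  proof (rule badI[OF small_empty])
    let ?L = "\<lambda>j. if j = i then {} else space N"
    show "?L j \<in> sets N" for j by simp
    show "f ` (cy (T j) - {}) \<subseteq> ?L j" for j
      using * f_space cyl_subset[of c "space M" "T j"] by auto
    show "(\<Inter>j\<in>I. ?L j) = {}" using INT_lower[OF assms(2), of ?L] by simp
  qed
  with assms(1) show False by blast
qed

text \<open>For each admissible pair \<open>p\<close> of extensions choose a discarded set
  \<open>S p\<close> and Borel sets \<open>L p i\<close> with empty intersection. The points of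
  \<open>cy (T s)\<close> compatible with all these choices form a set \<open>S1\<close> on which
  \<open>f\<close> is injective: two of them with one image would be told apart by some
  \<open>p\<close>, and that image would lie in an empty intersection. So \<open>S1\<close> may be
  discarded too, and every remaining point violates some \<open>p\<close>, which keeps its image out
  of \<open>J p\<close>.\<close>

lemma split_bad:
  assumes I: "finite I" "s \<in> I" "j \<notin> I" "k \<notin> I" "j \<noteq> k"
    and split: "\<And>\<rho> \<tau>. extends (T s) \<rho> \<Longrightarrow> extends (T s) \<tau> \<Longrightarrow> length \<rho> = length \<tau> \<Longrightarrow> \<rho> \<noteq> \<tau> \<Longrightarrow>
      bad (insert j (insert k (I - {s}))) (T(j := \<rho>, k := \<tau>))"
  shows "bad I T"
proof -
  define P where "P = {(\<rho>, \<tau>). extends (T s) \<rho> \<and> extends (T s) \<tau> \<and> length \<rho> = length \<tau> \<and> \<rho> \<noteq> \<tau>}"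
  have "countable P" by (rule countableI_type)
  have "\<forall>p\<in>P. \<exists>S L. small S \<and> L j \<in> sets N \<and> L k \<in> sets N \<and> (\<forall>i\<in>I - {s}. L i \<in> sets N \<and> f ` (cy (T i) - S) \<subseteq> L i) \<and>
     f ` (cy (fst p) - S) \<subseteq> L j \<and> f ` (cy (snd p) - S) \<subseteq> L k \<and> L j \<inter> L k \<inter> (\<Inter>i\<in>I - {s}. L i) = {}"
  proof
    fix p assume "p \<in> P"
    then obtain \<rho> \<tau> where p: "p = (\<rho>, \<tau>)" "extends (T s) \<rho>" "extends (T s) \<tau>" "length \<rho> = length \<tau>" "\<rho> \<noteq> \<tau>"
      unfolding P_def by blast
    obtain S L where SL: "small S" "\<forall>i\<in>insert j (insert k (I - {s})). L i \<in> sets N \<and> f ` (cy ((T(j := \<rho>, k := \<tau>)) i) - S) \<subseteq> L i"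
      "(\<Inter>i\<in>insert j (insert k (I - {s})). L i) = {}"
      using split[OF p(2-)] unfolding bad_def by blast
    have "f ` (cy (T i) - S) \<subseteq> L i" if "i \<in> I - {s}" for i
    proof -
      have "(T(j := \<rho>, k := \<tau>)) i = T i" using that I by auto
      then show ?thesis using SL(2)[rule_format, of i] that by simp
    qed
    moreover have "f ` (cy \<rho> - S) \<subseteq> L j" using SL(2)[rule_format, of j] I by simp
    moreover have "f ` (cy \<tau> - S) \<subseteq> L k" using SL(2)[rule_format, of k] I by simp
    moreover have "L j \<inter> L k \<inter> (\<Inter>i\<in>I - {s}. L i) = {}" using SL(3) by blast
    ultimately show "\<exists>S L. small S \<and> L j \<in> sets N \<and> L k \<in> sets N \<and> (\<forall>i\<in>I - {s}. L i \<in> sets N \<and> f ` (cy (T i) - S) \<subseteq> L i) \<and>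
     f ` (cy (fst p) - S) \<subseteq> L j \<and> f ` (cy (snd p) - S) \<subseteq> L k \<and> L j \<inter> L k \<inter> (\<Inter>i\<in>I - {s}. L i) = {}"
      using SL(1,2) p(1) by (intro exI[of _ S] exI[of _ L]) auto
  qed
  from bchoice[OF this] obtain S where S: "\<forall>p\<in>P. \<exists>L. small (S p) \<and> L j \<in> sets N \<and> L k \<in> sets N \<and> (\<forall>i\<in>I - {s}. L i \<in> sets N \<and> f ` (cy (T i) - S p) \<subseteq> L i) \<and>
     f ` (cy (fst p) - S p) \<subseteq> L j \<and> f ` (cy (snd p) - S p) \<subseteq> L k \<and> L j \<inter> L k \<inter> (\<Inter>i\<in>I - {s}. L i) = {}" ..
  from bchoice[OF this] obtain L where L: "\<forall>p\<in>P. small (S p) \<and> L p j \<in> sets N \<and> L p k \<in> sets N \<and> (\<forall>i\<in>I - {s}. L p i \<in> sets N \<and> f ` (cy (T i) - S p) \<subseteq> L p i) \<and>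
     f ` (cy (fst p) - S p) \<subseteq> L p j \<and> f ` (cy (snd p) - S p) \<subseteq> L p k \<and> L p j \<inter> L p k \<inter> (\<Inter>i\<in>I - {s}. L p i) = {}" ..
  have sm: "small (S p)" and Lj: "L p j \<in> sets N" and Lk: "L p k \<in> sets N"
    and subj: "f ` (cy (fst p) - S p) \<subseteq> L p j" and subk: "f ` (cy (snd p) - S p) \<subseteq> L p k"
    and disj: "L p j \<inter> L p k \<inter> (\<Inter>i\<in>I - {s}. L p i) = {}" if "p \<in> P" for p
    using bspec[OF L that] by simp_all
  have Li: "L p i \<in> sets N" and subi: "f ` (cy (T i) - S p) \<subseteq> L p i" if "p \<in> P" "i \<in> I - {s}" for p i
    using bspec[OF L that(1)] that(2) by simp_all
  define S0 where "S0 = (\<Union>p\<in>P. S p)"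
  define J where "J p = {x \<in> space N. \<forall>i\<in>I - {s}. x \<in> L p i}" for p
  have J: "J p \<in> sets N" if "p \<in> P" for p
    unfolding J_def using I(1) Li that by (intro sets_Collect_ball_mem) (auto intro: countable_finite)
  \<comment> \<open>Formulated by implications on points, so that \<open>U p\<close> is Borel
    without any knowledge about images of cylinders.\<close>
  define U where "U p = {y \<in> space M. (y \<in> cy (fst p) \<longrightarrow> f y \<in> L p j) \<and> (y \<in> cy (snd p) \<longrightarrow> f y \<in> L p k) \<and> f y \<in> J p}" for p
  have U: "U p \<in> sets M" if "p \<in> P" for p
  proof -
    have "U p = ((space M - cy (fst p)) \<union> (f -` L p j \<inter> space M)) \<inter>
        ((space M - cy (snd p)) \<union> (f -` L p k \<inter> space M)) \<inter> (f -` J p \<inter> space M)"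
      unfolding U_def by blast
    also have "\<dots> \<in> sets M"
      by (intro sets.Int sets.Un measurable_sets[OF f] sets.Diff cyl_sets[OF c] sets.top Lj[OF that] Lk[OF that] J[OF that])
    finally show ?thesis .
  qed
  define S1 where "S1 = cy (T s) \<inter> {y \<in> space M. \<forall>p\<in>P. y \<in> U p}"
  have "S1 \<in> sets M"
    unfolding S1_def by (intro sets.Int cyl_sets[OF c] sets_Collect_ball_mem \<open>countable P\<close> U)
  moreover have "inj_on f S1"
  proof (rule inj_onI, rule ccontr)
    fix y y' assume y: "y \<in> S1" "y' \<in> S1" "f y = f y'" "y \<noteq> y'"
    then have sp: "y \<in> space M" "y' \<in> space M" unfolding S1_def by blast+
    obtain n where n: "n > length (T s)" "map (c y) [0..<n] \<noteq> map (c y') [0..<n]"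
      using code_length_differs[OF sp y(4)] .
    let ?p = "(map (c y) [0..<n], map (c y') [0..<n])"
    have "y \<in> cy (T s)" "y' \<in> cy (T s)" using y unfolding S1_def by blast+
    then have p: "?p \<in> P"
      using n unfolding P_def by (simp add: extends_code)
    then have "y \<in> U ?p" "y' \<in> U ?p" using y unfolding S1_def by blast+
    then have "f y \<in> L ?p j" "f y \<in> L ?p k" "f y \<in> J ?p"
      using mem_cyl_code[OF sp(1), of c n] mem_cyl_code[OF sp(2), of c n] y(3)
      unfolding U_def by simp_all
    then have "f y \<in> L ?p j \<inter> L ?p k \<inter> (\<Inter>i\<in>I - {s}. L ?p i)" unfolding J_def by blast
    then show False using disj[OF p] by blast
  qed
  ultimately have "small S1" by (rule small_single)
  moreover have "small S0"
    unfolding S0_def by (rule small_countable_UN[OF \<open>countable P\<close> sm])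
  ultimately have sm01: "small (S0 \<union> S1)" by (intro small_Un)
  let ?Q = "{x \<in> space N. \<forall>p\<in>P. x \<in> J p}"
  define L' where "L' i = (if i = s then space N - ?Q else {x \<in> space N. \<forall>p\<in>P. x \<in> L p i})" for i
  show "bad I T"
  proof (rule badI[OF sm01])
    fix i assume i: "i \<in> I"
    show "L' i \<in> sets N"
      unfolding L'_def using i Li J \<open>countable P\<close>
      by (cases "i = s") (simp_all add: sets.Diff sets_Collect_ball_mem)
    show "f ` (cy (T i) - (S0 \<union> S1)) \<subseteq> L' i"
    proof (cases "i = s")
      case True
      show ?thesis
      proof
        fix x assume "x \<in> f ` (cy (T i) - (S0 \<union> S1))"
        then obtain y where y: "x = f y" "y \<in> cy (T s)" "y \<notin> S0" "y \<notin> S1"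
          using True by blast
        have sp: "y \<in> space M" using subsetD[OF cyl_subset y(2)] .
        then obtain p where p: "p \<in> P" "y \<notin> U p" using y(2,4) unfolding S1_def by blast
        then have "y \<notin> S p" using y(3) unfolding S0_def by blast
        \<comment> \<open>Off \<open>S p\<close> the two implications in \<open>U p\<close> hold by
          the choice of \<open>L p\<close>, so only the last conjunct can fail.\<close>
        then have "f y \<notin> J p" using p subj[OF p(1)] subk[OF p(1)] sp unfolding U_def by blast
        then show "x \<in> L' i" using p f_space[OF sp] True y(1) unfolding L'_def by auto
      qed
    next
      case False
      show ?thesis
      proof
        fix x assume "x \<in> f ` (cy (T i) - (S0 \<union> S1))"
        then obtain y where y: "x = f y" "y \<in> cy (T i)" "y \<notin> S0"
          by blast
        have "f y \<in> L p i" if "p \<in> P" for p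
          using subi[OF that, of i] y(2,3) that i False unfolding S0_def by blast
        moreover have "f y \<in> space N" by (rule f_space[OF subsetD[OF cyl_subset y(2)]])
        ultimately show "x \<in> L' i" using False y(1) unfolding L'_def by simp
      qed
    qed
  next
    show "(\<Inter>i\<in>I. L' i) = {}"
    proof (rule ccontr)
      assume "(\<Inter>i\<in>I. L' i) \<noteq> {}"
      then obtain x where x: "\<And>i. i \<in> I \<Longrightarrow> x \<in> L' i" by blast
      have "x \<in> space N - ?Q" using x[OF I(2)] unfolding L'_def by (simp only: if_True simp_thms)
      then have 1: "x \<in> space N" "\<not> (\<forall>p\<in>P. x \<in> J p)" by blast+
      have "x \<in> L p i" if "i \<in> I" "i \<noteq> s" "p \<in> P" for i p
        using x[OF that(1)] that(2,3) unfolding L'_def by (simp only: if_False simp_thms mem_Collect_eq)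
      then have "\<forall>p\<in>P. x \<in> J p" using 1(1) unfolding J_def by blast
      with 1(2) show False ..
    qed
  qed
qed

lemma not_bad_split:
  assumes "finite I" "s \<in> I" "j \<notin> I" "k \<notin> I" "j \<noteq> k" "\<not> bad I T"
  shows "\<exists>\<rho> \<tau>. extends (T s) \<rho> \<and> extends (T s) \<tau> \<and> length \<rho> = length \<tau> \<and> \<rho> \<noteq> \<tau> \<and>
    \<not> bad (insert j (insert k (I - {s}))) (T(j := \<rho>, k := \<tau>))" (is ?split)
proof (rule ccontr)
  assume neg: "\<not> ?split"
  have "bad I T"
  proof (rule split_bad[OF assms(1-5)], rule ccontr)
    fix \<rho> \<tau>
    assume "extends (T s) \<rho>" "extends (T s) \<tau>" "length \<rho> = length \<tau>" "\<rho> \<noteq> \<tau>"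
      and "\<not> bad (insert j (insert k (I - {s}))) (T(j := \<rho>, k := \<tau>))"
    then have ?split by (intro exI conjI)
    with neg show False ..
  qed
  with assms(6) show False ..
qed

section \<open>The Cantor scheme\<close>

definition splits :: "nat list \<Rightarrow> nat list \<Rightarrow> nat list \<Rightarrow> bool" where
  "splits \<sigma> \<rho> \<tau> \<longleftrightarrow> extends \<sigma> \<rho> \<and> extends \<sigma> \<tau> \<and> length \<rho> = length \<tau> \<and> \<rho> \<noteq> \<tau>"

text \<open>\<open>not_bad_split\<close> replaces one index at a time, whereas the whole level has
  to be split; the induction runs over the set \<open>J\<close> of strings already replaced by their
  two children.\<close>

lemma split_level:
  fixes T :: "bool list \<Rightarrow> nat list"
  assumes nb: "\<not> bad {s. length s = n} T"
  shows "\<exists>T'. \<not> bad {s. length s = Suc n} T' \<and>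
    (\<forall>s. length s = n \<longrightarrow> splits (T s) (T' (False # s)) (T' (True # s)))"
proof -
  let ?L = "{s::bool list. length s = n}"
  have fin: "finite ?L" using finite_lists_length_eq[of "UNIV :: bool set" n] by simp
  define K where "K J = (?L - J) \<union> (#) False ` J \<union> (#) True ` J" for J :: "bool list set"
  have "\<exists>T'. \<not> bad (K J) T' \<and> (\<forall>s\<in>?L - J. T' s = T s) \<and>
      (\<forall>s\<in>J. splits (T s) (T' (False # s)) (T' (True # s)))" if "J \<subseteq> ?L" for J
    using finite_subset[OF that fin] that
  proof (induction J rule: finite_induct)
    case empty
    have "K {} = ?L" by (simp add: K_def)
    then show ?case using nb by (intro exI[of _ T]) simp
  next
    case (insert s J)
    then obtain T' where T': "\<not> bad (K J) T'" "\<forall>s\<in>?L - J. T' s = T s"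
      "\<forall>s\<in>J. splits (T s) (T' (False # s)) (T' (True # s))"
      by auto
    have s: "length s = n" "s \<notin> J" and J: "J \<subseteq> ?L" using insert by auto
    have "s \<in> K J" using s by (simp add: K_def)
    moreover have new: "False # s \<notin> K J" "True # s \<notin> K J" using s by (auto simp: K_def)
    moreover have "finite (K J)" using fin insert(1) by (simp add: K_def)
    ultimately obtain \<rho> \<tau> where rt: "extends (T' s) \<rho>" "extends (T' s) \<tau>" "length \<rho> = length \<tau>" "\<rho> \<noteq> \<tau>"
      "\<not> bad (insert (False # s) (insert (True # s) (K J - {s}))) (T'(False # s := \<rho>, True # s := \<tau>))"
      using not_bad_split[of "K J" s "False # s" "True # s" T'] T'(1) by auto
    define T2 where "T2 = T'(False # s := \<rho>, True # s := \<tau>)"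
    have "K (insert s J) = insert (False # s) (insert (True # s) (K J - {s}))"
    proof -
      \<comment> \<open>Children are longer than \<open>n\<close>, so removing \<open>s\<close>
        removes no child.\<close>
      have "length r = Suc n" if "r \<in> (#) False ` J \<union> (#) True ` J" for r
        using that J by auto
      then have "s \<notin> (#) False ` J \<union> (#) True ` J" using s(1) by fastforce
      then show ?thesis
        unfolding K_def image_insert by blast
    qed
    moreover have "T' s = T s" using T'(2) s by simp
    moreover have "splits (T r) (T2 (False # r)) (T2 (True # r))" if "r \<in> insert s J" for r
    proof (cases "r = s")
      case True
      then show ?thesis using rt \<open>T' s = T s\<close> by (simp add: splits_def T2_def)
    next
      case False
      then show ?thesis using T'(3) that by (simp add: T2_def)
    qed
    moreover have "T2 r = T r" if "r \<in> ?L - insert s J" for r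
      using T'(2) s that by (auto simp: T2_def)
    ultimately show ?case
      using rt(5)[folded T2_def] by (intro exI[of _ T2] conjI ballI) simp_all
  qed
  from this[OF subset_refl] obtain T' where T': "\<not> bad (K ?L) T'"
    "\<forall>s\<in>?L. splits (T s) (T' (False # s)) (T' (True # s))"
    by blast
  moreover have "K ?L = {s. length s = Suc n}"
  proof (intro subset_antisym subsetI)
    fix s assume "s \<in> {s::bool list. length s = Suc n}"
    then obtain b r where "s = b # r" "length r = n" by (auto simp: length_Suc_conv)
    then show "s \<in> K ?L" by (cases b) (auto simp: K_def)
  qed (auto simp: K_def)
  ultimately show ?thesis by (intro exI[of _ T']) simp
qed

lemma uncountable_bool_seq: "\<not> countable (UNIV :: (nat \<Rightarrow> bool) set)"
proof
  assume "countable (UNIV :: (nat \<Rightarrow> bool) set)"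
  then have "range (from_nat_into (UNIV :: (nat \<Rightarrow> bool) set)) = UNIV"
    by (intro range_from_nat_into) auto
  then obtain m where "from_nat_into UNIV m = (\<lambda>n. \<not> (from_nat_into (UNIV :: (nat \<Rightarrow> bool) set) n) n)"
    by (metis surjD)
  from fun_cong[OF this, of m] show False by simp
qed

theorem small_space:
  assumes fib: "\<And>x. x \<in> space N \<Longrightarrow> countable {z \<in> space M. f z = x}"
  shows "small (space M)"
proof (rule ccontr)
  assume ns: "\<not> small (space M)"
  \<comment> \<open>With a single index, badness would put the image of all points outside a small
    set \<open>S\<close> into the empty set, so that \<open>S\<close> would be the whole
    space.\<close>
  have nb0: "\<not> bad {s::bool list. length s = 0} (\<lambda>_. [])"
  proof
    assume "bad {s::bool list. length s = 0} (\<lambda>_. [])"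
    then obtain S L where SL: "small S" "f ` (cy [] - S) \<subseteq> L ([]::bool list)" "L [] = {}"
      unfolding bad_def by auto
    have "cy [] = space M" by (simp add: cyl_def)
    then have "space M \<subseteq> S" using SL by auto
    moreover have "S \<subseteq> space M"
      using SL(1) sets.sets_into_space unfolding small_def by fastforce
    ultimately show False using ns SL(1) by simp
  qed
  have "\<exists>T. \<forall>n. \<not> bad {s::bool list. length s = n} (T n) \<and>
      (\<forall>s. length s = n \<longrightarrow> splits (T n s) (T (Suc n) (False # s)) (T (Suc n) (True # s)))"
  proof (rule dependent_nat_choice)
    show "\<exists>T. \<not> bad {s::bool list. length s = 0} T" using nb0 by (rule exI[of _ "\<lambda>_. []"])
    fix T n assume "\<not> bad {s::bool list. length s = n} T"
    from split_level[OF this] show "\<exists>T'. \<not> bad {s::bool list. length s = Suc n} T' \<and>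
      (\<forall>s. length s = n \<longrightarrow> splits (T s) (T' (False # s)) (T' (True # s)))" .
  qed
  then obtain T where T: "\<And>n. \<not> bad {s::bool list. length s = n} (T n)"
    "\<And>n s. length s = n \<Longrightarrow> splits (T n s) (T (Suc n) (False # s)) (T (Suc n) (True # s))"
    by blast
  \<comment> \<open>Reversed, because \<open>split_level\<close> puts the newest bit at the head of
    the string.\<close>
  define br where "br \<alpha> n = rev (map \<alpha> [0..<n])" for \<alpha> :: "nat \<Rightarrow> bool" and n
  have br_len: "length (br \<alpha> n) = n" for \<alpha> n by (simp add: br_def)
  have br_Suc: "br \<alpha> (Suc n) = \<alpha> n # br \<alpha> n" for \<alpha> n by (simp add: br_def)
  have br_eq: "br \<alpha> n = br \<alpha>' n \<longleftrightarrow> (\<forall>i<n. \<alpha> i = \<alpha>' i)" for \<alpha> \<alpha>' n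
    by (auto simp: br_def)
  have ext: "extends (T n (br \<alpha> n)) (T (Suc n) (br \<alpha> (Suc n)))" for \<alpha> n
    using T(2)[of "br \<alpha> n" n, OF br_len] unfolding br_Suc splits_def by (cases "\<alpha> n") simp_all
  have len: "n \<le> length (T n (br \<alpha> n))" for \<alpha> n
  proof (induction n)
    case (Suc n)
    then show ?case using ext[of n \<alpha>] by (simp add: extends_def)
  qed simp
  have ne: "cy (T n (br \<alpha> n)) \<noteq> {}" for \<alpha> n
    by (rule not_bad_nonempty[OF T(1)]) (simp add: br_len)
  have "\<forall>\<alpha>. \<exists>z. \<forall>n. z \<in> cy (T n (br \<alpha> n))"
  proof
    fix \<alpha>
    show "\<exists>z. \<forall>n. z \<in> cy (T n (br \<alpha> n))"
      by (rule branch_point[OF coding_closed[OF c], of "\<lambda>n. T n (br \<alpha> n)"]) (use ext ne in auto)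
  qed
  from choice[OF this] obtain z where z': "\<forall>\<alpha> n. z \<alpha> \<in> cy (T n (br \<alpha> n))" ..
  then have z: "z \<alpha> \<in> cy (T n (br \<alpha> n))" for \<alpha> n by simp
  have zM: "z \<alpha> \<in> space M" for \<alpha> using subsetD[OF cyl_subset z[of \<alpha> 0]] .
  have "inj z"
  proof (rule injI, rule ccontr)
    fix \<alpha> \<beta> assume eq: "z \<alpha> = z \<beta>" and "\<alpha> \<noteq> \<beta>"
    then have ex: "\<exists>i. \<alpha> i \<noteq> \<beta> i" by auto
    \<comment> \<open>At the first difference the two branches pass to the two children of one list,
      which are distinct and of equal length, so their cylinders are disjoint.\<close>
    define n where "n = (LEAST i. \<alpha> i \<noteq> \<beta> i)"
    have n: "\<alpha> n \<noteq> \<beta> n" unfolding n_def by (rule LeastI_ex[OF ex])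
    have "\<forall>i<n. \<alpha> i = \<beta> i" unfolding n_def using not_less_Least by blast
    then have "br \<alpha> n = br \<beta> n" by (simp add: br_eq)
    then have "length (T (Suc n) (br \<alpha> (Suc n))) = length (T (Suc n) (br \<beta> (Suc n)))"
      "T (Suc n) (br \<alpha> (Suc n)) \<noteq> T (Suc n) (br \<beta> (Suc n))"
      using T(2)[of "br \<alpha> n" n, OF br_len] n unfolding br_Suc splits_def
      by (cases "\<alpha> n"; cases "\<beta> n"; auto)+
    then show False
      using z[of \<alpha> "Suc n"] z[of \<beta> "Suc n"] eq by (auto simp: cyl_def list_eq_iff_nth_eq)
  qed
  \<comment> \<open>Different images would be separated, along the two branches, by a Borel set and
    its complement. At a deep level this makes the tuple bad, with nothing discarded and the whole
    of \<open>N\<close> as the set for all other indices.\<close>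
  have const: "f (z \<alpha>) = f (z \<beta>)" for \<alpha> \<beta>
  proof (rule ccontr)
    assume neq: "f (z \<alpha>) \<noteq> f (z \<beta>)"
    then have "\<alpha> \<noteq> \<beta>" by auto
    then obtain j where j: "\<alpha> j \<noteq> \<beta> j" by (auto simp: fun_eq_iff)
    from separate_images[OF zM zM neq] obtain B K where B1: "B \<in> sets N"
      and B2: "\<forall>\<sigma>. K \<le> length \<sigma> \<longrightarrow>
        (z \<alpha> \<in> cy \<sigma> \<longrightarrow> f ` cy \<sigma> \<subseteq> B) \<and> (z \<beta> \<in> cy \<sigma> \<longrightarrow> f ` cy \<sigma> \<inter> B = {})"
      by (elim bexE exE)
    then have B: "B \<in> sets N"
      "\<And>\<sigma>. K \<le> length \<sigma> \<Longrightarrow> z \<alpha> \<in> cy \<sigma> \<Longrightarrow> f ` cy \<sigma> \<subseteq> B"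
      "\<And>\<sigma>. K \<le> length \<sigma> \<Longrightarrow> z \<beta> \<in> cy \<sigma> \<Longrightarrow> f ` cy \<sigma> \<inter> B = {}"
      by simp_all
    \<comment> \<open>\<open>Suc j\<close> makes the two strings different, \<open>K\<close> makes
      the cylinders long enough to be separated.\<close>
    define n where "n = max K (Suc j)"
    have "j < n" by (simp add: n_def)
    then have ne: "br \<alpha> n \<noteq> br \<beta> n" using j br_eq[of \<alpha> n \<beta>] by blast
    have Kn: "K \<le> length (T n (br \<gamma> n))" for \<gamma> using len[of n \<gamma>] by (simp add: n_def)
    let ?L = "\<lambda>s. if s = br \<alpha> n then B else if s = br \<beta> n then space N - B else space N"
    have "bad {s. length s = n} (T n)"
    proof (rule badI[OF small_empty])
      show "?L s \<in> sets N" for s using B(1) by simp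
      show "f ` (cy (T n s) - {}) \<subseteq> ?L s" for s
      proof -
        have "f ` cy (T n s) \<subseteq> space N" using f_space cyl_subset[of c "space M"] by blast
        then show ?thesis
          using B(2)[OF Kn z[of \<alpha> n]] B(3)[OF Kn z[of \<beta> n]] ne by auto
      qed
      show "(\<Inter>s\<in>{s. length s = n}. ?L s) = {}"
        using INT_lower[of "br \<alpha> n" "{s. length s = n}" ?L] INT_lower[of "br \<beta> n" "{s. length s = n}" ?L] ne br_len
        by auto
    qed
    with T(1) show False by blast
  qed
  have "range z \<subseteq> {w \<in> space M. f w = f (z undefined)}"
    using zM const by blast
  then have "countable (range z)"
    using fib[OF f_space[OF zM[of undefined]]] countable_subset by blast
  then have "countable (UNIV :: (nat \<Rightarrow> bool) set)"
    using countable_image_inj_on[OF _ \<open>inj z\<close>] by blast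
  then show False using uncountable_bool_seq by blast
qed

section \<open>The Lusin-Souslin theorem\<close>

definition separated :: "nat list \<Rightarrow> nat list \<Rightarrow> bool" where
  "separated \<sigma> \<tau> \<longleftrightarrow> (\<exists>B\<in>sets N. f ` cy \<sigma> \<subseteq> B \<and> f ` cy \<tau> \<inter> B = {})"

lemma cy_split: "z \<in> cy \<sigma> \<Longrightarrow> z \<in> cy (\<sigma> @ [c z (length \<sigma>)])"
  by (auto simp: cyl_def nth_append less_Suc_eq)

lemma extends_append: "extends \<sigma> (\<sigma> @ [j])"
  by (simp add: extends_def nth_append)

text \<open>The child of the first list has to be separated from all children of the second at once,
  hence an intersection over \<open>k\<close> inside a union over \<open>j\<close>.\<close>

lemma separated_split:
  assumes "\<And>j k. separated (\<sigma> @ [j]) (\<tau> @ [k])"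
  shows "separated \<sigma> \<tau>"
proof -
  have "\<forall>p. \<exists>B. B \<in> sets N \<and> f ` cy (\<sigma> @ [fst p]) \<subseteq> B \<and> f ` cy (\<tau> @ [snd p]) \<inter> B = {}"
  proof
    fix p
    from assms[of "fst p" "snd p"] obtain B where
      "B \<in> sets N" "f ` cy (\<sigma> @ [fst p]) \<subseteq> B" "f ` cy (\<tau> @ [snd p]) \<inter> B = {}"
      unfolding separated_def by (elim bexE conjE)
    then show "\<exists>B. B \<in> sets N \<and> f ` cy (\<sigma> @ [fst p]) \<subseteq> B \<and> f ` cy (\<tau> @ [snd p]) \<inter> B = {}"
      by (intro exI conjI)
  qed
  from choice[OF this] obtain B where
    "\<forall>p. B p \<in> sets N \<and> f ` cy (\<sigma> @ [fst p]) \<subseteq> B p \<and> f ` cy (\<tau> @ [snd p]) \<inter> B p = {}" ..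
  then have B: "B (j, k) \<in> sets N" "f ` cy (\<sigma> @ [j]) \<subseteq> B (j, k)" "f ` cy (\<tau> @ [k]) \<inter> B (j, k) = {}" for j k
    by simp_all
  have "(\<Union>j. \<Inter>k. B (j, k)) \<in> sets N"
  proof (intro sets.countable_UN'' countableI_type)
    show "(\<Inter>k. B (j, k)) \<in> sets N" for j
      by (rule sets.countable_INT) (use B(1) in auto)
  qed
  moreover have "f ` cy \<sigma> \<subseteq> (\<Union>j. \<Inter>k. B (j, k))"
  proof
    fix x assume "x \<in> f ` cy \<sigma>"
    then obtain z where z: "x = f z" "z \<in> cy \<sigma>" by blast
    have "f z \<in> B (c z (length \<sigma>), k)" for k
      using subsetD[OF B(2)] cy_split[OF z(2)] by blast
    then show "x \<in> (\<Union>j. \<Inter>k. B (j, k))" using z(1) by blast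
  qed
  moreover have "f ` cy \<tau> \<inter> (\<Union>j. \<Inter>k. B (j, k)) = {}"
  proof (rule ccontr)
    assume "f ` cy \<tau> \<inter> (\<Union>j. \<Inter>k. B (j, k)) \<noteq> {}"
    then obtain z j where z: "z \<in> cy \<tau>" "\<forall>k. f z \<in> B (j, k)" by blast
    then show False
      using B(3)[of "c z (length \<tau>)" j] cy_split[OF z(1)] by blast
  qed
  ultimately show ?thesis unfolding separated_def by blast
qed

text \<open>Otherwise children that are not separated can be chosen forever. The two branches have
  limit points \<open>z\<close> and \<open>w\<close>, which differ because the initial cylinders are
  disjoint; injectivity gives \<open>f z \<noteq> f w\<close>, and \<open>separate_images\<close>
  separates a late stage.\<close>

lemma separated_disjoint:
  assumes inj: "inj_on f (space M)" and disj: "cy \<sigma> \<inter> cy \<tau> = {}"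
  shows "separated \<sigma> \<tau>"
proof (rule ccontr)
  assume ns: "\<not> separated \<sigma> \<tau>"
  \<comment> \<open>The clause for \<open>n = 0\<close> ties the sequence to the given pair, whose
    disjointness is used for the limits.\<close>
  have "\<exists>p. \<forall>n. (\<not> separated (fst (p n)) (snd (p n)) \<and> (n = 0 \<longrightarrow> p n = (\<sigma>, \<tau>))) \<and>
     (extends (fst (p n)) (fst (p (Suc n))) \<and> extends (snd (p n)) (snd (p (Suc n))))"
  proof (rule dependent_nat_choice)
    show "\<exists>p. \<not> separated (fst p) (snd p) \<and> (0 = (0::nat) \<longrightarrow> p = (\<sigma>, \<tau>))"
      using ns by (intro exI[of _ "(\<sigma>, \<tau>)"]) simp
    fix p :: "nat list \<times> nat list" and n :: nat
    assume "\<not> separated (fst p) (snd p) \<and> (n = 0 \<longrightarrow> p = (\<sigma>, \<tau>))"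
    then obtain j k where "\<not> separated (fst p @ [j]) (snd p @ [k])"
      using separated_split[of "fst p" "snd p"] by blast
    then show "\<exists>q. (\<not> separated (fst q) (snd q) \<and> (Suc n = 0 \<longrightarrow> q = (\<sigma>, \<tau>))) \<and>
        (extends (fst p) (fst q) \<and> extends (snd p) (snd q))"
      by (intro exI[of _ "(fst p @ [j], snd p @ [k])"]) (simp add: extends_append)
  qed
  then obtain p where p: "\<And>n. \<not> separated (fst (p n)) (snd (p n))" "p 0 = (\<sigma>, \<tau>)"
    "\<And>n. extends (fst (p n)) (fst (p (Suc n)))" "\<And>n. extends (snd (p n)) (snd (p (Suc n)))"
    by blast
  have ne1: "cy (fst (p n)) \<noteq> {}" for n
  proof
    assume "cy (fst (p n)) = {}"
    then have "separated (fst (p n)) (snd (p n))"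
      unfolding separated_def by (intro bexI[of _ "{}"]) auto
    with p(1) show False by blast
  qed
  have ne2: "cy (snd (p n)) \<noteq> {}" for n
  proof
    assume "cy (snd (p n)) = {}"
    moreover have "f ` cy (fst (p n)) \<subseteq> space N" using f_space cyl_subset[of c "space M"] by blast
    ultimately have "separated (fst (p n)) (snd (p n))"
      unfolding separated_def by (intro bexI[of _ "space N"]) auto
    with p(1) show False by blast
  qed
  obtain z where z: "\<And>n. z \<in> cy (fst (p n))"
    using branch_point[OF coding_closed[OF c], of "\<lambda>n. fst (p n)"] p(3) ne1 by blast
  obtain w where w: "\<And>n. w \<in> cy (snd (p n))"
    using branch_point[OF coding_closed[OF c], of "\<lambda>n. snd (p n)"] p(4) ne2 by blast
  have zw: "z \<in> space M" "w \<in> space M" using subsetD[OF cyl_subset z] subsetD[OF cyl_subset w] by blast+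
  have "z \<noteq> w" using z[of 0] w[of 0] p(2) disj by auto
  then have "f z \<noteq> f w" using inj_onD[OF inj _ zw] by blast
  from separate_images[OF zw this] obtain B K where B1: "B \<in> sets N"
    and B2: "\<forall>\<sigma>. K \<le> length \<sigma> \<longrightarrow>
      (z \<in> cy \<sigma> \<longrightarrow> f ` cy \<sigma> \<subseteq> B) \<and> (w \<in> cy \<sigma> \<longrightarrow> f ` cy \<sigma> \<inter> B = {})"
    by (elim bexE exE)
  then have B: "B \<in> sets N"
      "\<And>\<sigma>. K \<le> length \<sigma> \<Longrightarrow> z \<in> cy \<sigma> \<Longrightarrow> f ` cy \<sigma> \<subseteq> B"
      "\<And>\<sigma>. K \<le> length \<sigma> \<Longrightarrow> w \<in> cy \<sigma> \<Longrightarrow> f ` cy \<sigma> \<inter> B = {}"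
    by simp_all
  have len1: "n \<le> length (fst (p n))" for n
  proof (induction n)
    case (Suc n)
    then show ?case using p(3)[of n] by (simp add: extends_def)
  qed simp
  have len2: "n \<le> length (snd (p n))" for n
  proof (induction n)
    case (Suc n)
    then show ?case using p(4)[of n] by (simp add: extends_def)
  qed simp
  have "separated (fst (p K)) (snd (p K))"
    unfolding separated_def using B(1) B(2)[OF len1 z] B(3)[OF len2 w] by blast
  with p(1) show False by blast
qed

text \<open>The images of cylinders are enclosed in Borel sets \<open>G \<sigma>\<close> that are
  disjoint for disjoint cylinders and stay inside every coordinate set \<open>D p\<close> containing
  the image. A point \<open>x\<close> lying in some \<open>G \<sigma>\<close> for each length
  determines a coherent sequence of lists, hence a point \<open>z\<close>, and the sets
  \<open>D p\<close> force \<open>f z = x\<close>.\<close>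

theorem image_sets:
  assumes inj: "inj_on f (space M)"
  shows "f ` space M \<in> sets N"
proof -
  let ?Q = "{p. cy (fst p) \<inter> cy (snd p) = {}}"
  have "\<forall>p\<in>?Q. \<exists>B. B \<in> sets N \<and> f ` cy (fst p) \<subseteq> B \<and> f ` cy (snd p) \<inter> B = {}"
  proof
    fix p assume "p \<in> ?Q"
    then have "separated (fst p) (snd p)" by (intro separated_disjoint[OF inj]) simp
    then show "\<exists>B. B \<in> sets N \<and> f ` cy (fst p) \<subseteq> B \<and> f ` cy (snd p) \<inter> B = {}"
      unfolding separated_def by (elim bexE conjE) (intro exI conjI)
  qed
  from bchoice[OF this] obtain B where
    "\<forall>p\<in>?Q. B p \<in> sets N \<and> f ` cy (fst p) \<subseteq> B p \<and> f ` cy (snd p) \<inter> B p = {}" ..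
  then have B: "B (\<sigma>, \<tau>) \<in> sets N" "f ` cy \<sigma> \<subseteq> B (\<sigma>, \<tau>)" "f ` cy \<tau> \<inter> B (\<sigma>, \<tau>) = {}"
    if "cy \<sigma> \<inter> cy \<tau> = {}" for \<sigma> \<tau>
    using that by auto
  define D where "D p = {x \<in> space N. d x (fst p) = snd p}" for p
  have D: "D p \<in> sets N" for p unfolding D_def by (rule code_sets[OF d])
  \<comment> \<open>Subtracting \<open>B (\<tau>, \<sigma>)\<close> makes the enclosures of disjoint
    cylinders disjoint. The sets \<open>D p\<close> do the work of the closure of the image.\<close>
  define G where "G \<sigma> = {x \<in> space N. \<forall>\<tau>\<in>{\<tau>. cy \<sigma> \<inter> cy \<tau> = {}}. x \<in> B (\<sigma>, \<tau>) - B (\<tau>, \<sigma>)} \<inter>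
      {x \<in> space N. \<forall>p\<in>{p. f ` cy \<sigma> \<subseteq> D p}. x \<in> D p}" for \<sigma>
  have G: "G \<sigma> \<in> sets N" for \<sigma>
    unfolding G_def
  proof (intro sets.Int sets_Collect_ball_mem D countableI_type)
    fix \<tau> assume "\<tau> \<in> {\<tau>. cy \<sigma> \<inter> cy \<tau> = {}}"
    then show "B (\<sigma>, \<tau>) - B (\<tau>, \<sigma>) \<in> sets N"
      using B(1)[of \<sigma> \<tau>] B(1)[of \<tau> \<sigma>] by (simp add: Int_commute sets.Diff)
  qed
  have fG: "f ` cy \<sigma> \<subseteq> G \<sigma>" for \<sigma>
  proof
    fix x assume x: "x \<in> f ` cy \<sigma>"
    then have xN: "x \<in> space N" using f_space cyl_subset[of c "space M"] by blast
    have "x \<in> B (\<sigma>, \<tau>) - B (\<tau>, \<sigma>)" if "cy \<sigma> \<inter> cy \<tau> = {}" for \<tau>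
    proof -
      have "cy \<tau> \<inter> cy \<sigma> = {}" using that by (simp add: Int_commute)
      then show ?thesis using B(2)[OF that] B(3)[of \<tau> \<sigma>] x by blast
    qed
    then show "x \<in> G \<sigma>" unfolding G_def using xN x by blast
  qed
  have Gdisj: "cy \<sigma> \<inter> cy \<tau> \<noteq> {}" if "x \<in> G \<sigma>" "x \<in> G \<tau>" for x \<sigma> \<tau>
  proof
    assume "cy \<sigma> \<inter> cy \<tau> = {}"
    moreover from this have "cy \<tau> \<inter> cy \<sigma> = {}" by (simp add: Int_commute)
    ultimately show False using that unfolding G_def by blast
  qed
  have "f ` space M = {x \<in> space N. \<forall>n\<in>UNIV. x \<in> (\<Union>\<sigma>\<in>{\<sigma>. length \<sigma> = n}. G \<sigma>)}"
  proof (intro subset_antisym subsetI)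
    fix x assume "x \<in> f ` space M"
    then obtain z where z: "x = f z" "z \<in> space M" by blast
    have "x \<in> (\<Union>\<sigma>\<in>{\<sigma>. length \<sigma> = n}. G \<sigma>)" for n
    proof (rule UN_I)
      show "map (c z) [0..<n] \<in> {\<sigma>. length \<sigma> = n}" by simp
      show "x \<in> G (map (c z) [0..<n])"
        using subsetD[OF fG] z(1) mem_cyl_code[OF z(2)] by blast
    qed
    then show "x \<in> {x \<in> space N. \<forall>n\<in>UNIV. x \<in> (\<Union>\<sigma>\<in>{\<sigma>. length \<sigma> = n}. G \<sigma>)}"
      using z f_space by simp
  next
    fix x assume "x \<in> {x \<in> space N. \<forall>n\<in>UNIV. x \<in> (\<Union>\<sigma>\<in>{\<sigma>. length \<sigma> = n}. G \<sigma>)}"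
    then have xN: "x \<in> space N" and "\<forall>n. \<exists>\<sigma>. length \<sigma> = n \<and> x \<in> G \<sigma>" by auto
    from choice[OF this(2)] obtain \<sigma> where "\<forall>n. length (\<sigma> n) = n \<and> x \<in> G (\<sigma> n)" ..
    then have s: "length (\<sigma> n) = n" "x \<in> G (\<sigma> n)" for n by simp_all
    define \<alpha> where "\<alpha> i = \<sigma> (Suc i) ! i" for i
    have s_nth: "\<sigma> n ! i = \<alpha> i" if "i < n" for i n
    proof -
      \<comment> \<open>Both enclosures contain \<open>x\<close>, so the cylinders meet, and a
        common point compares the entries of the lists.\<close>
      obtain z where "z \<in> cy (\<sigma> n)" "z \<in> cy (\<sigma> (Suc i))"
        using Gdisj[OF s(2) s(2)] by blast
      then show ?thesis using that by (simp add: cyl_def s(1) \<alpha>_def)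
    qed
    have "\<exists>z\<in>space M. \<forall>i<n. c z i = \<alpha> i" for n
    proof -
      \<comment> \<open>An empty cylinder is disjoint from itself, which makes its enclosure empty;
        an enclosure containing \<open>x\<close> therefore yields a point of the cylinder.\<close>
      obtain z where "z \<in> cy (\<sigma> n)"
        using Gdisj[OF s(2) s(2)] by blast
      then show ?thesis by (intro bexI[of _ z]) (auto simp: cyl_def s(1) s_nth)
    qed
    from closed_codeD[OF coding_closed[OF c] this] obtain z where z: "z \<in> space M" "c z = \<alpha>" by blast
    have zs: "z \<in> cy (\<sigma> n)" for n using z by (simp add: cyl_def s(1) s_nth)
    have "f z = x"
    proof (rule ccontr)
      assume "f z \<noteq> x"
      then have "d (f z) \<noteq> d x" using inj_onD[OF coding_inj[OF d] _ f_space[OF z(1)] xN] by blast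
      then obtain n where n: "d (f z) n \<noteq> d x n" by blast
      obtain K where K: "\<And>u v. u \<in> space M \<Longrightarrow> v \<in> space M \<Longrightarrow> agree c K u v \<Longrightarrow>
          (d (f u) n = d (f z) n) = (d (f v) n = d (f z) n)"
        using dec[of n "d (f z) n"] unfolding decides_def by blast
      have "f ` cy (\<sigma> K) \<subseteq> D (n, d (f z) n)"
      proof
        fix y assume "y \<in> f ` cy (\<sigma> K)"
        then obtain u where u: "y = f u" "u \<in> cy (\<sigma> K)" by blast
        then have "u \<in> space M" using cyl_subset[of c "space M" "\<sigma> K"] by blast
        moreover have "agree c K z u" using cyl_agree[OF zs[of K] u(2)] s(1) by simp
        ultimately show "y \<in> D (n, d (f z) n)" using K[OF z(1)] f_space u(1) by (simp add: D_def)
      qed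
      then have "x \<in> D (n, d (f z) n)" using s(2)[of K] unfolding G_def by blast
      then show False using n by (simp add: D_def)
    qed
    then show "x \<in> f ` space M" using z(1) by blast
  qed
  also have "\<dots> \<in> sets N"
    by (intro sets_Collect_ball_mem sets.countable_UN'' G countableI_type)
  finally show ?thesis .
qed

end

section \<open>Polish topologies and codings\<close>

text \<open>The coordinate \<open>h\<close> compares a distance with a rational \<open>r\<close> and, if it is larger, also records
  a margin: \<open>\<le> r\<close> and \<open>\<ge> r + 1 / (m + 1)\<close> are closed conditions. That \<open>m\<close> is least possible
  is a comparison with another rational in the opposite direction, whence the sign \<open>s\<close>. The even
  coordinates force Cauchy sequences.\<close>

lemma (in Metric_space) coding_of_dense_seq:
  fixes N :: "'a measure" and q :: "nat \<Rightarrow> 'a"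
  assumes comp: mcomplete and sp: "space N = M"
    and sets: "sets N = sigma_sets M {U. openin mtopology U}"
    and q: "\<And>i. q i \<in> M" and dense: "\<And>y e. y \<in> M \<Longrightarrow> e > 0 \<Longrightarrow> \<exists>i. d y (q i) < e"
  shows "\<exists>c. coding N c"
proof -
  define g where "g s i y = (if s then d y (q i) else - d y (q i))" for s :: bool and i y
  define h where "h p y = (case p of (s, i, r) \<Rightarrow>
      if g s i y \<le> of_rat r then 0 else Suc (LEAST m. of_rat r + 1 / (real m + 1) \<le> g s i y))"
    for p :: "bool \<times> nat \<times> rat" and y
  define c where "c y n = (if even n then (LEAST i. d y (q i) \<le> 1 / (real (n div 2) + 1))
      else h (from_nat (n div 2)) y)" for y n
  have c_even: "c y (2 * k) = (LEAST i. d y (q i) \<le> 1 / (real k + 1))" for y k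
    by (simp add: c_def)
  have c_odd: "c y (Suc (2 * to_nat p)) = h p y" for y p
    by (simp add: c_def)
  have h0: "h (s, i, r) y = 0 \<longleftrightarrow> g s i y \<le> of_rat r" for s i r y
    by (simp add: h_def)
  have arch: "\<exists>m. a + 1 / (real m + 1) \<le> b" if "a < b" for a b :: real
  proof -
    obtain m where "inverse (real (Suc m)) < b - a"
      using reals_Archimedean[of "b - a"] \<open>a < b\<close> by auto
    then show ?thesis by (intro exI[of _ m]) (simp add: inverse_eq_divide add.commute)
  qed
  have hSuc: "of_rat r + 1 / (real m + 1) \<le> g s i y"
    "\<And>m'. m' < m \<Longrightarrow> g s i y < of_rat r + 1 / (real m' + 1)" if "h (s, i, r) y = Suc m" for s i r y m
  proof -
    have gt: "of_rat r < g s i y" and m: "m = (LEAST m. of_rat r + 1 / (real m + 1) \<le> g s i y)"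
      using that by (auto simp: h_def split: if_splits)
    show "of_rat r + 1 / (real m + 1) \<le> g s i y"
      unfolding m by (rule LeastI_ex[OF arch[OF gt]])
    show "g s i y < of_rat r + 1 / (real m' + 1)" if "m' < m" for m'
      using not_less_Least[OF that[unfolded m]] by simp
  qed
  have open_sets: "U \<in> sets N" if "openin mtopology U" for U
    unfolding sets using that by (intro sigma_sets.Basic) simp
  have [measurable]: "(\<lambda>y. d y (q i)) \<in> borel_measurable N" for i
  proof (rule borel_measurableI_less)
    fix a
    have "{y \<in> space N. d y (q i) < a} = mball (q i) a"
      using q by (auto simp: sp commute)
    then show "{y \<in> space N. d y (q i) < a} \<in> sets N"
      by (simp add: open_sets)
  qed
  have [measurable]: "(\<lambda>y. g s i y) \<in> borel_measurable N" for s i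
    unfolding g_def by (cases s) simp_all
  have [measurable]: "h p \<in> measurable N (count_space UNIV)" for p
    unfolding h_def by (cases p) simp
  have c_meas: "(\<lambda>y. c y n) \<in> measurable N (count_space UNIV)" for n
    unfolding c_def by (cases "even n") simp_all
  have near: "d y (q (LEAST i. d y (q i) \<le> 1 / (real k + 1))) \<le> 1 / (real k + 1)" if "y \<in> M" for y k
  proof (rule LeastI_ex)
    obtain i where "d y (q i) < 1 / (real k + 1)" using dense[OF \<open>y \<in> M\<close>, of "1 / (real k + 1)"] by auto
    then show "\<exists>i. d y (q i) \<le> 1 / (real k + 1)" by (intro exI[of _ i]) simp
  qed
  have "closed_code M c"
    unfolding closed_code_def
  proof (intro allI impI)
    fix \<alpha> assume "\<forall>n. \<exists>z\<in>M. \<forall>i<n. c z i = \<alpha> i"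
    then have "\<forall>n. \<exists>z. z \<in> M \<and> (\<forall>i<n. c z i = \<alpha> i)" by blast
    from choice[OF this] obtain Y where "\<forall>n. Y n \<in> M \<and> (\<forall>i<n. c (Y n) i = \<alpha> i)" ..
    then have Y: "Y n \<in> M" "\<And>i. i < n \<Longrightarrow> c (Y n) i = \<alpha> i" for n by simp_all
    have Yq: "d (Y n) (q (\<alpha> (2 * k))) \<le> 1 / (real k + 1)" if "n > 2 * k" for n k
      using near[OF Y(1), of n k] Y(2)[OF that] by (simp add: c_even)
    have "MCauchy Y"
      unfolding MCauchy_def
    proof (intro conjI allI impI)
      show "range Y \<subseteq> M" using Y(1) by blast
      fix e :: real assume "e > 0"
      \<comment> \<open>The summand 0 is the left end in \<open>arch\<close>; with
        \<open>e / 3\<close> two weak bounds still add up to a strict one.\<close>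
      then obtain k where k: "0 + 1 / (real k + 1) \<le> e / 3" using arch[of 0 "e / 3"] by auto
      show "\<exists>N. \<forall>n n'. N \<le> n \<longrightarrow> N \<le> n' \<longrightarrow> d (Y n) (Y n') < e"
      proof (intro exI allI impI)
        fix n n' assume nn: "Suc (2 * k) \<le> n" "Suc (2 * k) \<le> n'"
        have "d (Y n) (Y n') \<le> d (Y n) (q (\<alpha> (2 * k))) + d (q (\<alpha> (2 * k))) (Y n')"
          using Y(1) q by (intro triangle)
        also have "\<dots> \<le> e / 3 + e / 3"
          using Yq[of k n] Yq[of k n'] nn k by (simp add: commute[of "q (\<alpha> (2 * k))"])
        also have "\<dots> < e" using \<open>e > 0\<close> by simp
        finally show "d (Y n) (Y n') < e" .
      qed
    qed
    then obtain y where "limitin mtopology Y y sequentially"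
      using comp unfolding mcomplete_def by blast
    then have y: "y \<in> M" and lim: "(\<lambda>n. d (Y n) y) \<longlonglongrightarrow> 0"
      by (simp_all add: limitin_metric_dist_null)
    have dlim: "(\<lambda>n. d (Y n) (q i)) \<longlonglongrightarrow> d y (q i)" for i
    proof -
      have "norm (d (Y n) (q i) - d y (q i)) \<le> d (Y n) y" for n
        using triangle[OF Y(1)[of n] y q[of i]] triangle[OF y Y(1)[of n] q[of i]] commute[of y "Y n"]
        by (simp add: abs_le_iff)
      then have "(\<lambda>n. d (Y n) (q i) - d y (q i)) \<longlonglongrightarrow> 0"
        by (intro Lim_null_comparison[OF _ lim]) simp
      then show ?thesis by (simp add: LIM_zero_iff)
    qed
    have glim: "(\<lambda>n. g s i (Y n)) \<longlonglongrightarrow> g s i y" for s i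
      unfolding g_def using dlim[of i] by (cases s) (auto intro: tendsto_minus)
    have hY: "h p (Y n) = \<alpha> (Suc (2 * to_nat p))" if "n > Suc (2 * to_nat p)" for p n
      using Y(2)[OF that] by (simp add: c_odd)
    \<comment> \<open>This is the use of the recorded margin: a strict comparison that holds along
      \<open>Y\<close> stays strict in the limit.\<close>
    have up: "of_rat r + 1 / (real m + 1) \<le> g s i y" if "\<alpha> (Suc (2 * to_nat (s, i, r))) = Suc m" for s i r m
    proof (rule LIMSEQ_le_const[OF glim])
      show "\<exists>N. \<forall>n\<ge>N. of_rat r + 1 / (real m + 1) \<le> g s i (Y n)"
        using hSuc(1)[OF hY[THEN trans, OF _ that]]
        by (intro exI[of _ "Suc (Suc (2 * to_nat (s, i, r)))"]) simp
    qed
    have h_y: "h (s, i, r) y = \<alpha> (Suc (2 * to_nat (s, i, r)))" for s i r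
    proof (cases "\<alpha> (Suc (2 * to_nat (s, i, r)))")
      case 0
      have "g s i y \<le> of_rat r"
      proof (rule LIMSEQ_le_const2[OF glim])
        show "\<exists>N. \<forall>n\<ge>N. g s i (Y n) \<le> of_rat r"
          using hY[of "(s, i, r)"] 0 by (intro exI[of _ "Suc (Suc (2 * to_nat (s, i, r)))"]) (simp flip: h0)
      qed
      then show ?thesis using 0 by (simp add: h0)
    next
      case (Suc m)
      have ge: "of_rat r + 1 / (real m + 1) \<le> g s i y" by (rule up[OF Suc])
      have lt: "g s i y < of_rat r + 1 / (real m' + 1)" if "m' < m" for m'
      proof -
        \<comment> \<open>A strict upper bound for \<open>g s i\<close> is a strict lower bound for
          \<open>g (\<not> s) i\<close> by the negated rational, and to that bound \<open>up\<close>
          applies.\<close>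
        define r' where "r' = - (r + 1 / (of_nat m' + 1))"
        have r': "of_rat r' = - (of_rat r + 1 / (real m' + 1))"
          by (simp add: r'_def of_rat_minus of_rat_add of_rat_diff of_rat_divide)
        define n where "n = Suc (Suc (2 * to_nat (s, i, r) + 2 * to_nat (\<not> s, i, r')))"
        have "h (s, i, r) (Y n) = Suc m"
          using hY[of "(s, i, r)" n] Suc by (simp add: n_def)
        from hSuc(2)[OF this that] have "of_rat r' < g (\<not> s) i (Y n)"
          by (cases s) (simp_all add: r' g_def)
        then have "h (\<not> s, i, r') (Y n) \<noteq> 0" by (simp add: h0)
        then have "\<alpha> (Suc (2 * to_nat (\<not> s, i, r'))) \<noteq> 0"
          using hY[of "(\<not> s, i, r')" n] by (simp add: n_def)
        then obtain m2 where "\<alpha> (Suc (2 * to_nat (\<not> s, i, r'))) = Suc m2"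
          using not0_implies_Suc by blast
        from up[OF this] have "of_rat r' < g (\<not> s) i y"
          by (smt (verit) of_nat_0_le_iff divide_pos_pos)
        then show ?thesis by (cases s) (simp_all add: r' g_def)
      qed
      have "of_rat r < of_rat r + 1 / (real m + 1)" by simp
      with ge have "\<not> g s i y \<le> of_rat r" by linarith
      moreover have "(LEAST m. of_rat r + 1 / (real m + 1) \<le> g s i y) = m"
        using ge lt by (intro Least_equality) (auto simp: not_less[symmetric])
      ultimately show ?thesis using Suc by (simp add: h_def)
    qed
    have e_y: "(LEAST i. d y (q i) \<le> 1 / (real k + 1)) = \<alpha> (2 * k)" for k
    proof (rule Least_equality)
      show "d y (q (\<alpha> (2 * k))) \<le> 1 / (real k + 1)"
      proof (rule LIMSEQ_le_const2[OF dlim])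
        show "\<exists>N. \<forall>n\<ge>N. d (Y n) (q (\<alpha> (2 * k))) \<le> 1 / (real k + 1)"
          using Yq[of k] by (intro exI[of _ "Suc (2 * k)"]) simp
      qed
      fix j assume j: "d y (q j) \<le> 1 / (real k + 1)"
      show "\<alpha> (2 * k) \<le> j"
      proof (rule ccontr)
        assume "\<not> \<alpha> (2 * k) \<le> j"
        \<comment> \<open>A smaller index \<open>j\<close> fails along \<open>Y\<close>; the
          coordinate for \<open>j\<close> and the rational \<open>1 / (k + 1)\<close> records this
          with a margin, so \<open>j\<close> fails in the limit as well.\<close>
        define r where "r = (1 / (of_nat k + 1) :: rat)"
        have r: "of_rat r = 1 / (real k + 1)" by (simp add: r_def of_rat_divide of_rat_add)
        define n where "n = Suc (Suc (2 * k + 2 * to_nat (True, j, r)))"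
        have "(LEAST i. d (Y n) (q i) \<le> 1 / (real k + 1)) = \<alpha> (2 * k)"
          using Y(2)[of "2 * k" n] by (simp add: n_def c_even)
        then have "\<not> d (Y n) (q j) \<le> 1 / (real k + 1)"
          using not_less_Least[of j "\<lambda>i. d (Y n) (q i) \<le> 1 / (real k + 1)"] \<open>\<not> \<alpha> (2 * k) \<le> j\<close> by simp
        then have "h (True, j, r) (Y n) \<noteq> 0" by (simp add: h0 g_def r)
        then have "\<alpha> (Suc (2 * to_nat (True, j, r))) \<noteq> 0"
          using hY[of "(True, j, r)" n] by (simp add: n_def)
        then obtain m where "\<alpha> (Suc (2 * to_nat (True, j, r))) = Suc m"
          using not0_implies_Suc by blast
        from up[OF this] have "1 / (real k + 1) < d y (q j)"
          by (smt (verit) of_nat_0_le_iff divide_pos_pos r g_def)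
        with j show False by simp
      qed
    qed
    have "c y n = \<alpha> n" for n
    proof (cases "even n")
      case True
      then obtain k where "n = 2 * k" by blast
      then show ?thesis using e_y by (simp add: c_even)
    next
      case False
      then obtain k where n: "n = Suc (2 * k)" by (metis oddE Suc_eq_plus1)
      define p where "p = (from_nat k :: bool \<times> nat \<times> rat)"
      have cp: "c w n = h p w" for w by (simp add: n c_def p_def)
      define m where "m = Suc (Suc (2 * k + 2 * to_nat p))"
      have "\<alpha> n = c (Y m) n" using Y(2)[of n m] by (simp add: m_def n)
      also have "\<dots> = h p (Y m)" by (rule cp)
      also have "\<dots> = \<alpha> (Suc (2 * to_nat p))" using hY[of p m] by (simp add: m_def)
      also have "\<dots> = h p y" by (cases p) (simp add: h_y)
      also have "\<dots> = c y n" by (simp add: cp)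
      finally show ?thesis by simp
    qed
    then show "\<exists>z\<in>M. c z = \<alpha>" using y by (intro bexI[of _ y]) auto
  qed
  moreover have "inj_on c M"
  proof (rule inj_onI, rule ccontr)
    fix z w assume zw: "z \<in> M" "w \<in> M" "c z = c w" "z \<noteq> w"
    then have "d z w > 0" by simp
    then obtain i where i: "d z (q i) < d z w / 3" using dense[OF zw(1), of "d z w / 3"] by auto
    \<comment> \<open>The rational lies between the distances of \<open>z\<close> and
      \<open>w\<close> from \<open>q i\<close>, so one odd coordinate vanishes at \<open>z\<close>
      but not at \<open>w\<close>.\<close>
    obtain r where r: "d z (q i) < of_rat r" "of_rat r < d z w / 3"
      using of_rat_dense[OF i] by blast
    have "d z w \<le> d z (q i) + d w (q i)"
      using triangle[OF zw(1) q zw(2), of i] by (simp add: commute)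
    then have "\<not> d w (q i) \<le> of_rat r" using r \<open>d z w > 0\<close> by linarith
    then have "h (True, i, r) w \<noteq> 0" "h (True, i, r) z = 0"
      using r by (simp_all add: h0 g_def)
    then show False using c_odd[of z "(True, i, r)"] c_odd[of w "(True, i, r)"] zw(3) by simp
  qed
  moreover have "sets N \<subseteq> sigma_sets M {{z \<in> M. c z n = m} |n m. True}" (is "_ \<subseteq> ?G")
  proof -
    interpret G: sigma_algebra M ?G by (intro sigma_algebra_sigma_sets) auto
    \<comment> \<open>Closed balls of rational radius around the \<open>q i\<close> are the sets on
      which one odd coordinate vanishes, and an open set is the union of the countably many that it
      contains.\<close>
    define D where "D p = {z \<in> M. d z (q (fst p)) \<le> of_rat (snd p)}" for p
    have D: "D p \<in> ?G" for p
    proof -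
      have "D p = {z \<in> M. c z (Suc (2 * to_nat (True, fst p, snd p))) = 0}"
        unfolding D_def c_odd h0 by (simp add: g_def)
      then show ?thesis by (intro sigma_sets.Basic CollectI exI conjI TrueI)
    qed
    have "U \<in> ?G" if "openin mtopology U" for U
    proof -
      have "U = (\<Union>p\<in>{p. D p \<subseteq> U}. D p)"
      proof (intro subset_antisym subsetI)
        fix y assume "y \<in> U"
        have U: "U \<subseteq> M" "\<forall>x. x \<in> U \<longrightarrow> (\<exists>r>0. mball x r \<subseteq> U)"
          using that by (simp_all add: openin_mtopology)
        then obtain e where e: "e > 0" "mball y e \<subseteq> U" using \<open>y \<in> U\<close> by metis
        have e3: "y \<in> M" using U(1) \<open>y \<in> U\<close> by (rule subsetD)
        obtain i where i: "d y (q i) < e / 2" using dense[OF e3, of "e / 2"] e(1) by auto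
        obtain r where r: "d y (q i) < of_rat r" "of_rat r < e / 2"
          using of_rat_dense[OF i] by blast
        have "D (i, r) \<subseteq> U"
        proof
          fix z assume "z \<in> D (i, r)"
          then have z: "z \<in> M" "d z (q i) \<le> of_rat r" by (simp_all add: D_def)
          have "d y z \<le> d y (q i) + d z (q i)"
            using triangle[OF e3 q z(1), of i] by (simp add: commute)
          then have "d y z < e" using r z(2) by linarith
          then have "z \<in> mball y e" using z(1) e3 by simp
          then show "z \<in> U" using e(2) by blast
        qed
        moreover have "y \<in> D (i, r)" using r e3 by (simp add: D_def)
        ultimately show "y \<in> (\<Union>p\<in>{p. D p \<subseteq> U}. D p)" by blast
      qed blast
      also have "\<dots> \<in> ?G"
        by (intro G.countable_UN' countableI_type image_subsetI D)
      finally show ?thesis .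
    qed
    then show ?thesis
      unfolding sets by (intro sigma_sets_mono) auto
  qed
  ultimately have "coding N c"
    unfolding coding_def sp by (intro conjI allI c_meas)
  then show ?thesis by (rule exI[of _ c])
qed

lemma standard_borel_imp_coding:
  assumes "standard_borel N"
  shows "\<exists>c. coding N c"
proof -
  obtain T where T: "topspace T = space N" "completely_metrizable_space T" "second_countable T"
    "sets N = sigma_sets (space N) {U. openin T U}"
    using assms unfolding standard_borel_def by (elim exE conjE)
  obtain M d where Md: "Metric_space M d" "Metric_space.mcomplete M d" "T = Metric_space.mtopology M d"
    using T(2) unfolding completely_metrizable_space_def by (elim exE conjE)
  interpret Metric_space M d by (rule Md(1))
  have sp: "space N = M" using T(1) Md(3) by simp
  show ?thesis
  \<comment> \<open>The empty space has no dense sequence; any function codes it.\<close>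
  proof (cases "M = {}")
    case True
    have "A = {}" if "A \<in> sets N" for A
      using sets.sets_into_space[OF that] sp True by simp
    then have "coding N (\<lambda>_ _. 0)"
      unfolding coding_def sp True closed_code_def by (auto intro: sigma_sets.Empty)
    then show ?thesis by (rule exI[of _ "\<lambda>_ _. 0"])
  next
    case False
    have "\<exists>C. countable C \<and> C \<subseteq> M \<and> mtopology closure_of C = M"
      using second_countable_imp_separable_space[OF T(3)] unfolding Md(3) separable_space_def by simp
    then obtain C where C: "countable C" "C \<subseteq> M" "mtopology closure_of C = M"
      by (elim exE conjE)
    have "C \<noteq> {}" using C(3) False by auto
    note q = from_nat_into[OF this] and rq = range_from_nat_into[OF this C(1)]
    show ?thesis
    proof (rule coding_of_dense_seq[OF Md(2) sp])
      show "sets N = sigma_sets M {U. openin mtopology U}" using T(4) Md(3) sp by simp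
      show "from_nat_into C i \<in> M" for i using q C(2) by blast
      fix y e assume "y \<in> M" "e > (0::real)"
      from \<open>y \<in> M\<close> have "y \<in> mtopology closure_of C" by (simp only: C(3))
      then have "\<forall>r>0. \<exists>x\<in>C. x \<in> mball y r"
        unfolding metric_closure_of mem_Collect_eq by (rule conjunct2)
      with \<open>e > 0\<close> obtain x where x: "x \<in> C" "x \<in> mball y e" by metis
      from x(1) have "x \<in> range (from_nat_into C)" by (simp only: rq)
      then obtain i where "x = from_nat_into C i" by (rule rangeE)
      with x(2) have "d y (from_nat_into C i) < e" by simp
      then show "\<exists>i. d y (from_nat_into C i) < e" by (rule exI)
    qed
  qed
qed

section \<open>From codings back to Polish topologies\<close>

definition seq_topology :: "(nat \<Rightarrow> nat) topology" where
  "seq_topology = product_topology (\<lambda>_. discrete_topology UNIV) UNIV"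

lemma topspace_seq [simp]: "topspace seq_topology = UNIV"
  by (simp add: seq_topology_def)

text \<open>A basic open set of the product restricts finitely many coordinates, all of them below
  some \<open>n\<close>; conversely fixing a prefix is a basic open condition.\<close>

lemma openin_seq:
  "openin seq_topology U \<longleftrightarrow> (\<forall>x\<in>U. \<exists>n. \<forall>y. (\<forall>i<n. y i = x i) \<longrightarrow> y \<in> U)"
proof
  assume U: "openin seq_topology U"
  show "\<forall>x\<in>U. \<exists>n. \<forall>y. (\<forall>i<n. y i = x i) \<longrightarrow> y \<in> U"
  proof
    fix x assume "x \<in> U"
    from product_topology_open_contains_basis[OF U[unfolded seq_topology_def] this] obtain V
      where V: "x \<in> Pi\<^sub>E UNIV V" "finite {i. V i \<noteq> UNIV}" "Pi\<^sub>E UNIV V \<subseteq> U"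
      by auto
    obtain n where n: "\<forall>i\<in>{i. V i \<noteq> UNIV}. i < n"
      using V(2) finite_nat_set_iff_bounded by blast
    show "\<exists>n. \<forall>y. (\<forall>i<n. y i = x i) \<longrightarrow> y \<in> U"
    proof (intro exI allI impI)
      fix y assume y: "\<forall>i<n. y i = x i"
      have "y i \<in> V i" for i
      proof (cases "V i = UNIV")
        case False
        then have "y i = x i" using n y by simp
        then show ?thesis using PiE_mem[OF V(1), of i] by simp
      qed simp
      then show "y \<in> U" using V(3) by (auto simp: PiE_UNIV_domain)
    qed
  qed
next
  assume U: "\<forall>x\<in>U. \<exists>n. \<forall>y. (\<forall>i<n. y i = x i) \<longrightarrow> y \<in> U"
  show "openin seq_topology U"
  proof (subst openin_subopen, rule ballI)
    fix x assume "x \<in> U"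
    then obtain n where n: "\<forall>y. (\<forall>i<n. y i = x i) \<longrightarrow> y \<in> U" using U by metis
    let ?V = "\<lambda>i. if i < n then {x i} else UNIV"
    have "openin seq_topology (Pi\<^sub>E UNIV ?V)"
      unfolding seq_topology_def
    proof (rule product_topology_basis)
      have "{i. ?V i \<noteq> topspace (discrete_topology UNIV)} \<subseteq> {..<n}" by auto
      then show "finite {i. ?V i \<noteq> topspace (discrete_topology UNIV)}"
        by (rule finite_subset) simp
    qed simp
    moreover have "Pi\<^sub>E UNIV ?V \<subseteq> U"
    proof
      fix y assume "y \<in> Pi\<^sub>E UNIV ?V"
      then have "y i \<in> ?V i" for i by (simp add: PiE_UNIV_domain Pi_iff)
      then have "\<forall>i<n. y i = x i" by (metis singletonD)
      then show "y \<in> U" using n by simp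
    qed
    moreover have "x \<in> Pi\<^sub>E UNIV ?V" by (simp add: PiE_UNIV_domain)
    ultimately show "\<exists>T. openin seq_topology T \<and> x \<in> T \<and> T \<subseteq> U" by (intro exI conjI)
  qed
qed

lemma closedin_seq_range:
  assumes cl: "closed_code S c"
  shows "closedin seq_topology (c ` S)"
proof -
  have "openin seq_topology (- (c ` S))"
    unfolding openin_seq
  proof (rule ballI, rule ccontr)
    fix x assume x: "x \<in> - (c ` S)" and neg: "\<not> (\<exists>n. \<forall>y. (\<forall>i<n. y i = x i) \<longrightarrow> y \<in> - (c ` S))"
    have "\<exists>z\<in>S. \<forall>i<n. c z i = x i" for n
    proof -
      have "\<exists>y. (\<forall>i<n. y i = x i) \<and> y \<in> c ` S"
        using neg by simp
      then obtain y where y: "\<forall>i<n. y i = x i" "y \<in> c ` S" by (elim exE conjE)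
      from y(2) obtain z where "z \<in> S" "y = c z" by (rule imageE)
      with y(1) show ?thesis by (intro bexI[of _ z]) simp_all
    qed
    then have "\<exists>z\<in>S. c z = x" by (rule closed_codeD[OF cl])
    with x show False by auto
  qed
  then show ?thesis by (simp add: closedin_def Compl_eq_Diff_UNIV)
qed

text \<open>With the topology pulled back along \<open>c\<close> the space is homeomorphic to a
  closed subset of a countable product of discrete spaces, hence completely metrizable. The
  cylinders form a countable base, and therefore the Borel sets of this topology are those of
  \<open>M\<close>.\<close>

lemma coding_imp_standard_borel:
  assumes c: "coding M c"
  shows "standard_borel M"
proof -
  let ?S = "space M"
  let ?T = "pullback_topology ?S c seq_topology"
  have top: "topspace ?T = ?S" by (simp add: topspace_pullback_topology)
  have cyl_open: "openin ?T (cyl c ?S \<sigma>)" for \<sigma>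
  proof -
    have "openin seq_topology {x. \<forall>i<length \<sigma>. x i = \<sigma> ! i}"
      unfolding openin_seq by (intro ballI exI[of _ "length \<sigma>"]) simp
    moreover have "cyl c ?S \<sigma> = c -` {x. \<forall>i<length \<sigma>. x i = \<sigma> ! i} \<inter> ?S"
      by (auto simp: cyl_def)
    ultimately show ?thesis unfolding openin_pullback_topology by blast
  qed
  have base: "\<exists>\<sigma>. z \<in> cyl c ?S \<sigma> \<and> cyl c ?S \<sigma> \<subseteq> U" if "openin ?T U" "z \<in> U" for U z
  proof -
    obtain V where V: "openin seq_topology V" "U = c -` V \<inter> ?S"
      using \<open>openin ?T U\<close> unfolding openin_pullback_topology by (elim exE conjE)
    then have z: "c z \<in> V" "z \<in> ?S" using \<open>z \<in> U\<close> by simp_all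
    obtain n where n: "\<forall>y. (\<forall>i<n. y i = c z i) \<longrightarrow> y \<in> V"
      using V(1) z(1) unfolding openin_seq by metis
    have "cyl c ?S (map (c z) [0..<n]) \<subseteq> U"
    proof
      fix w assume "w \<in> cyl c ?S (map (c z) [0..<n])"
      then have "w \<in> ?S" "\<forall>i<n. c w i = c z i" by (simp_all add: cyl_def)
      then show "w \<in> U" using n V(2) by simp
    qed
    then show ?thesis using mem_cyl_code[OF z(2)] by blast
  qed
  have "homeomorphic_map ?T (subtopology seq_topology (c ` ?S)) c"
  proof (rule bijective_open_imp_homeomorphic_map)
    have "continuous_map ?T seq_topology c"
      unfolding continuous_map_def top
    proof (intro conjI allI impI)
      fix U assume "openin seq_topology U"
      moreover have "{x \<in> ?S. c x \<in> U} = c -` U \<inter> ?S" by blast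
      ultimately show "openin ?T {x \<in> ?S. c x \<in> U}" unfolding openin_pullback_topology by blast
    qed simp
    then show "continuous_map ?T (subtopology seq_topology (c ` ?S)) c"
      by (simp add: continuous_map_in_subtopology top)
    show "open_map ?T (subtopology seq_topology (c ` ?S)) c"
      unfolding open_map_def
    proof (intro allI impI)
      fix U assume "openin ?T U"
      then obtain V where V: "openin seq_topology V" "U = c -` V \<inter> ?S"
        unfolding openin_pullback_topology by (elim exE conjE)
      have "c ` U = V \<inter> c ` ?S" unfolding V(2) by blast
      then show "openin (subtopology seq_topology (c ` ?S)) (c ` U)"
        using V(1) unfolding openin_subtopology by blast
    qed
    show "c ` topspace ?T = topspace (subtopology seq_topology (c ` ?S))"
      by (simp add: top)
    show "inj_on c (topspace ?T)" by (simp add: top coding_inj[OF c])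
  qed
  moreover have "completely_metrizable_space (subtopology seq_topology (c ` ?S))"
  proof (intro completely_metrizable_space_closedin closedin_seq_range coding_closed[OF c])
    show "completely_metrizable_space seq_topology"
      unfolding seq_topology_def completely_metrizable_space_product_topology
      by (simp add: completely_metrizable_space_discrete_topology)
  qed
  ultimately have "completely_metrizable_space ?T"
    using homeomorphic_completely_metrizable_space homeomorphic_map_imp_homeomorphic_space by metis
  moreover have "second_countable ?T"
    unfolding second_countable_def
  proof (intro exI conjI allI impI ballI)
    show "countable (range (cyl c ?S))" by (intro countable_image countableI_type)
    show "openin ?T V" if "V \<in> range (cyl c ?S)" for V using that cyl_open by (elim rangeE) simp
    fix U z assume "openin ?T U \<and> z \<in> U"
    with base[of U z] obtain \<sigma> where "z \<in> cyl c ?S \<sigma>" "cyl c ?S \<sigma> \<subseteq> U" by metis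
    then show "\<exists>V\<in>range (cyl c ?S). z \<in> V \<and> V \<subseteq> U" by (intro bexI[of _ "cyl c ?S \<sigma>"]) simp_all
  qed
  moreover have "sets M = sigma_sets ?S {U. openin ?T U}"
  proof (intro subset_antisym)
    have "{z \<in> ?S. c z n = m} \<in> {U. openin ?T U}" for n m
    proof -
      have "openin seq_topology {x. x n = m}"
        unfolding openin_seq by (intro ballI exI[of _ "Suc n"]) simp
      moreover have "{z \<in> ?S. c z n = m} = c -` {x. x n = m} \<inter> ?S" by auto
      ultimately show ?thesis unfolding openin_pullback_topology by blast
    qed
    then have "sigma_sets ?S {{z \<in> ?S. c z n = m} |n m. True} \<subseteq> sigma_sets ?S {U. openin ?T U}"
      by (intro sigma_sets_mono) (auto intro: sigma_sets.Basic)
    with coding_generates[OF c] show "sets M \<subseteq> sigma_sets ?S {U. openin ?T U}"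
      by (rule subset_trans)
    have "U \<in> sets M" if U: "openin ?T U" for U
    proof -
      have "U = (\<Union>\<sigma>\<in>{\<sigma>. cyl c ?S \<sigma> \<subseteq> U}. cyl c ?S \<sigma>)"
      proof (intro subset_antisym subsetI)
        fix z assume "z \<in> U"
        from base[OF U this] show "z \<in> (\<Union>\<sigma>\<in>{\<sigma>. cyl c ?S \<sigma> \<subseteq> U}. cyl c ?S \<sigma>)" by blast
      qed blast
      also have "\<dots> \<in> sets M"
        by (intro sets.countable_UN'' countableI_type cyl_sets[OF c])
      finally show ?thesis .
    qed
    then show "sigma_sets ?S {U. openin ?T U} \<subseteq> sets M"
      by (intro sets.sigma_sets_subset) blast
  qed
  ultimately show ?thesis
    unfolding standard_borel_def using top by (intro exI[of _ ?T] conjI)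
qed

section \<open>Constructions and theorems for standard Borel spaces\<close>

theorem standard_borel_restrict:
  assumes "standard_borel M" "B \<in> sets M"
  shows "standard_borel (restrict_space M B)"
proof -
  obtain c0 where "coding M c0" using standard_borel_imp_coding[OF assms(1)] by blast
  \<comment> \<open>Once \<open>B\<close> is decided, a limit that shares a long prefix with a point
    of \<open>B\<close> lies in \<open>B\<close>, so the code of \<open>B\<close> is closed
    again.\<close>
  from exists_deciding_coding[OF this, of "\<lambda>_. B"] assms(2)
  obtain c where c: "coding M c" and dec: "decides c (space M) B" by auto
  have BM: "B \<subseteq> space M" by (rule sets.sets_into_space[OF assms(2)])
  then have sp: "space (restrict_space M B) = B" by (auto simp: space_restrict_space)
  have "coding (restrict_space M B) c"
    unfolding coding_def sp
  proof (intro conjI allI)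
    show "(\<lambda>z. c z n) \<in> measurable (restrict_space M B) (count_space UNIV)" for n
      by (rule measurable_restrict_space1[OF coding_measurable[OF c]])
    show "inj_on c B" by (rule inj_on_subset[OF coding_inj[OF c] BM])
    show "closed_code B c"
      unfolding closed_code_def
    proof (intro allI impI)
      fix \<alpha> assume \<alpha>: "\<forall>n. \<exists>z\<in>B. \<forall>i<n. c z i = \<alpha> i"
      have "\<exists>z\<in>space M. \<forall>i<n. c z i = \<alpha> i" for n
      proof -
        obtain z where "z \<in> B" "\<forall>i<n. c z i = \<alpha> i" using \<alpha> by metis
        then show ?thesis using BM by (intro bexI[of _ z]) auto
      qed
      from closed_codeD[OF coding_closed[OF c] this] obtain z where z: "z \<in> space M" "c z = \<alpha>" by blast
      obtain n where n: "\<And>u v. u \<in> space M \<Longrightarrow> v \<in> space M \<Longrightarrow> agree c n u v \<Longrightarrow> (u \<in> B) = (v \<in> B)"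
        using dec unfolding decides_def by blast
      obtain w where w: "w \<in> B" "\<forall>i<n. c w i = \<alpha> i" using \<alpha> by metis
      then have "agree c n w z" using z(2) by (simp add: agree_def)
      then have "z \<in> B" using n[of w z] w(1) BM z(1) by auto
      then show "\<exists>z\<in>B. c z = \<alpha>" using z(2) by blast
    qed
    let ?G = "sigma_sets B {{z \<in> B. c z n = m} |n m. True}"
    have "sets (restrict_space M B) = sigma_sets B ((\<inter>) B ` {{z \<in> space M. c z n = m} |n m. True})"
    proof -
      note gen = coding_sets[OF c]
      have "sets (restrict_space M B) = (\<inter>) B ` sigma_sets (space M) {{z \<in> space M. c z n = m} |n m. True}"
        unfolding sets_restrict_space gen ..
      also have "\<dots> = sigma_sets B ((\<inter>) B ` {{z \<in> space M. c z n = m} |n m. True})"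
        by (rule sigma_sets_Int[OF _ BM]) (use assms(2) gen in simp)
      finally show ?thesis .
    qed
    also have "\<dots> \<subseteq> ?G"
    proof (rule sigma_sets_mono, rule subsetI)
      fix A assume "A \<in> (\<inter>) B ` {{z \<in> space M. c z n = m} |n m. True}"
      then obtain n m where "A = B \<inter> {z \<in> space M. c z n = m}" by blast
      then have "A = {z \<in> B. c z n = m}" using BM by blast
      then show "A \<in> ?G" by (intro sigma_sets.Basic) blast
    qed
    finally show "sets (restrict_space M B) \<subseteq> ?G" .
  qed
  then show ?thesis by (rule coding_imp_standard_borel)
qed

text \<open>Codings of the factors are interleaved; a limit of interleaved codes splits into a limit
  for each factor.\<close>

lemma standard_borel_pair:
  assumes "standard_borel M" "standard_borel N"
  shows "standard_borel (M \<Otimes>\<^sub>M N)"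
proof -
  obtain c where c: "coding M c" using standard_borel_imp_coding[OF assms(1)] by blast
  obtain d where d: "coding N d" using standard_borel_imp_coding[OF assms(2)] by blast
  define e where "e p n = (if even n then c (fst p) (n div 2) else d (snd p) (n div 2))" for p n
  have e0: "e p (2 * n) = c (fst p) n" and e1: "e p (Suc (2 * n)) = d (snd p) n" for p n
    by (simp_all add: e_def)
  let ?S = "space M \<times> space N"
  let ?gen = "{{p \<in> ?S. e p n = m} |n m. True}"
  have "coding (M \<Otimes>\<^sub>M N) e"
    unfolding coding_def space_pair_measure
  proof (intro conjI allI)
    show "(\<lambda>p. e p n) \<in> measurable (M \<Otimes>\<^sub>M N) (count_space UNIV)" for n
      unfolding e_def
    proof (cases "even n")
      case True
      show "(\<lambda>p. if even n then c (fst p) (n div 2) else d (snd p) (n div 2)) \<in> measurable (M \<Otimes>\<^sub>M N) (count_space UNIV)"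
        unfolding if_P[OF True] by (rule measurable_compose[OF measurable_fst coding_measurable[OF c]])
    next
      case False
      show "(\<lambda>p. if even n then c (fst p) (n div 2) else d (snd p) (n div 2)) \<in> measurable (M \<Otimes>\<^sub>M N) (count_space UNIV)"
        unfolding if_not_P[OF False] by (rule measurable_compose[OF measurable_snd coding_measurable[OF d]])
    qed
    show "inj_on e ?S"
    proof (rule inj_onI)
      fix p q assume pq: "p \<in> ?S" "q \<in> ?S" "e p = e q"
      have "c (fst p) n = c (fst q) n" "d (snd p) n = d (snd q) n" for n
        using e0[of p n] e0[of q n] e1[of p n] e1[of q n] pq(3) by simp_all
      then have "c (fst p) = c (fst q)" "d (snd p) = d (snd q)" by (simp_all add: fun_eq_iff)
      then have "fst p = fst q" "snd p = snd q"
        using pq inj_onD[OF coding_inj[OF c]] inj_onD[OF coding_inj[OF d]] by auto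
      then show "p = q" by (rule prod_eqI)
    qed
    show "closed_code ?S e"
      unfolding closed_code_def
    proof (intro allI impI)
      fix \<alpha> assume \<alpha>: "\<forall>n. \<exists>p\<in>?S. \<forall>i<n. e p i = \<alpha> i"
      have "\<exists>x\<in>space M. \<forall>i<n. c x i = \<alpha> (2 * i)" for n
      proof -
        obtain p where "p \<in> ?S" "\<forall>i<2 * n. e p i = \<alpha> i" using \<alpha> by metis
        then show ?thesis by (intro bexI[of _ "fst p"]) (auto simp flip: e0)
      qed
      from closed_codeD[OF coding_closed[OF c] this] obtain x where x: "x \<in> space M" "c x = (\<lambda>i. \<alpha> (2 * i))" by blast
      have "\<exists>x\<in>space N. \<forall>i<n. d x i = \<alpha> (Suc (2 * i))" for n
      proof -
        obtain p where "p \<in> ?S" "\<forall>i<2 * n. e p i = \<alpha> i" using \<alpha> by metis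
        then show ?thesis by (intro bexI[of _ "snd p"]) (auto simp flip: e1)
      qed
      from closed_codeD[OF coding_closed[OF d] this] obtain y where y: "y \<in> space N" "d y = (\<lambda>i. \<alpha> (Suc (2 * i)))" by blast
      have "e (x, y) n = \<alpha> n" for n
        by (cases "even n") (auto simp: e_def x(2) y(2) elim!: oddE)
      then show "\<exists>p\<in>?S. e p = \<alpha>" using x(1) y(1) by (intro bexI[of _ "(x, y)"]) auto
    qed
    let ?G = "sigma ?S ?gen"
    have sub: "?gen \<subseteq> Pow ?S" by auto
    have sG: "sets ?G = sigma_sets ?S ?gen" "space ?G = ?S" using sub by simp_all
    have "fst \<in> measurable ?G M"
    proof (rule measurable_sigma_sets[OF coding_sets[OF c]])
      show "fst \<in> space ?G \<rightarrow> space M" unfolding sG by auto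
      fix A assume "A \<in> {{z \<in> space M. c z n = m} |n m. True}"
      then obtain n m where A: "A = {z \<in> space M. c z n = m}" by blast
      have "fst -` A \<inter> space ?G = {p \<in> ?S. e p (2 * n) = m}"
        unfolding sG A e0 by auto
      then show "fst -` A \<inter> space ?G \<in> sets ?G" unfolding sG(1) by (intro sigma_sets.Basic) blast
    qed auto
    moreover have "snd \<in> measurable ?G N"
    proof (rule measurable_sigma_sets[OF coding_sets[OF d]])
      show "snd \<in> space ?G \<rightarrow> space N" unfolding sG by auto
      fix A assume "A \<in> {{z \<in> space N. d z n = m} |n m. True}"
      then obtain n m where A: "A = {z \<in> space N. d z n = m}" by blast
      have "snd -` A \<inter> space ?G = {p \<in> ?S. e p (Suc (2 * n)) = m}"
        unfolding sG A e1 by auto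
      then show "snd -` A \<inter> space ?G \<in> sets ?G" unfolding sG(1) by (intro sigma_sets.Basic) blast
    qed auto
    ultimately have fs: "fst -` a \<inter> space ?G \<in> sets ?G" "snd -` b \<inter> space ?G \<in> sets ?G"
      if "a \<in> sets M" "b \<in> sets N" for a b
      using that by (auto intro: measurable_sets)
    have "a \<times> b \<in> sets ?G" if "a \<in> sets M" "b \<in> sets N" for a b
    proof -
      have "a \<times> b = (fst -` a \<inter> space ?G) \<inter> (snd -` b \<inter> space ?G)"
        unfolding sG using sets.sets_into_space[OF that(1)] sets.sets_into_space[OF that(2)] by auto
      also have "\<dots> \<in> sets ?G" by (intro sets.Int fs[OF that])
      finally show ?thesis .
    qed
    then have "a \<times> b \<in> sigma_sets ?S ?gen" if "a \<in> sets M" "b \<in> sets N" for a b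
      using that unfolding sG(1) by blast
    then have "sigma_sets ?S {a \<times> b |a b. a \<in> sets M \<and> b \<in> sets N} \<subseteq> sigma_sets ?S ?gen"
      by (intro sigma_sets_mono subsetI) (elim CollectE exE conjE, simp)
    then show "sets (M \<Otimes>\<^sub>M N) \<subseteq> sigma_sets ?S ?gen"
      unfolding sets_pair_measure .
  qed
  then show ?thesis by (rule coding_imp_standard_borel)
qed

text \<open>Equality means agreement in all coordinates of a coding, a countable condition on
  measurable functions with values in the natural numbers.\<close>

lemma sets_Collect_eq:
  assumes "standard_borel N" "f \<in> measurable M N" "g \<in> measurable M N"
  shows "{x \<in> space M. f x = g x} \<in> sets M"
proof -
  obtain d where d: "coding N d" using standard_borel_imp_coding[OF assms(1)] by blast
  define h k where "h n x = d (f x) n" and "k n x = d (g x) n" for n x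
  have hk: "h n \<in> measurable M (count_space UNIV)" "k n \<in> measurable M (count_space UNIV)" for n
    unfolding h_def k_def
    by (rule measurable_compose[OF assms(2) coding_measurable[OF d]],
      rule measurable_compose[OF assms(3) coding_measurable[OF d]])
  have "f x = g x \<longleftrightarrow> (\<forall>n. d (f x) n = d (g x) n)" if "x \<in> space M" for x
    using inj_onD[OF coding_inj[OF d], of "f x" "g x"] measurable_space[OF assms(2) that]
      measurable_space[OF assms(3) that] by (auto simp: fun_eq_iff)
  then have "{x \<in> space M. f x = g x} =
      {x \<in> space M. \<forall>n\<in>UNIV. x \<in> (\<Union>m. (h n -` {m} \<inter> space M) \<inter> (k n -` {m} \<inter> space M))}"
    by (auto simp: h_def k_def)
  also have "\<dots> \<in> sets M"
    by (intro sets_Collect_ball_mem sets.countable_UN'' sets.Int measurable_sets[OF hk(1)]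
        measurable_sets[OF hk(2)] countableI_type) auto
  finally show ?thesis .
qed

text \<open>Deciding the countably many sets where \<open>d (f z) n = m\<close> only requires a
  finer coding of \<open>M\<close>; the coding of \<open>N\<close> stays fixed.\<close>

lemma exists_coded_map:
  assumes "standard_borel M" "standard_borel N" "f \<in> measurable M N"
  shows "\<exists>c d. coded_map M N c d f"
proof -
  obtain c0 where c0: "coding M c0" using standard_borel_imp_coding[OF assms(1)] by blast
  obtain d where d: "coding N d" using standard_borel_imp_coding[OF assms(2)] by blast
  let ?B = "\<lambda>p. {z \<in> space M. d (f z) (fst p) = snd p}"
  have "?B p \<in> sets M" for p
    using measurable_sets[OF measurable_compose[OF assms(3) coding_measurable[OF d]], of "{snd p}" "fst p"]
    by (simp add: vimage_def Int_def conj_commute)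
  from exists_deciding_coding[OF c0 this, of prod_decode] obtain c where
    c: "coding M c" "\<forall>i. decides c (space M) (?B (prod_decode i))" by blast
  have "decides c (space M) {z \<in> space M. d (f z) n = m}" for n m
    using spec[OF c(2), of "prod_encode (n, m)"] by simp
  then show ?thesis using c(1) d assms(3) unfolding coded_map_def by blast
qed

theorem lusin_novikov:
  assumes "standard_borel M" "standard_borel N" "f \<in> measurable M N"
    and "\<And>x. x \<in> space N \<Longrightarrow> countable {z \<in> space M. f z = x}"
  obtains F :: "nat \<Rightarrow> 'a set" where "\<And>k. F k \<in> sets M" "\<And>k. inj_on f (F k)" "(\<Union>k. F k) = space M"
proof -
  obtain c d where "coded_map M N c d f" using exists_coded_map[OF assms(1-3)] by blast
  then interpret coded_map M N c d f .
  have "small (space M)" by (rule small_space) (rule assms(4))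
  then obtain F :: "nat \<Rightarrow> 'a set"
    where F: "\<forall>k. F k \<in> sets M \<and> inj_on f (F k)" "space M = (\<Union>k. F k)"
    unfolding small_def by (elim exE conjE)
  show thesis by (rule that[of F]) (use F in auto)
qed

theorem lusin_souslin:
  assumes "standard_borel M" "standard_borel N" "B \<in> sets M"
    and f: "f \<in> measurable (restrict_space M B) N" and inj: "inj_on f B"
  shows "f ` B \<in> sets N"
proof -
  have "B \<subseteq> space M" by (rule sets.sets_into_space[OF assms(3)])
  then have sp: "space (restrict_space M B) = B" by (auto simp: space_restrict_space)
  obtain c d where "coded_map (restrict_space M B) N c d f"
    using exists_coded_map[OF standard_borel_restrict[OF assms(1,3)] assms(2) f] by blast
  then interpret coded_map "restrict_space M B" N c d f .
  show ?thesis using image_sets inj unfolding sp by blast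
qed

text \<open>A preimage under the inverse is the image of a Borel subset of \<open>B\<close>, which
  is Borel by \<open>lusin_souslin\<close>.\<close>

theorem borel_iso_image:
  assumes M: "standard_borel M" and N: "standard_borel N" and B: "B \<in> sets M"
    and f: "f \<in> measurable (restrict_space M B) N" and inj: "inj_on f B"
  shows "borel_iso (restrict_space M B) (restrict_space N (f ` B)) f"
proof -
  have BM: "B \<subseteq> space M" by (rule sets.sets_into_space[OF B])
  then have sp: "space (restrict_space M B) = B" by (auto simp: space_restrict_space)
  have fB: "f ` B \<in> sets N" by (rule lusin_souslin[OF assms])
  have "f ` B \<subseteq> space N" by (rule sets.sets_into_space[OF fB])
  then have sp2: "space (restrict_space N (f ` B)) = f ` B" by (auto simp: space_restrict_space)
  show ?thesis
    unfolding borel_iso_def sp sp2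
  proof (intro conjI)
    show "f \<in> measurable (restrict_space M B) (restrict_space N (f ` B))"
      by (rule measurable_restrict_space2[OF _ f]) (simp add: sp)
    show "bij_betw f B (f ` B)" using inj by (rule inj_on_imp_bij_betw)
    show "the_inv_into B f \<in> measurable (restrict_space N (f ` B)) (restrict_space M B)"
    proof (rule measurableI)
      fix y assume "y \<in> space (restrict_space N (f ` B))"
      then show "the_inv_into B f y \<in> space (restrict_space M B)"
        unfolding sp sp2 by (intro the_inv_into_into[OF inj]) auto
    next
      fix A assume A: "A \<in> sets (restrict_space M B)"
      have AB: "A \<subseteq> B" using sets.sets_into_space[OF A] unfolding sp .
      have AM: "A \<in> sets M" using A B sets_restrict_space_iff[of B M A] BM by (simp add: Int_absorb2)
      have "f ` A \<in> sets N"
      proof (rule lusin_souslin[OF M N AM])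
        have "f \<in> measurable (restrict_space (restrict_space M B) A) N"
          by (rule measurable_restrict_space1[OF f])
        moreover have "restrict_space (restrict_space M B) A = restrict_space M A"
          using restrict_restrict_space[of B M A] AB BM AM B
          by (simp add: Int_absorb1 Int_absorb2 subset_trans[OF AB BM])
        ultimately show "f \<in> measurable (restrict_space M A) N" by simp
        show "inj_on f A" by (rule inj_on_subset[OF inj AB])
      qed
      moreover have "the_inv_into B f -` A \<inter> f ` B = f ` A"
        using AB the_inv_into_f_f[OF inj] by (auto simp: image_iff)
      moreover have "f ` A \<subseteq> f ` B" using AB by blast
      ultimately show "the_inv_into B f -` A \<inter> space (restrict_space N (f ` B)) \<in> sets (restrict_space N (f ` B))"
        unfolding sp2 using fB \<open>f ` B \<subseteq> space N\<close> by (simp add: sets_restrict_space_iff Int_absorb2)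
    qed
  qed
qed

section \<open>Walks and trees\<close>

lemma walk_append:
  "walk G u p w \<Longrightarrow> walk G w q v \<Longrightarrow> walk G u (p @ q) v"
  by (induction p arbitrary: u) auto

lemma walk_appendD:
  "walk G u (p @ q) v \<Longrightarrow> serre_graph G \<Longrightarrow> \<exists>w. walk G u p w \<and> walk G w q v"
proof (induction p arbitrary: u)
  case Nil
  have "u \<in> verts G"
  proof (cases q)
    case Nil
    then show ?thesis using Nil.prems by auto
  next
    case (Cons a r)
    then have "a \<in> edges G" "org G a = u" using Nil.prems(1) by simp_all
    then show ?thesis using Nil.prems(2) unfolding serre_graph_def by blast
  qed
  then show ?case using Nil.prems by (intro exI[of _ u]) simp
next
  case (Cons a p)
  then have a: "a \<in> edges G" "org G a = u" "walk G (ter G a) (p @ q) v" by simp_all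
  obtain w where "walk G (ter G a) p w" "walk G w q v" using Cons.IH[OF a(3) Cons.prems(2)] by blast
  then show ?case using a by (intro exI[of _ w]) simp
qed

lemma ter_opp: "serre_graph G \<Longrightarrow> a \<in> edges G \<Longrightarrow> ter G (opp G a) = org G a"
  unfolding serre_graph_def by metis

lemma walk_reverse:
  "walk G u p v \<Longrightarrow> serre_graph G \<Longrightarrow> \<exists>q. walk G v q u"
proof (induction p arbitrary: u)
  case Nil
  then show ?case by (intro exI[of _ "[]"]) auto
next
  case (Cons a p)
  then have a: "a \<in> edges G" "org G a = u" "walk G (ter G a) p v" by simp_all
  obtain q where q: "walk G v q (ter G a)" using Cons.IH[OF a(3) Cons.prems(2)] by blast
  have "walk G (ter G a) [opp G a] u"
    using a(1,2) Cons.prems(2) ter_opp[OF Cons.prems(2) a(1)] unfolding serre_graph_def by auto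
  from walk_append[OF q this] show ?case by (rule exI)
qed

lemma graph_connected_root:
  assumes G: "serre_graph G" and r: "r \<in> verts G"
    and root: "\<And>v. v \<in> verts G \<Longrightarrow> \<exists>p. walk G v p r"
  shows "graph_connected G"
  unfolding graph_connected_def
proof (intro conjI ballI)
  show "verts G \<noteq> {}" using r by blast
  fix u v assume "u \<in> verts G" "v \<in> verts G"
  then obtain p q where p: "walk G u p r" and "walk G v q r" using root by metis
  from walk_reverse[OF this(2) G] obtain q' where "walk G r q' v" by (rule exE)
  from walk_append[OF p this] show "\<exists>p. walk G u p v" by (rule exI)
qed

lemma walk_mono:
  assumes "verts H \<subseteq> verts G" "edges H \<subseteq> edges G" "org H = org G" "ter H = ter G"
  shows "walk H u p v \<Longrightarrow> walk G u p v"
  using assms by (induction p arbitrary: u) auto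

lemma circuit_mono:
  assumes "verts H \<subseteq> verts G" "edges H \<subseteq> edges G" "org H = org G" "ter H = ter G" "opp H = opp G"
  shows "circuit H p \<Longrightarrow> circuit G p"
  using walk_mono[OF assms(1-4)] assms(4,5) unfolding circuit_def by auto

text \<open>Induction along the walk: if the simple walk from the second vertex passes through
  \<open>u\<close>, only what follows that visit is kept.\<close>

lemma simple_walk:
  "walk G u p v \<Longrightarrow> serre_graph G \<Longrightarrow> \<exists>q. walk G u q v \<and> distinct (u # map (ter G) q)"
proof (induction p arbitrary: u)
  case Nil
  then show ?case by (intro exI[of _ "[]"]) auto
next
  case (Cons a p)
  then have a: "a \<in> edges G" "org G a = u" "walk G (ter G a) p v" by simp_all
  obtain q where q: "walk G (ter G a) q v" "distinct (ter G a # map (ter G) q)"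
    using Cons.IH[OF a(3) Cons.prems(2)] by blast
  show ?case
  proof (cases "u \<in> set (map (ter G) (a # q))")
    case False
    then show ?thesis using a q by (intro exI[of _ "a # q"]) auto
  next
    case True
    then obtain b where b: "b \<in> set (a # q)" "ter G b = u" by auto
    then obtain q1 q2 where s: "a # q = q1 @ b # q2" using split_list by metis
    have "walk G u (a # q) v" using a q by simp
    then obtain w where "walk G w (b # q2) v" unfolding s using walk_appendD[OF _ Cons.prems(2)] by metis
    then have "walk G u q2 v" using b(2) by simp
    moreover have "distinct (map (ter G) (q1 @ b # q2))" unfolding s[symmetric] using q(2) by simp
    then have "distinct (u # map (ter G) q2)" using b(2) by auto
    ultimately show ?thesis by blast
  qed
qed

lemma walk_nth_org:
  "walk G u p v \<Longrightarrow> i < length p \<Longrightarrow> p ! i \<in> edges G \<and> org G (p ! i) = (u # map (ter G) p) ! i"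
proof (induction p arbitrary: u i)
  case (Cons a p)
  then show ?case by (cases i) auto
qed simp

lemma walk_last: "walk G u p v \<Longrightarrow> v = last (u # map (ter G) p)"
  by (induction p arbitrary: u) auto

text \<open>A new edge \<open>e\<close> has both ends in the tree, which already spans; followed by
  a simple walk back through the tree it forms a circuit. A return along an edge inside the walk
  would repeat a vertex, and the walk cannot begin with the opposite of \<open>e\<close>, which is
  outside the tree like \<open>e\<close> itself.\<close>

lemma maximal_subtree_spanning:
  assumes G: "serre_graph G" and sub: "is_subtree G V E" and V: "V = verts G"
  shows "maximal_subtree G V E"
  unfolding maximal_subtree_def
proof (intro conjI allI impI)
  show "is_subtree G V E" by (rule sub)
  fix V' E' assume *: "is_subtree G V' E' \<and> V \<subseteq> V' \<and> E \<subseteq> E'"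
  then show "V' = V" unfolding is_subtree_def using V by blast
  then have V': "V' = V" .
  let ?T = "restrict_graph G V E" and ?T' = "restrict_graph G V' E'"
  have T: "serre_graph ?T" "graph_connected ?T" using sub unfolding is_subtree_def is_tree_def by blast+
  have T': "serre_graph ?T'" "\<not> (\<exists>p. circuit ?T' p)" using * unfolding is_subtree_def is_tree_def by blast+
  have simps: "verts (restrict_graph G A B) = A" "edges (restrict_graph G A B) = B"
    "org (restrict_graph G A B) = org G" "ter (restrict_graph G A B) = ter G"
    "opp (restrict_graph G A B) = opp G" for A B
    by (simp_all add: restrict_graph_def)
  show "E' = E"
  proof (rule ccontr)
    assume "E' \<noteq> E"
    then obtain e where e: "e \<in> E'" "e \<notin> E" using * by blast
    have "org G e \<in> V" "ter G e \<in> V"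
      using T'(1) e(1) unfolding serre_graph_def simps V' by blast+
    then obtain p where "walk ?T (ter G e) p (org G e)"
      using T(2) unfolding graph_connected_def simps by blast
    from simple_walk[OF this T(1)] obtain q where
      q: "walk ?T (ter G e) q (org G e)" "distinct (ter G e # map (ter G) q)"
      unfolding simps by blast
    have wq: "walk ?T' (ter G e) q (org G e)"
      by (rule walk_mono[OF _ _ _ _ q(1)]) (use * V' in \<open>simp_all add: simps\<close>)
    have "circuit ?T' (e # q)"
      unfolding circuit_def
    proof (intro conjI exI allI impI)
      show "e # q \<noteq> []" by simp
      show "walk ?T' (org G e) (e # q) (org G e)" using wq e(1) by (simp add: simps)
      show "distinct (map (ter ?T') (e # q))" using q(2) by (simp add: simps)
      fix i assume i: "Suc i < length (e # q)"
      show "(e # q) ! Suc i \<noteq> opp ?T' ((e # q) ! i)"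
      proof
        assume eq: "(e # q) ! Suc i = opp ?T' ((e # q) ! i)"
        have qi: "q ! i \<in> E" "org G (q ! i) = (ter G e # map (ter G) q) ! i"
          using walk_nth_org[OF q(1), of i] i by (simp_all add: simps)
        show False
        proof (cases i)
          case 0
          then have "q ! i = opp G e" using eq by (simp add: simps)
          then have "opp G (opp G e) \<in> E" using qi(1) T(1) unfolding serre_graph_def simps by metis
          moreover have "opp G (opp G e) = e" using T'(1) e(1) unfolding serre_graph_def simps by metis
          ultimately show False using e(2) by simp
        next
          case (Suc k)
          then have k: "q ! Suc k = opp G (q ! k)" "k < length q" using eq i by (simp_all add: simps)
          have "q ! k \<in> E" "org G (q ! k) = (ter G e # map (ter G) q) ! k"
            using walk_nth_org[OF q(1) k(2)] by (simp_all add: simps)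
          moreover have "ter G (opp G (q ! k)) = org G (q ! k)"
            using ter_opp[OF T(1), of "q ! k"] \<open>q ! k \<in> E\<close> by (simp add: simps)
          ultimately have "(ter G e # map (ter G) q) ! Suc (Suc k) = (ter G e # map (ter G) q) ! k"
            using k(1) i Suc by simp
          then show False
            using nth_eq_iff_index_eq[OF q(2), of "Suc (Suc k)" k] i Suc by simp
        qed
      qed
    qed
    with T'(2) show False by blast
  qed
qed

text \<open>Vertices are ordered so that every edge joins a vertex to its parent, which is smaller.
  At the largest vertex of a circuit the walk would have to return along the edge it came from.\<close>

lemma parent_graph_no_circuit:
  fixes G :: "(nat, 'e) sgraph"
  assumes G: "serre_graph G"
    and loop: "\<And>a. a \<in> edges G \<Longrightarrow> org G a \<noteq> ter G a"
    and parent: "\<And>a b. a \<in> edges G \<Longrightarrow> b \<in> edges G \<Longrightarrow> ter G a = org G b \<Longrightarrow>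
      org G a < ter G a \<Longrightarrow> ter G b < org G b \<Longrightarrow> b = opp G a"
  shows "\<not> circuit G p"
proof
  assume "circuit G p"
  then obtain u where p: "p \<noteq> []" "walk G u p u" "distinct (map (ter G) p)"
    and nb: "\<And>i. Suc i < length p \<Longrightarrow> p ! Suc i \<noteq> opp G (p ! i)"
    unfolding circuit_def by blast
  let ?ts = "map (ter G) p"
  define m where "m = Max (set ?ts)"
  have "m \<in> set ?ts" unfolding m_def by (rule Max_in) (use p(1) in auto)
  then obtain i where i: "i < length p" "ter G (p ! i) = m" by (auto simp: in_set_conv_nth)
  have le: "ter G (p ! k) \<le> m" if "k < length p" for k
    unfolding m_def using that by (intro Max_ge) auto
  have u: "u = ter G (p ! (length p - 1))"
    using walk_last[OF p(2)] p(1) by (simp add: last_conv_nth)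
  have edge: "p ! k \<in> edges G" if "k < length p" for k
    using walk_nth_org[OF p(2) that] by blast
  have org_Suc: "org G (p ! Suc k) = ter G (p ! k)" if "Suc k < length p" for k
    using walk_nth_org[OF p(2) that] that by simp
  have org_0: "org G (p ! 0) = u"
    using walk_nth_org[OF p(2), of 0] p(1) by simp
  have org_le: "org G (p ! k) \<le> m" if "k < length p" for k
  proof (cases k)
    case 0
    then show ?thesis using org_0 u le[of "length p - 1"] p(1) by simp
  next
    case (Suc j)
    then show ?thesis using org_Suc[of j] le[of j] that by simp
  qed
  have up: "org G (p ! i) < ter G (p ! i)"
    using org_le[OF i(1)] loop[OF edge[OF i(1)]] i(2) by simp
  have down: "p ! k = opp G (p ! i)" if "k < length p" "org G (p ! k) = m" for k
    using parent[OF edge[OF i(1)] edge[OF that(1)]] up i(2) that(2) le[OF that(1)]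
      loop[OF edge[OF that(1)]] by simp
  show False
  \<comment> \<open>If the maximum is the last terminal vertex, it is the base point of the closed
    walk, where \<open>circuit\<close> does not compare the last edge with the first. Distinctness
    of the vertices then leaves only length two, and the inner turn of such a circuit is a forbidden
    return.\<close>
  proof (cases "Suc i < length p")
    case True
    then show False using down[of "Suc i"] org_Suc[OF True] i(2) nb[OF True] by simp
  next
    case False
    then have last: "i = length p - 1" using i(1) by simp
    have "0 < length p" using p(1) by simp
    then have p0: "p ! 0 = opp G (p ! i)" using down[of 0] org_0 u last i(2) by simp
    have "p ! 0 \<noteq> p ! i"
      using p0 G edge[OF i(1)] unfolding serre_graph_def by metis
    then obtain k where k: "i = Suc k" by (cases i) auto
    have "ter G (p ! k) = org G (p ! i)" using org_Suc[of k] i(1) k by simp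
    also have "\<dots> = ter G (p ! 0)" using ter_opp[OF G edge[OF i(1)]] p0 by simp
    finally have "k = 0"
      using nth_eq_iff_index_eq[OF p(3), of k 0] k i(1) p(1) by simp
    then have "opp G (p ! 0) = p ! Suc 0"
      using p0 k G edge[OF i(1)] unfolding serre_graph_def by metis
    then show False using nb[of 0] i(1) k by simp
  qed
qed

section \<open>Actions of a countable Borel equivalence relation\<close>

text \<open>\<open>R\<close> is itself a standard Borel space, and both projections have countable
  fibres. \<open>lusin_novikov\<close> for the first projection gives pieces that are graphs of
  functions, for the second it makes these functions injective; intersecting the two decompositions
  covers \<open>R\<close> by graphs of countably many elements of the pseudogroup.\<close>

lemma countable_borel_equiv_cover:
  assumes X: "standard_borel X" and R: "borel_equiv X R"
    and cnt: "\<And>x. x \<in> space X \<Longrightarrow> countable (R `` {x})"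
  shows "\<exists>B \<phi>. (\<forall>j::nat. B j \<in> sets X \<and> \<phi> j \<in> measurable (restrict_space X (B j)) X \<and>
      inj_on (\<phi> j) (B j) \<and> (\<forall>x\<in>B j. (x, \<phi> j x) \<in> R)) \<and>
    (\<forall>x y. (x, y) \<in> R \<longrightarrow> (\<exists>j. x \<in> B j \<and> \<phi> j x = y))"
proof -
  let ?M = "restrict_space (X \<Otimes>\<^sub>M X) R"
  have Rs: "R \<in> sets (X \<Otimes>\<^sub>M X)" and eq: "equiv (space X) R" using R unfolding borel_equiv_def by blast+
  have XX: "standard_borel (X \<Otimes>\<^sub>M X)" by (rule standard_borel_pair[OF X X])
  have M: "standard_borel ?M" by (rule standard_borel_restrict[OF XX Rs])
  have RX: "R \<subseteq> space X \<times> space X" using sets.sets_into_space[OF Rs] by (simp add: space_pair_measure)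
  have sp: "space ?M = R" using RX by (auto simp: space_restrict_space space_pair_measure)
  have fst_m: "fst \<in> measurable ?M X" and snd_m: "snd \<in> measurable ?M X"
    by (intro measurable_restrict_space1 measurable_fst measurable_snd)+
  have "countable {z \<in> space ?M. fst z = x}" if "x \<in> space X" for x
  proof -
    have "{z \<in> space ?M. fst z = x} = Pair x ` (R `` {x})" unfolding sp by force
    then show ?thesis using cnt[OF that] by simp
  qed
  from lusin_novikov[OF M X fst_m this] obtain F :: "nat \<Rightarrow> ('a \<times> 'a) set" where
    F: "\<And>k. F k \<in> sets ?M" "\<And>k. inj_on fst (F k)" "(\<Union>k. F k) = space ?M" by metis
  have "countable {z \<in> space ?M. snd z = x}" if "x \<in> space X" for x
  proof -
    have "{z \<in> space ?M. snd z = x} = (\<lambda>y. (y, x)) ` (R `` {x})"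
      unfolding sp using eq by (auto simp: equiv_def sym_def)
    then show ?thesis using cnt[OF that] by simp
  qed
  from lusin_novikov[OF M X snd_m this] obtain H :: "nat \<Rightarrow> ('a \<times> 'a) set" where
    H: "\<And>k. H k \<in> sets ?M" "\<And>k. inj_on snd (H k)" "(\<Union>k. H k) = space ?M" by metis
  define \<Gamma> where "\<Gamma> j = F (fst (prod_decode j)) \<inter> H (snd (prod_decode j))" for j
  have \<Gamma>M: "\<Gamma> j \<in> sets ?M" for j unfolding \<Gamma>_def by (intro sets.Int F(1) H(1))
  have \<Gamma>R: "\<Gamma> j \<subseteq> R" for j using sets.sets_into_space[OF \<Gamma>M] unfolding sp .
  have inj: "inj_on fst (\<Gamma> j)" "inj_on snd (\<Gamma> j)" for j
    unfolding \<Gamma>_def by (rule inj_on_subset[OF F(2)], blast, rule inj_on_subset[OF H(2)], blast)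
  define B where "B j = fst ` \<Gamma> j" for j
  define \<phi> where "\<phi> j x = snd (the_inv_into (\<Gamma> j) fst x)" for j x
  have mem: "(x, \<phi> j x) \<in> \<Gamma> j" if "x \<in> B j" for x j
  proof -
    have "the_inv_into (\<Gamma> j) fst x \<in> \<Gamma> j" "fst (the_inv_into (\<Gamma> j) fst x) = x"
      using that inj(1)[of j] unfolding B_def
      by (auto intro: the_inv_into_into f_the_inv_into_f)
    then show ?thesis unfolding \<phi>_def by (metis prod.collapse)
  qed
  have phi_eq: "\<phi> j x = y" if "(x, y) \<in> \<Gamma> j" for x y j
    unfolding \<phi>_def using the_inv_into_f_f[OF inj(1) that] by simp
  have iso: "borel_iso (restrict_space ?M (\<Gamma> j)) (restrict_space X (B j)) fst" for j
    unfolding B_def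
    by (rule borel_iso_image[OF M X \<Gamma>M measurable_restrict_space1[OF fst_m] inj(1)])
  have Bs: "B j \<in> sets X" for j
    unfolding B_def by (rule lusin_souslin[OF M X \<Gamma>M measurable_restrict_space1[OF fst_m] inj(1)])
  have sp\<Gamma>: "space (restrict_space ?M (\<Gamma> j)) = \<Gamma> j" for j
    using \<Gamma>R[of j] sp by (auto simp: space_restrict_space)
  have "\<phi> j \<in> measurable (restrict_space X (B j)) X" for j
  proof -
    have "the_inv_into (\<Gamma> j) fst \<in> measurable (restrict_space X (B j)) (restrict_space ?M (\<Gamma> j))"
      using iso[of j] unfolding borel_iso_def sp\<Gamma> by blast
    from measurable_compose[OF this measurable_restrict_space1[OF snd_m]]
    show ?thesis unfolding \<phi>_def .
  qed
  moreover have "inj_on (\<phi> j) (B j)" for j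
  proof (rule inj_onI)
    fix x y assume "x \<in> B j" "y \<in> B j" "\<phi> j x = \<phi> j y"
    then show "x = y" using inj_onD[OF inj(2) _ mem mem, of x j y] by simp
  qed
  moreover have "(x, \<phi> j x) \<in> R" if "x \<in> B j" for x j using mem[OF that] \<Gamma>R by blast
  moreover have "\<exists>j. x \<in> B j \<and> \<phi> j x = y" if "(x, y) \<in> R" for x y
  proof -
    have "(x, y) \<in> (\<Union>k. F k)" "(x, y) \<in> (\<Union>k. H k)" using that F(3) H(3) sp by auto
    then obtain k l where "(x, y) \<in> F k" "(x, y) \<in> H l" by blast
    then have "(x, y) \<in> \<Gamma> (prod_encode (k, l))" by (simp add: \<Gamma>_def)
    then show ?thesis using phi_eq unfolding B_def by (metis fst_conv image_eqI)
  qed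
  ultimately show ?thesis using Bs by (intro exI[of _ B] exI[of _ \<phi>]) simp
qed

section \<open>Orbit relations of fibred spaces\<close>

locale fibred_action =
  fixes X :: "'x measure" and R :: "('x \<times> 'x) set" and F :: "('x, 'f) fibred"
  assumes X: "standard_borel X" and R: "borel_equiv X R"
    and cnt: "\<And>x. x \<in> space X \<Longrightarrow> countable (R `` {x})"
    and F: "R_fibred_standard_space X R F"
begin

abbreviation "tot \<equiv> total_space F"
abbreviation "orb \<equiv> orbit_rel R F"
abbreviation "sat \<equiv> saturation orb"

lemma R_sets: "R \<in> sets (X \<Otimes>\<^sub>M X)" and R_equiv: "equiv (space X) R"
  using R unfolding borel_equiv_def by blast+

lemma R_space: "(x, y) \<in> R \<Longrightarrow> x \<in> space X \<and> y \<in> space X"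
  using sets.sets_into_space[OF R_sets] by (auto simp: space_pair_measure)

lemma R_refl: "x \<in> space X \<Longrightarrow> (x, x) \<in> R"
  and R_sym: "(x, y) \<in> R \<Longrightarrow> (y, x) \<in> R"
  and R_trans: "(x, y) \<in> R \<Longrightarrow> (y, z) \<in> R \<Longrightarrow> (x, z) \<in> R"
  using R_equiv by (auto elim!: equivE simp: refl_on_def dest: symD transD)

lemma fibred: "fibred_standard_space X F" and action: "is_action X R F"
  using F unfolding R_fibred_standard_space_def by blast+

lemma tot_standard: "standard_borel tot"
  and proj_measurable: "proj F \<in> measurable tot X"
  and proj_onto: "proj F ` space tot = space X"
  and proj_countable: "x \<in> space X \<Longrightarrow> countable {f \<in> space tot. proj F f = x}"
  using fibred unfolding fibred_standard_space_def by blast+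

lemma proj_space: "f \<in> space tot \<Longrightarrow> proj F f \<in> space X"
  by (rule measurable_space[OF proj_measurable])

lemma act_proj: "(x, y) \<in> R \<Longrightarrow> f \<in> space tot \<Longrightarrow> proj F f = y \<Longrightarrow> proj F (act F x y f) = x"
  and act_id: "f \<in> space tot \<Longrightarrow> act F (proj F f) (proj F f) f = f"
  and act_act: "(x, y) \<in> R \<Longrightarrow> (y, z) \<in> R \<Longrightarrow> f \<in> space tot \<Longrightarrow> proj F f = z \<Longrightarrow>
    act F x y (act F y z f) = act F x z f"
proof -
  note a = conjunct2[OF action[unfolded is_action_def]]
  show "(x, y) \<in> R \<Longrightarrow> f \<in> space tot \<Longrightarrow> proj F f = y \<Longrightarrow> proj F (act F x y f) = x"
    using conjunct1[OF a] by blast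
  show "f \<in> space tot \<Longrightarrow> act F (proj F f) (proj F f) f = f"
    using conjunct1[OF conjunct2[OF a]] by simp
  show "(x, y) \<in> R \<Longrightarrow> (y, z) \<in> R \<Longrightarrow> f \<in> space tot \<Longrightarrow> proj F f = z \<Longrightarrow>
    act F x y (act F y z f) = act F x z f"
    using conjunct2[OF conjunct2[OF a]] by blast
qed

lemma act_measurable:
  assumes "a \<in> measurable M X" "h \<in> measurable M tot"
    and "\<And>z. z \<in> space M \<Longrightarrow> (a z, proj F (h z)) \<in> R"
  shows "(\<lambda>z. act F (a z) (proj F (h z)) (h z)) \<in> measurable M tot"
proof -
  let ?D = "{((x, y), f). (x, y) \<in> R \<and> f \<in> space tot \<and> proj F f = y}"
  have "(\<lambda>((x, y), f). act F x y f) \<in> measurable (restrict_space ((X \<Otimes>\<^sub>M X) \<Otimes>\<^sub>M tot) ?D) tot"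
    using action unfolding is_action_def by blast
  moreover have "(\<lambda>z. ((a z, proj F (h z)), h z)) \<in> measurable M (restrict_space ((X \<Otimes>\<^sub>M X) \<Otimes>\<^sub>M tot) ?D)"
  proof (rule measurable_restrict_space2)
    show "(\<lambda>z. ((a z, proj F (h z)), h z)) \<in> space M \<rightarrow> ?D"
      using assms(3) measurable_space[OF assms(2)] by auto
    show "(\<lambda>z. ((a z, proj F (h z)), h z)) \<in> measurable M ((X \<Otimes>\<^sub>M X) \<Otimes>\<^sub>M tot)"
      by (intro measurable_Pair assms(1,2) measurable_compose[OF assms(2) proj_measurable])
  qed
  ultimately have "(\<lambda>z. (\<lambda>((x, y), f). act F x y f) ((a z, proj F (h z)), h z)) \<in> measurable M tot"
    by (rule measurable_compose[rotated])
  then show ?thesis by simp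
qed

lemma act_space:
  assumes "(x, proj F f) \<in> R" "f \<in> space tot"
  shows "act F x (proj F f) f \<in> space tot"
proof -
  \<comment> \<open>That the action lands in the total space is read off from its measurability,
    composed with a map from a one-point space.\<close>
  have "(\<lambda>_. act F x (proj F f) f) \<in> measurable (count_space {()}) tot"
    using R_space[OF assms(1)] assms by (intro act_measurable[of "\<lambda>_. x" _ "\<lambda>_. f"]) auto
  from measurable_space[OF this, of "()"] show ?thesis by simp
qed

lemma orb_iff: "(f, g) \<in> orb \<longleftrightarrow> f \<in> space tot \<and> g \<in> space tot \<and> (proj F f, proj F g) \<in> R \<and>
    act F (proj F f) (proj F g) g = f"
  by (simp add: orbit_rel_def)

lemma orb_space: "(f, g) \<in> orb \<Longrightarrow> f \<in> space tot \<and> g \<in> space tot \<and> (proj F f, proj F g) \<in> R"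
  by (simp add: orb_iff)

lemma orb_refl: "f \<in> space tot \<Longrightarrow> (f, f) \<in> orb"
  by (simp add: orb_iff R_refl proj_space act_id)

lemma orb_sym:
  assumes "(f, g) \<in> orb"
  shows "(g, f) \<in> orb"
proof -
  have *: "f \<in> space tot" "g \<in> space tot" "(proj F f, proj F g) \<in> R"
    "act F (proj F f) (proj F g) g = f" using assms by (simp_all add: orb_iff)
  have "act F (proj F g) (proj F f) (act F (proj F f) (proj F g) g) = act F (proj F g) (proj F g) g"
    by (rule act_act[OF R_sym[OF *(3)] *(3) *(2) refl])
  then show ?thesis using * R_sym by (simp add: orb_iff act_id)
qed

lemma orb_trans:
  assumes "(f, g) \<in> orb" "(g, h) \<in> orb"
  shows "(f, h) \<in> orb"
proof -
  have *: "f \<in> space tot" "g \<in> space tot" "(proj F f, proj F g) \<in> R"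
    "act F (proj F f) (proj F g) g = f" "h \<in> space tot" "(proj F g, proj F h) \<in> R"
    "act F (proj F g) (proj F h) h = g" using assms by (simp_all add: orb_iff)
  have "act F (proj F f) (proj F g) (act F (proj F g) (proj F h) h) = act F (proj F f) (proj F h) h"
    by (rule act_act[OF *(3,6,5) refl])
  then show ?thesis using * R_trans[of "proj F f" "proj F g" "proj F h"] by (simp add: orb_iff)
qed

lemma orb_act: "(x, proj F f) \<in> R \<Longrightarrow> f \<in> space tot \<Longrightarrow> (act F x (proj F f) f, f) \<in> orb"
  by (simp add: orb_iff act_space act_proj)

lemma sat_iff: "f \<in> sat B \<longleftrightarrow> (\<exists>g\<in>B. (f, g) \<in> orb)"
  by (simp add: saturation_def)

lemma satI: "(f, g) \<in> orb \<Longrightarrow> g \<in> B \<Longrightarrow> f \<in> sat B"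
  unfolding sat_iff by blast

lemma subset_sat:
  assumes "B \<subseteq> space tot"
  shows "B \<subseteq> sat B"
proof
  fix f assume f: "f \<in> B"
  then have "(f, f) \<in> orb" using assms by (intro orb_refl) blast
  then show "f \<in> sat B" unfolding sat_iff by (rule bexI[OF _ f])
qed

lemma sat_space: "sat B \<subseteq> space tot"
  using orb_space by (auto simp: sat_iff)

lemma sat_invariant:
  assumes "f \<in> sat B" "(f, g) \<in> orb"
  shows "g \<in> sat B"
proof -
  obtain h where h: "h \<in> B" "(f, h) \<in> orb" using assms(1) unfolding sat_iff by (rule bexE)
  have "(g, h) \<in> orb" by (rule orb_trans[OF orb_sym[OF assms(2)] h(2)])
  then show ?thesis unfolding sat_iff by (rule bexI[OF _ h(1)])
qed

lemma sat_disjoint: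
  assumes "\<And>f g. f \<in> A \<Longrightarrow> g \<in> B \<Longrightarrow> (f, g) \<notin> orb"
  shows "sat A \<inter> sat B = {}"
proof (rule ccontr)
  assume "sat A \<inter> sat B \<noteq> {}"
  then obtain h where "h \<in> sat A" "h \<in> sat B" by auto
  then obtain f g where fg: "f \<in> A" "g \<in> B" "(h, f) \<in> orb" "(h, g) \<in> orb"
    unfolding sat_iff by (elim bexE)
  have "(f, g) \<in> orb" by (rule orb_trans[OF orb_sym[OF fg(3)] fg(4)])
  with assms[OF fg(1,2)] show False by (rule notE)
qed

lemma translate_sets:
  assumes D: "D \<in> sets X" "\<phi> \<in> measurable (restrict_space X D) X" "\<And>x. x \<in> D \<Longrightarrow> (x, \<phi> x) \<in> R"
    and B: "B \<in> sets tot"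
  shows "{f \<in> space tot. proj F f \<in> D \<and> act F (\<phi> (proj F f)) (proj F f) f \<in> B} \<in> sets tot"
proof -
  let ?P = "proj F -` D \<inter> space tot"
  let ?a = "\<lambda>f. act F (\<phi> (proj F f)) (proj F f) f"
  have P: "?P \<in> sets tot" by (rule measurable_sets[OF proj_measurable D(1)])
  have sp: "space (restrict_space tot ?P) = ?P" by (auto simp: space_restrict_space)
  have a_meas: "?a \<in> measurable (restrict_space tot ?P) tot"
  proof (rule act_measurable[of "\<lambda>f. \<phi> (proj F f)" _ "\<lambda>f. f"])
    have "proj F \<in> measurable (restrict_space tot ?P) (restrict_space X D)"
      by (rule measurable_restrict_space2[OF _ measurable_restrict_space1[OF proj_measurable]])
        (auto simp: sp)
    from measurable_compose[OF this D(2)] show "(\<lambda>f. \<phi> (proj F f)) \<in> measurable (restrict_space tot ?P) X" .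
    show "(\<lambda>f. f) \<in> measurable (restrict_space tot ?P) tot"
      by (rule measurable_restrict_space1) simp
    show "(\<phi> (proj F z), proj F z) \<in> R" if "z \<in> space (restrict_space tot ?P)" for z
    proof (rule R_sym)
      show "(proj F z, \<phi> (proj F z)) \<in> R" using that D(3) unfolding sp by auto
    qed
  qed
  have "?a -` B \<inter> space (restrict_space tot ?P) \<in> sets (restrict_space tot ?P)"
    by (rule measurable_sets[OF a_meas B])
  moreover have "?a -` B \<inter> space (restrict_space tot ?P) =
      {f \<in> space tot. proj F f \<in> D \<and> act F (\<phi> (proj F f)) (proj F f) f \<in> B}"
    unfolding sp by blast
  ultimately show ?thesis using P sets_restrict_space_iff[of ?P tot]
    by (simp add: Int_absorb2)
qed

text \<open>Countably many partial maps have graphs covering \<open>R\<close>, so the saturation is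
  the union of the preimages of \<open>B\<close> under the corresponding translations.\<close>

lemma sat_sets:
  assumes B: "B \<in> sets tot"
  shows "sat B \<in> sets tot"
proof -
  obtain D \<phi> where D: "\<forall>j::nat. D j \<in> sets X \<and> \<phi> j \<in> measurable (restrict_space X (D j)) X \<and>
      inj_on (\<phi> j) (D j) \<and> (\<forall>x\<in>D j. (x, \<phi> j x) \<in> R)"
    and cov: "\<forall>x y. (x, y) \<in> R \<longrightarrow> (\<exists>j. x \<in> D j \<and> \<phi> j x = y)"
    using countable_borel_equiv_cover[OF X R] cnt by metis
  let ?T = "\<lambda>j. {f \<in> space tot. proj F f \<in> D j \<and> act F (\<phi> j (proj F f)) (proj F f) f \<in> B}"
  have "sat B = (\<Union>j. ?T j)"
  proof (intro subset_antisym subsetI)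
    fix f assume "f \<in> sat B"
    then obtain g where g: "g \<in> B" "(f, g) \<in> orb" unfolding sat_iff by blast
    then have gf: "act F (proj F g) (proj F f) f = g" "(proj F f, proj F g) \<in> R" "f \<in> space tot"
      using orb_sym[OF g(2)] orb_iff orb_space[OF g(2)] by auto
    then obtain j where "proj F f \<in> D j" "\<phi> j (proj F f) = proj F g" using cov by blast
    then show "f \<in> (\<Union>j. ?T j)" using gf g(1) by (intro UN_I[of j]) auto
  next
    fix f assume "f \<in> (\<Union>j. ?T j)"
    then obtain j where f: "f \<in> space tot" "proj F f \<in> D j" "act F (\<phi> j (proj F f)) (proj F f) f \<in> B" by auto
    have "(\<phi> j (proj F f), proj F f) \<in> R" using D f(2) R_sym by blast
    from orb_sym[OF orb_act[OF this f(1)]] show "f \<in> sat B" using f(3) unfolding sat_iff by blast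
  qed
  also have "\<dots> \<in> sets tot"
    by (intro sets.countable_UN'' countableI_type translate_sets B) (use D in blast)+
  finally show ?thesis .
qed

lemma orb_sets: "orb \<in> sets (tot \<Otimes>\<^sub>M tot)"
proof -
  let ?T = "tot \<Otimes>\<^sub>M tot"
  \<comment> \<open>The action makes sense only over pairs in \<open>R\<close>; this part is cut out
    first and the equality is tested inside it.\<close>
  define D where "D = (\<lambda>p. (proj F (fst p), proj F (snd p))) -` R \<inter> space ?T"
  have D: "D \<in> sets ?T"
    unfolding D_def
    by (rule measurable_sets[OF _ R_sets])
      (intro measurable_Pair measurable_compose[OF measurable_fst proj_measurable]
        measurable_compose[OF measurable_snd proj_measurable])
  have sp: "space (restrict_space ?T D) = D" by (auto simp: D_def space_restrict_space)
  have DR: "(proj F (fst p), proj F (snd p)) \<in> R" if "p \<in> D" for p using that by (simp add: D_def)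
  have f: "fst \<in> measurable (restrict_space ?T D) tot" and s: "snd \<in> measurable (restrict_space ?T D) tot"
    by (intro measurable_restrict_space1 measurable_fst measurable_snd)+
  have "{p \<in> space (restrict_space ?T D). act F (proj F (fst p)) (proj F (snd p)) (snd p) = fst p} \<in> sets (restrict_space ?T D)"
    by (intro sets_Collect_eq[OF tot_standard _ f] act_measurable measurable_compose[OF f proj_measurable] s)
      (use DR in \<open>simp add: sp\<close>)
  then have "{p \<in> D. act F (proj F (fst p)) (proj F (snd p)) (snd p) = fst p} \<in> sets ?T"
    using D sets_restrict_space_iff[of D ?T] sets.sets_into_space[OF D] by (simp add: sp Int_absorb2)
  moreover have "orb = {p \<in> D. act F (proj F (fst p)) (proj F (snd p)) (snd p) = fst p}"
    by (auto simp: D_def orb_iff space_pair_measure)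
  ultimately show ?thesis by simp
qed

section \<open>Partial sections\<close>

lemma pieces:
  "\<exists>P :: nat \<Rightarrow> 'f set. (\<forall>k. P k \<in> sets tot \<and> inj_on (proj F) (P k)) \<and> (\<Union>k. P k) = space tot"
  by (rule lusin_novikov[OF tot_standard X proj_measurable proj_countable]) (assumption, blast)

text \<open>A partial section is handled through its image, a Borel set on which the projection is
  injective; \<open>sec\<close> gives the map back.\<close>

abbreviation sec :: "'f set \<Rightarrow> 'x \<Rightarrow> 'f" where
  "sec B \<equiv> the_inv_into B (proj F)"

lemma restrict_total_space: "B \<in> sets tot \<Longrightarrow> space (restrict_space tot B) = B"
  using sets.sets_into_space[of B tot] by (auto simp: space_restrict_space)

lemma restrict_base_space: "B \<in> sets X \<Longrightarrow> space (restrict_space X B) = B"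
  using sets.sets_into_space[of B X] by (auto simp: space_restrict_space)

context
  fixes B assumes B: "B \<in> sets tot" and inj: "inj_on (proj F) B"
begin

lemma sec_mem: "x \<in> proj F ` B \<Longrightarrow> sec B x \<in> B"
  by (rule the_inv_into_into[OF inj]) auto

lemma sec_space: "x \<in> proj F ` B \<Longrightarrow> sec B x \<in> space tot"
  using sec_mem sets.sets_into_space[OF B] by blast

lemma proj_sec: "x \<in> proj F ` B \<Longrightarrow> proj F (sec B x) = x"
  by (rule f_the_inv_into_f[OF inj])

lemma sec_proj: "f \<in> B \<Longrightarrow> sec B (proj F f) = f"
  by (rule the_inv_into_f_f[OF inj])

lemma sec_image: "sec B ` proj F ` B = B"
  using sec_mem sec_proj by force

lemma base_sets: "proj F ` B \<in> sets X"
  by (rule lusin_souslin[OF tot_standard X B measurable_restrict_space1[OF proj_measurable] inj])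

lemma sec_measurable: "sec B \<in> measurable (restrict_space X (proj F ` B)) tot"
proof -
  have "borel_iso (restrict_space tot B) (restrict_space X (proj F ` B)) (proj F)"
    by (rule borel_iso_image[OF tot_standard X B measurable_restrict_space1[OF proj_measurable] inj])
  then have "sec B \<in> measurable (restrict_space X (proj F ` B)) (restrict_space tot B)"
    unfolding borel_iso_def restrict_total_space[OF B] by blast
  then show ?thesis using measurable_restrict_space2_iff by blast
qed

lemma sec_borel_iso: "borel_iso (restrict_space X (proj F ` B)) (restrict_space tot B) (sec B)"
proof -
  have "borel_iso (restrict_space X (proj F ` B)) (restrict_space tot (sec B ` proj F ` B)) (sec B)"
    by (rule borel_iso_image[OF X tot_standard base_sets sec_measurable])
      (metis inj_onI proj_sec)
  then show ?thesis unfolding sec_image .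
qed

text \<open>The orbit relation on the image \<open>B\<close>, transported to its projection. It
  serves for the relations on vertex spaces and, being the stabilizer of the section by
  \<open>sec_rel_Stab\<close>, for those on edge spaces.\<close>

definition sec_rel :: "('x \<times> 'x) set" where
  "sec_rel = {(x, y). x \<in> proj F ` B \<and> y \<in> proj F ` B \<and> (sec B x, sec B y) \<in> orb}"

lemma sec_rel_borel_equiv: "borel_equiv (restrict_space X (proj F ` B)) sec_rel"
  unfolding borel_equiv_def restrict_base_space[OF base_sets]
proof
  let ?B = "proj F ` B" and ?N = "restrict_space X (proj F ` B)"
  have "refl_on ?B sec_rel"
    unfolding sec_rel_def by (rule refl_onI) (use orb_refl sec_space in auto)
  moreover have "sym sec_rel" unfolding sec_rel_def using orb_sym by (auto intro: symI)
  moreover have "trans sec_rel" unfolding sec_rel_def using orb_trans by (auto intro!: transI)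
  moreover have "sec_rel \<subseteq> ?B \<times> ?B" unfolding sec_rel_def by blast
  ultimately show "equiv ?B sec_rel" by (simp add: equiv_def)
  have "sec_rel = (\<lambda>p. (sec B (fst p), sec B (snd p))) -` orb \<inter> space (?N \<Otimes>\<^sub>M ?N)"
    unfolding sec_rel_def by (auto simp: space_pair_measure restrict_base_space[OF base_sets])
  also have "\<dots> \<in> sets (?N \<Otimes>\<^sub>M ?N)"
    by (rule measurable_sets[OF _ orb_sets])
      (intro measurable_Pair measurable_compose[OF measurable_fst sec_measurable]
        measurable_compose[OF measurable_snd sec_measurable])
  finally show "sec_rel \<in> sets (?N \<Otimes>\<^sub>M ?N)" .
qed

text \<open>\<open>Stab\<close> carries the value at \<open>x\<close> to that at \<open>y\<close>,
  the orbit relation the value at \<open>y\<close> to that at \<open>x\<close>; symmetry reconciles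
  them.\<close>

lemma sec_rel_Stab: "sec_rel = Stab R F (proj F ` B) (sec B)"
proof -
  have "(sec B x, sec B y) \<in> orb \<longleftrightarrow> (x, y) \<in> R \<and> act F y x (sec B x) = sec B y"
    if "x \<in> proj F ` B" "y \<in> proj F ` B" for x y
  proof -
    have "(sec B x, sec B y) \<in> orb \<longleftrightarrow> (sec B y, sec B x) \<in> orb" using orb_sym by blast
    also have "\<dots> \<longleftrightarrow> (y, x) \<in> R \<and> act F y x (sec B x) = sec B y"
      using that by (simp add: orb_iff sec_space proj_sec)
    also have "(y, x) \<in> R \<longleftrightarrow> (x, y) \<in> R" using R_sym by blast
    finally show ?thesis .
  qed
  then show ?thesis unfolding sec_rel_def Stab_def by blast
qed

lemma sec_rel_iso:
  "rel_iso (restrict_space X (proj F ` B)) sec_rel (restrict_space tot B) (Restr orb B) (sec B)"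
  unfolding rel_iso_def
  using sec_borel_iso sec_mem by (auto simp: sec_rel_def restrict_base_space[OF base_sets])

end

text \<open>Over each point only the piece with the least number is kept; some piece is available
  because the projection is onto.\<close>

lemma global_section:
  obtains B where "B \<in> sets tot" "inj_on (proj F) B" "proj F ` B = space X"
proof -
  obtain P :: "nat \<Rightarrow> 'f set" where P: "\<And>k. P k \<in> sets tot" "\<And>k. inj_on (proj F) (P k)"
    "(\<Union>k. P k) = space tot" using pieces by metis
  define B where "B = (\<Union>k. {f \<in> P k. \<forall>j<k. proj F f \<notin> proj F ` P j})"
  have piece: "{f \<in> P k. \<forall>j<k. proj F f \<notin> proj F ` P j} \<in> sets tot" for k
  proof -
    have "{f \<in> P k. \<forall>j<k. proj F f \<notin> proj F ` P j} =
        P k \<inter> {f \<in> space tot. \<forall>j\<in>{..<k}. f \<in> space tot - (proj F -` proj F ` P j \<inter> space tot)}"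
      using sets.sets_into_space[OF P(1)[of k]] by auto
    also have "\<dots> \<in> sets tot"
      by (intro sets.Int P(1) sets_Collect_ball_mem sets.Diff sets.top countable_finite finite_lessThan
          measurable_sets[OF proj_measurable] base_sets[OF P(1,2)])
    finally show ?thesis .
  qed
  have "B \<in> sets tot" unfolding B_def by (intro sets.countable_UN'' piece countableI_type)
  moreover have "inj_on (proj F) B"
  proof (rule inj_onI)
    fix f g assume "f \<in> B" "g \<in> B" and eq: "proj F f = proj F g"
    then obtain k l where k: "f \<in> P k" "\<forall>j<k. proj F f \<notin> proj F ` P j"
      and l: "g \<in> P l" "\<forall>j<l. proj F g \<notin> proj F ` P j" unfolding B_def by blast
    have "k = l" using k l eq by (metis imageI linorder_neqE_nat)
    then show "f = g" using inj_onD[OF P(2) eq k(1)] l(1) by blast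
  qed
  moreover have "proj F ` B = space X"
  proof (intro subset_antisym subsetI)
    fix x assume "x \<in> proj F ` B"
    then show "x \<in> space X" using proj_space sets.sets_into_space[OF P(1)] unfolding B_def by blast
  next
    fix x assume "x \<in> space X"
    then have "\<exists>k. x \<in> proj F ` P k" using proj_onto P(3) by blast
    then have "x \<in> proj F ` P (LEAST k. x \<in> proj F ` P k)" by (rule LeastI_ex)
    then obtain f where f: "f \<in> P (LEAST k. x \<in> proj F ` P k)" "x = proj F f" by blast
    then have "f \<in> B" unfolding B_def using not_less_Least[of _ "\<lambda>k. x \<in> proj F ` P k"] by blast
    then show "x \<in> proj F ` B" using f(2) by blast
  qed
  ultimately show thesis by (rule that)
qed

end

section \<open>Representatives of vertices and edges\<close>

lemma morphism_orb:
  assumes h: "R_morphism R F F' h" and fg: "(f, g) \<in> orbit_rel R F"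
  shows "(h f, h g) \<in> orbit_rel R F'"
proof -
  have fg': "f \<in> space (total_space F)" "g \<in> space (total_space F)" "(proj F f, proj F g) \<in> R"
    "act F (proj F f) (proj F g) g = f" using fg by (simp_all add: orbit_rel_def)
  have hm: "h \<in> measurable (total_space F) (total_space F')"
    and hp: "\<And>f. f \<in> space (total_space F) \<Longrightarrow> proj F' (h f) = proj F f"
    and ha: "\<And>x f. (x, proj F f) \<in> R \<Longrightarrow> f \<in> space (total_space F) \<Longrightarrow>
      h (act F x (proj F f) f) = act F' x (proj F f) (h f)"
    using h unfolding R_morphism_def by auto
  have "act F' (proj F f) (proj F g) (h g) = h f" using ha[OF fg'(3,2)] fg'(4) by simp
  then show ?thesis
    unfolding orbit_rel_def mem_Collect_eq prod.case hp[OF fg'(1)] hp[OF fg'(2)]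
    using fg'(3) measurable_space[OF hm fg'(1)] measurable_space[OF hm fg'(2)] by (intro conjI)
qed

locale arboretum_action =
  fixes X :: "'x measure" and R :: "('x \<times> 'x) set" and A :: "('x, 'w, 'f) graph_field"
  assumes X: "standard_borel X" and R: "borel_equiv X R"
    and cnt: "\<And>x. x \<in> space X \<Longrightarrow> countable (R `` {x})"
    and A: "R_arboretum X R A"

sublocale arboretum_action \<subseteq> V: fibred_action X R "vfib A"
  by unfold_locales (use X R cnt A in \<open>auto simp: R_arboretum_def R_graph_field_def\<close>)

sublocale arboretum_action \<subseteq> E: fibred_action X R "efib A"
  by unfold_locales (use X R cnt A in \<open>auto simp: R_arboretum_def R_graph_field_def\<close>)

context arboretum_action
begin

abbreviation "SV \<equiv> space V.tot"
abbreviation "SE \<equiv> space E.tot"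
abbreviation "pv \<equiv> proj (vfib A)"
abbreviation "pe \<equiv> proj (efib A)"

lemma field: "R_graph_field X R A" and trees: "x \<in> space X \<Longrightarrow> is_tree (fibre_on A SV SE x)"
  using A unfolding R_arboretum_def by blast+

lemma struct_maps: "R_morphism R (efib A) (vfib A) (forg A)" "R_morphism R (efib A) (vfib A) (fter A)"
  "R_morphism R (efib A) (efib A) (fopp A)"
  using field unfolding R_graph_field_def by blast+

lemma org_measurable: "forg A \<in> measurable E.tot V.tot"
  and ter_measurable: "fter A \<in> measurable E.tot V.tot"
  and opp_measurable: "fopp A \<in> measurable E.tot E.tot"
  using struct_maps unfolding R_morphism_def by blast+

lemma org_proj: "e \<in> SE \<Longrightarrow> pv (forg A e) = pe e"
  and ter_proj: "e \<in> SE \<Longrightarrow> pv (fter A e) = pe e"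
  and opp_proj: "e \<in> SE \<Longrightarrow> pe (fopp A e) = pe e"
  using struct_maps unfolding R_morphism_def by blast+

lemmas org_orb = morphism_orb[OF struct_maps(1)]
lemmas ter_orb = morphism_orb[OF struct_maps(2)]
lemmas opp_orb = morphism_orb[OF struct_maps(3)]

lemmas org_space = measurable_space[OF org_measurable]
lemmas ter_space = measurable_space[OF ter_measurable]
lemmas opp_space = measurable_space[OF opp_measurable]

lemma serre: "serre_graph (graph_on A SV SE)"
  using field unfolding R_graph_field_def by blast

lemma opp_opp: "e \<in> SE \<Longrightarrow> fopp A (fopp A e) = e"
  and opp_neq: "e \<in> SE \<Longrightarrow> fopp A e \<noteq> e"
  and org_opp: "e \<in> SE \<Longrightarrow> forg A (fopp A e) = fter A e"
  using serre by (simp_all add: serre_graph_def graph_on_def)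

lemma ter_opp: "e \<in> SE \<Longrightarrow> fter A (fopp A e) = forg A e"
  using org_opp[OF opp_space] opp_opp by metis

lemma opp_orb_iff: "e \<in> SE \<Longrightarrow> g \<in> SE \<Longrightarrow> (fopp A e, g) \<in> E.orb \<longleftrightarrow> (e, fopp A g) \<in> E.orb"
  using opp_orb[of "fopp A e" g] opp_orb[of e "fopp A g"] opp_opp by auto

lemma sat_opp_iff:
  assumes "B \<subseteq> SE"
  shows "e \<in> E.sat (fopp A ` B) \<longleftrightarrow> e \<in> SE \<and> fopp A e \<in> E.sat B"
proof
  assume "e \<in> E.sat (fopp A ` B)"
  then obtain g where g: "g \<in> B" "(e, fopp A g) \<in> E.orb" unfolding E.sat_iff by blast
  then have "e \<in> SE" "g \<in> SE" using E.orb_space assms by blast+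
  then show "e \<in> SE \<and> fopp A e \<in> E.sat B"
    using g opp_orb_iff[of e g] unfolding E.sat_iff by blast
next
  assume e: "e \<in> SE \<and> fopp A e \<in> E.sat B"
  then obtain g where g: "g \<in> B" "(fopp A e, g) \<in> E.orb" unfolding E.sat_iff by blast
  then have "g \<in> SE" using assms by blast
  then show "e \<in> E.sat (fopp A ` B)"
    using g e opp_orb_iff[of e g] unfolding E.sat_iff by blast
qed

lemma opp_image: "B \<subseteq> SE \<Longrightarrow> fopp A ` B = fopp A -` B \<inter> SE"
proof (intro subset_antisym subsetI)
  fix e assume "B \<subseteq> SE" "e \<in> fopp A ` B"
  then show "e \<in> fopp A -` B \<inter> SE" using opp_opp opp_space by auto
next
  fix e assume "B \<subseteq> SE" "e \<in> fopp A -` B \<inter> SE"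
  then show "e \<in> fopp A ` B" using opp_opp by (intro image_eqI[of _ _ "fopp A e"]) auto
qed

lemma opp_image_sets: "B \<in> sets E.tot \<Longrightarrow> fopp A ` B \<in> sets E.tot"
  using opp_image[OF sets.sets_into_space] measurable_sets[OF opp_measurable] by auto

text \<open>\<open>forg A\<close> is equivariant, so translating \<open>e\<close> to the base point
  of \<open>g\<close> moves its origin to \<open>g\<close>. Thus edges leaving an orbit of vertices
  may be assumed to leave a chosen representative.\<close>

lemma translate_edge:
  assumes e: "e \<in> SE" and g: "(forg A e, g) \<in> V.orb"
  shows "\<exists>e'. (e', e) \<in> E.orb \<and> forg A e' = g"
proof (intro exI conjI)
  let ?e = "act (efib A) (pv g) (pe e) e"
  have R': "(pv g, pe e) \<in> R"
    using V.orb_space[OF g] org_proj[OF e] V.R_sym by simp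
  show "(?e, e) \<in> E.orb" by (rule E.orb_act[OF R' e])
  have "forg A ?e = act (vfib A) (pv g) (pe e) (forg A e)"
    using struct_maps(1) R' e unfolding R_morphism_def by blast
  also have "\<dots> = g" using V.orb_sym[OF g] org_proj[OF e] by (simp add: V.orb_iff)
  finally show "forg A ?e = g" .
qed

end

text \<open>Vertex sets are numbered in order of creation, and \<open>E n\<close> consists of the
  edges that attach \<open>V (Suc n)\<close> to the earlier set \<open>V (p n)\<close>. As
  \<open>pe\<close> is injective on \<open>E n\<close>, each vertex of \<open>V (Suc n)\<close> has
  exactly one edge to its parent.\<close>

locale tree_representatives = arboretum_action +
  fixes V :: "nat \<Rightarrow> 'b set" and E :: "nat \<Rightarrow> 'c set" and p :: "nat \<Rightarrow> nat"
  assumes V_sets: "V n \<in> sets V.tot" and V_inj: "inj_on pv (V n)" and V_0: "pv ` V 0 = space X"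
    and E_sets: "E n \<in> sets E.tot" and E_inj: "inj_on pe (E n)" and p_le: "p n \<le> n"
    and org_E: "forg A ` E n \<subseteq> V (p n)" and ter_E: "fter A ` E n = V (Suc n)"
    and V_disj: "n \<noteq> m \<Longrightarrow> V.sat (V n) \<inter> V.sat (V m) = {}"
    and V_cover: "(\<Union>n. V.sat (V n)) = SV"

text \<open>The set \<open>V (Suc m)\<close> is made of the terminal vertices of the edges \<open>E m\<close>, which leave \<open>V (p m)\<close>
  within one piece of a countable partition of the edge space into sections and arrive outside the
  saturations of the earlier \<open>V l\<close>; as \<open>m\<close> runs through all pairs (vertex set, piece), nothing is
  missed.\<close>

lemma (in arboretum_action) vertex_representatives:
  "\<exists>V E p. tree_representatives X R A V E p"
proof -
  obtain B0 where B0: "B0 \<in> sets V.tot" "inj_on pv B0" "pv ` B0 = space X" by (rule V.global_section)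
  obtain P :: "nat \<Rightarrow> 'f set" where P: "\<And>k. P k \<in> sets E.tot" "\<And>k. inj_on pe (P k)" "(\<Union>k. P k) = SE"
    using E.pieces by metis
  define p where "p m = fst (prod_decode m)" for m
  define k where "k m = snd (prod_decode m)" for m
  \<comment> \<open>A component of a pair never exceeds the code of the pair, so the parent set
    exists when stage \<open>m\<close> needs it.\<close>
  have p_le: "p m \<le> m" for m
    unfolding p_def using le_prod_encode_1[of "fst (prod_decode m)" "snd (prod_decode m)"] by simp
  define step where "step h n = (case n of 0 \<Rightarrow> B0 | Suc m \<Rightarrow>
      fter A ` {e \<in> P (k m). forg A e \<in> h (p m) \<and> (\<forall>l\<le>m. fter A e \<notin> V.sat (h l))})"
    for h :: "nat \<Rightarrow> 'w set" and n
  define V where "V = wfrec less_than step"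
  define E where "E m = {e \<in> P (k m). forg A e \<in> V (p m) \<and> (\<forall>l\<le>m. fter A e \<notin> V.sat (V l))}" for m
  have V_rec: "V n = step (cut V less_than n) n" for n
    unfolding V_def by (rule wfrec) simp
  have V_0: "V 0 = B0" by (simp add: V_rec step_def)
  have V_Suc: "V (Suc m) = fter A ` E m" for m
    unfolding V_rec[of "Suc m"] step_def E_def using p_le[of m] by (simp add: cut_apply less_Suc_eq_le)
  have E_P: "E m \<subseteq> P (k m)" and E_SE: "E m \<subseteq> SE" for m
    unfolding E_def using sets.sets_into_space[OF P(1)] by auto
  have E_inj: "inj_on pe (E m)" for m by (rule inj_on_subset[OF P(2) E_P])
  \<comment> \<open>Equal ends force equal base points; this injectivity is what makes the new
    vertex set Borel by \<open>lusin_souslin\<close>.\<close>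
  have E_ter_inj: "inj_on (fter A) (E m)" for m
  proof (rule inj_onI)
    fix e g assume "e \<in> E m" "g \<in> E m" "fter A e = fter A g"
    moreover from this have "pe e = pe g" using E_SE ter_proj by (metis subsetD)
    ultimately show "e = g" using inj_onD[OF E_inj] by blast
  qed
  have E_sets: "E m \<in> sets E.tot" if "\<And>l. l \<le> m \<Longrightarrow> V l \<in> sets V.tot" for m
  proof -
    have "E m = P (k m) \<inter> (forg A -` V (p m) \<inter> SE) \<inter>
        {e \<in> SE. \<forall>l\<in>{..m}. e \<in> SE - (fter A -` V.sat (V l) \<inter> SE)}"
      unfolding E_def using sets.sets_into_space[OF P(1)[of "k m"]] by auto
    also have "\<dots> \<in> sets E.tot"
      by (intro sets.Int P(1) sets_Collect_ball_mem sets.Diff sets.top countable_finite finite_atMost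
          measurable_sets[OF org_measurable] measurable_sets[OF ter_measurable] V.sat_sets that p_le) simp
    finally show ?thesis .
  qed
  have V_sets: "V n \<in> sets V.tot" for n
  proof (induction n rule: less_induct)
    case (less n)
    show ?case
    proof (cases n)
      case 0
      then show ?thesis using V_0 B0 by simp
    next
      case (Suc m)
      have "E m \<in> sets E.tot" by (rule E_sets) (use less Suc in simp)
      then show ?thesis
        unfolding Suc V_Suc
        by (rule lusin_souslin[OF E.tot_standard V.tot_standard _ measurable_restrict_space1[OF ter_measurable] E_ter_inj])
    qed
  qed
  have V_inj: "inj_on pv (V n)" for n
  proof (cases n)
    case 0
    then show ?thesis using V_0 B0 by simp
  next
    case (Suc m)
    show ?thesis
      unfolding Suc V_Suc
    proof (rule inj_onI)
      fix v w assume "v \<in> fter A ` E m" "w \<in> fter A ` E m" and vw: "pv v = pv w"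
      then obtain e g where eg: "e \<in> E m" "g \<in> E m" "v = fter A e" "w = fter A g" by blast
      then have "pe e = pe g" using vw E_SE ter_proj by (metis subsetD)
      then show "v = w" using inj_onD[OF E_inj] eg by blast
    qed
  qed
  have V_SV: "V n \<subseteq> SV" for n by (rule sets.sets_into_space[OF V_sets])
  have disj: "V.sat (V n) \<inter> V.sat (V m) = {}" if "n < m" for n m
  proof (rule V.sat_disjoint, rule notI)
    fix f g assume fg: "f \<in> V n" "g \<in> V m" "(f, g) \<in> V.orb"
    obtain l where l: "m = Suc l" "n \<le> l" using \<open>n < m\<close> by (cases m) auto
    obtain e where "e \<in> E l" "g = fter A e" using fg(2) unfolding l(1) V_Suc by blast
    then have "g \<notin> V.sat (V n)" using l(2) unfolding E_def by blast
    moreover have "g \<in> V.sat (V n)" unfolding V.sat_iff using fg V.orb_sym by blast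
    ultimately show False by blast
  qed
  have disj': "V.sat (V n) \<inter> V.sat (V m) = {}" if "n \<noteq> m" for n m
    using disj[of n m] disj[of m n] that by (cases "n < m") auto
  let ?U = "\<Union>n. V.sat (V n)"
  \<comment> \<open>The union of the saturations is stable under crossing an edge: after translation
    the edge starts at a representative, and its end either was reached by stage \<open>m\<close> or
    belongs to the set created there.\<close>
  have step: "fter A e \<in> ?U" if e: "e \<in> SE" and U: "forg A e \<in> ?U" for e
  proof -
    obtain n where "forg A e \<in> V.sat (V n)" using U by blast
    then obtain g where g: "g \<in> V n" "(forg A e, g) \<in> V.orb" unfolding V.sat_iff by (rule bexE)
    from translate_edge[OF e g(2)] obtain e' where e': "(e', e) \<in> E.orb" "forg A e' = g"
      by (elim exE conjE)
    have "e' \<in> SE" using E.orb_space[OF e'(1)] by blast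
    then obtain i where i: "e' \<in> P i" using P(3) by blast
    define m where "m = prod_encode (n, i)"
    have te: "(fter A e', fter A e) \<in> V.orb" by (rule ter_orb[OF e'(1)])
    have "fter A e' \<in> ?U"
    proof (cases "\<exists>l\<le>m. fter A e' \<in> V.sat (V l)")
      case True
      then obtain l where "fter A e' \<in> V.sat (V l)" by blast
      then show ?thesis by (rule UN_I[OF UNIV_I])
    next
      case False
      then have "e' \<in> E m" unfolding E_def using i e'(2) g(1) by (simp add: p_def k_def m_def)
      then have "fter A e' \<in> V (Suc m)" unfolding V_Suc by blast
      then have "fter A e' \<in> V.sat (V (Suc m))" by (rule subsetD[OF V.subset_sat[OF V_SV]])
      then show ?thesis by (rule UN_I[OF UNIV_I])
    qed
    then obtain l where "fter A e' \<in> V.sat (V l)" by (rule UN_E)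
    from V.sat_invariant[OF this te] show ?thesis by (rule UN_I[OF UNIV_I])
  qed
  have walk_U: "walk (fibre_on A SV SE x) u q v \<Longrightarrow> u \<in> ?U \<Longrightarrow> v \<in> ?U" for x u q v
  proof (induction q arbitrary: u)
    case (Cons a q)
    then have w: "a \<in> SE" "forg A a = u" "walk (fibre_on A SV SE x) (fter A a) q v"
      by (simp_all add: fibre_on_def graph_on_def)
    have "fter A a \<in> ?U" by (rule step[OF w(1)]) (use w(2) Cons.prems(2) in simp)
    then show ?case by (rule Cons.IH[OF w(3)])
  qed simp
  have "SV \<subseteq> ?U"
  proof
    fix v assume v: "v \<in> SV"
    let ?x = "pv v"
    have x: "?x \<in> space X" by (rule V.proj_space[OF v])
    \<comment> \<open>The global section meets every fibre, and a walk inside the connected fibre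
      leads from it to \<open>v\<close>.\<close>
    then obtain b where b: "b \<in> B0" "pv b = ?x" using B0(3) by (metis imageE)
    have bU: "b \<in> V.sat (V 0)" using V.subset_sat[OF V_SV[of 0]] b(1) V_0 by blast
    have "b \<in> SV" using b(1) V_0 V_SV by blast
    then have "b \<in> verts (fibre_on A SV SE ?x)" "v \<in> verts (fibre_on A SV SE ?x)"
      using v b(2) by (simp_all add: fibre_on_def graph_on_def)
    moreover have "graph_connected (fibre_on A SV SE ?x)"
      using trees[OF x] unfolding is_tree_def by (elim conjE)
    ultimately obtain q where "walk (fibre_on A SV SE ?x) b q v"
      unfolding graph_connected_def by metis
    moreover have "b \<in> ?U" using bU by (rule UN_I[OF UNIV_I])
    ultimately show "v \<in> ?U" by (rule walk_U)
  qed
  then have cover: "?U = SV" using V.sat_space by blast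
  have "tree_representatives X R A V E p"
    by unfold_locales (use V_sets V_inj V_0 B0(3) E_sets E_inj p_le V_Suc disj' cover in
      \<open>auto simp: E_def\<close>)
  then show ?thesis by (intro exI)
qed

context tree_representatives
begin

lemma V_SV: "V n \<subseteq> SV" by (rule sets.sets_into_space[OF V_sets])
lemma E_SE: "E n \<subseteq> SE" by (rule sets.sets_into_space[OF E_sets])

lemma V_unique: "v \<in> V n \<Longrightarrow> w \<in> V m \<Longrightarrow> (v, w) \<in> V.orb \<Longrightarrow> n = m"
  using V_disj[of n m] V.subset_sat[OF V_SV] V.sat_invariant by blast

text \<open>What remains for edges outside the tree. The set is invariant under the action and under
  reversal, so it can be decomposed on its own.\<close>

definition rest :: "'c set" where
  "rest = SE - (\<Union>m. E.sat (E m) \<union> E.sat (fopp A ` E m))"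

lemma rest_sets: "rest \<in> sets E.tot"
  unfolding rest_def
  by (intro sets.Diff sets.top sets.countable_UN'' sets.Un countableI_type E.sat_sets opp_image_sets E_sets)

lemma rest_SE: "rest \<subseteq> SE" unfolding rest_def by blast

lemma rest_invariant: "e \<in> rest \<Longrightarrow> (e, g) \<in> E.orb \<Longrightarrow> g \<in> rest"
  unfolding rest_def using E.sat_invariant[OF _ E.orb_sym] E.orb_space by blast

lemma rest_opp:
  assumes "e \<in> rest"
  shows "fopp A e \<in> rest"
proof -
  have e: "e \<in> SE" using assms rest_SE by blast
  show ?thesis
    using assms sat_opp_iff[OF E_SE, of e] sat_opp_iff[OF E_SE, of "fopp A e"] e opp_opp[OF e] opp_space[OF e]
    unfolding rest_def by simp
qed

end

text \<open>\<open>T n\<close> is the image of the section of the \<open>n\<close>-th edge outside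
  the tree; it starts in \<open>V (a n)\<close> and, displaced by \<open>\<phi> n\<close>, ends in
  \<open>V (b n)\<close>. The alternative at the end of \<open>T\<close> tells whether this edge and
  its opposite carry disjoint parts of the partition of edges or one and the same.\<close>

locale desing_data = tree_representatives +
  fixes T :: "nat \<Rightarrow> 'c set" and a b :: "nat \<Rightarrow> nat" and \<phi> :: "nat \<Rightarrow> 'a \<Rightarrow> 'a"
  assumes T: "\<And>n. T n \<in> sets E.tot \<and> T n \<subseteq> rest \<and> inj_on pe (T n) \<and> forg A ` T n \<subseteq> V (a n) \<and>
      \<phi> n \<in> measurable (restrict_space X (pe ` T n)) X \<and> inj_on (\<phi> n) (pe ` T n) \<and>
      (\<forall>x\<in>pe ` T n. (x, \<phi> n x) \<in> R) \<and>
      (\<forall>e\<in>T n. act (vfib A) (\<phi> n (pe e)) (pe e) (fter A e) \<in> V (b n)) \<and>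
      (E.sat (T n) \<inter> E.sat (fopp A ` T n) = {} \<or> E.sat (T n) = E.sat (fopp A ` T n))"
    and T_cover: "(\<Union>n. E.sat (T n) \<union> E.sat (fopp A ` T n)) = rest"
    and T_sep: "\<And>n m e g. n \<noteq> m \<Longrightarrow> e \<in> T n \<Longrightarrow> g \<in> T m \<Longrightarrow> (e, g) \<notin> E.orb \<and> (e, fopp A g) \<notin> E.orb"

text \<open>An edge may be equivalent to the opposite of another edge of the same piece; the pieces are
  split so that this happens for all edges of a piece or for none.\<close>

lemma (in tree_representatives) edge_representatives:
  "\<exists>T a b \<phi>. desing_data X R A V E p T a b \<phi>"
proof -
  obtain P :: "nat \<Rightarrow> 'c set" where P: "\<And>k. P k \<in> sets E.tot" "\<And>k. inj_on pe (P k)" "(\<Union>k. P k) = SE"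
    using E.pieces by metis
  obtain D \<phi> where D: "\<forall>j::nat. D j \<in> sets X \<and> \<phi> j \<in> measurable (restrict_space X (D j)) X \<and>
      inj_on (\<phi> j) (D j) \<and> (\<forall>x\<in>D j. (x, \<phi> j x) \<in> R)"
    and cov: "\<forall>x y. (x, y) \<in> R \<longrightarrow> (\<exists>j. x \<in> D j \<and> \<phi> j x = y)"
    using countable_borel_equiv_cover[OF X R] cnt by metis
  \<comment> \<open>\<open>a\<close> and \<open>b\<close> sort by origin and displaced end,
    \<open>k\<close> makes the projection injective, \<open>j\<close> selects the
    displacement.\<close>
  define S where "S a b k j = {e \<in> P k \<inter> rest. forg A e \<in> V a \<and> pe e \<in> D j \<and>
      act (vfib A) (\<phi> j (pe e)) (pe e) (fter A e) \<in> V b}" for a b k j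
  define ia ib ik ij where "ia n = fst (prod_decode n)"
    and "ib n = fst (prod_decode (snd (prod_decode n)))"
    and "ik n = fst (prod_decode (snd (prod_decode (snd (prod_decode n)))))"
    and "ij n = snd (prod_decode (snd (prod_decode (snd (prod_decode n)))))" for n
  define Q where "Q n = S (ia n) (ib n) (ik n) (ij n)" for n
  have Q_all: "S a b k j = Q (prod_encode (a, prod_encode (b, prod_encode (k, j))))" for a b k j
    by (simp add: Q_def ia_def ib_def ik_def ij_def)
  have S_sets: "S a b k j \<in> sets E.tot" for a b k j
  proof -
    let ?U = "{v \<in> SV. pv v \<in> D j \<and> act (vfib A) (\<phi> j (pv v)) (pv v) v \<in> V b}"
    have "?U \<in> sets V.tot" by (rule V.translate_sets[OF _ _ _ V_sets]) (use D in blast)+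
    moreover have "S a b k j = P k \<inter> rest \<inter> (forg A -` V a \<inter> SE) \<inter> (fter A -` ?U \<inter> SE)"
    proof (intro subset_antisym subsetI)
      fix e assume e: "e \<in> S a b k j"
      then have "e \<in> SE" unfolding S_def using rest_SE by blast
      then show "e \<in> P k \<inter> rest \<inter> (forg A -` V a \<inter> SE) \<inter> (fter A -` ?U \<inter> SE)"
        using e unfolding S_def by (simp add: ter_proj ter_space)
    next
      fix e assume e: "e \<in> P k \<inter> rest \<inter> (forg A -` V a \<inter> SE) \<inter> (fter A -` ?U \<inter> SE)"
      then have "pv (fter A e) = pe e" using ter_proj by blast
      then show "e \<in> S a b k j" using e unfolding S_def by simp
    qed
    ultimately show ?thesis
      using measurable_sets[OF org_measurable V_sets[of a]] measurable_sets[OF ter_measurable, of ?U]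
      by (simp add: sets.Int P(1) rest_sets)
  qed
  have Q_sets: "Q n \<in> sets E.tot" for n unfolding Q_def by (rule S_sets)
  have Q_rest: "Q n \<subseteq> rest" for n unfolding Q_def S_def by blast
  have Q_SE: "Q n \<subseteq> SE" for n using Q_rest rest_SE by blast
  \<comment> \<open>Opposites of earlier pieces are removed as well, since an orbit and its reversal
    are the two directions of one edge of the quotient.\<close>
  define C where "C n = Q n - (\<Union>m\<in>{..<n}. E.sat (Q m) \<union> E.sat (fopp A ` Q m))" for n
  have C_Q: "C n \<subseteq> Q n" for n unfolding C_def by blast
  have C_SE: "C n \<subseteq> SE" for n using C_Q Q_SE by blast
  have C_sets: "C n \<in> sets E.tot" for n
    unfolding C_def by (intro sets.Diff Q_sets sets.countable_UN'' sets.Un countable_finite finite_lessThan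
        E.sat_sets opp_image_sets)
  \<comment> \<open>Even numbers keep the edges equivalent to the opposite of some edge of the same
    piece, odd numbers keep the others.\<close>
  define T where "T n = (if even n then C (n div 2) \<inter> E.sat (fopp A ` C (n div 2))
      else C (n div 2) - E.sat (fopp A ` C (n div 2)))" for n
  have T_C: "T n \<subseteq> C (n div 2)" for n unfolding T_def by auto
  have T_Q: "T n \<subseteq> Q (n div 2)" for n using T_C C_Q by blast
  have T_SE: "T n \<subseteq> SE" for n using T_C C_SE by blast
  have T_sets: "T n \<in> sets E.tot" for n
    unfolding T_def using C_sets[of "n div 2"] E.sat_sets[OF opp_image_sets[OF C_sets[of "n div 2"]]]
    by (simp add: sets.Int sets.Diff)
  have C_mem: "fopp A e \<in> E.sat (C n) \<longleftrightarrow> e \<in> E.sat (fopp A ` C n)" if "e \<in> SE" for e n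
    using sat_opp_iff[OF C_SE] that by simp
  have T_split: "E.sat (T n) \<inter> E.sat (fopp A ` T n) = {} \<or> E.sat (T n) = E.sat (fopp A ` T n)" for n
  proof (cases "even n")
    case True
    let ?C = "C (n div 2)"
    have Tn: "T n = ?C \<inter> E.sat (fopp A ` ?C)" using True by (simp add: T_def)
    \<comment> \<open>The partner \<open>g\<close> of the reversed edge belongs to the even part
      too, because reversing the equivalence exchanges the roles of \<open>e\<close> and
      \<open>g\<close>.\<close>
    have opp_T: "fopp A e \<in> E.sat (T n)" if "e \<in> T n" for e
    proof -
      have e: "e \<in> SE" "e \<in> ?C" using that T_SE T_C by blast+
      have "fopp A e \<in> E.sat ?C" using C_mem[OF e(1)] that unfolding Tn by blast
      then obtain g where g: "g \<in> ?C" "(fopp A e, g) \<in> E.orb" unfolding E.sat_iff by (rule bexE)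
      have gS: "g \<in> SE" using g(1) C_SE by blast
      have "(fopp A g, e) \<in> E.orb"
        using opp_orb[OF g(2)] opp_opp[OF e(1)] E.orb_sym by simp
      then have "fopp A g \<in> E.sat ?C" unfolding E.sat_iff by (rule bexI[OF _ e(2)])
      then have "g \<in> T n" using C_mem[OF gS] g(1) unfolding Tn by blast
      then show ?thesis by (rule E.satI[OF g(2)])
    qed
    have sub: "fopp A f \<in> E.sat (T n)" if "f \<in> E.sat (T n)" for f
    proof -
      obtain e where e: "e \<in> T n" "(f, e) \<in> E.orb"
        using \<open>f \<in> E.sat (T n)\<close> unfolding E.sat_iff by (rule bexE)
      from E.sat_invariant[OF opp_T[OF e(1)] opp_orb[OF E.orb_sym[OF e(2)]]] show ?thesis .
    qed
    have "f \<in> E.sat (T n) \<longleftrightarrow> f \<in> E.sat (fopp A ` T n)" for f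
    proof (cases "f \<in> SE")
      case True
      then show ?thesis using sat_opp_iff[OF T_SE] sub[of f] sub[of "fopp A f"] opp_opp[OF True] by auto
    next
      case False
      then show ?thesis using E.sat_space by blast
    qed
    then show ?thesis by blast
  next
    case False
    let ?C = "C (n div 2)"
    have Tn: "T n = ?C - E.sat (fopp A ` ?C)" using False by (simp add: T_def)
    have "E.sat (T n) \<inter> E.sat (fopp A ` T n) = {}"
    proof (rule E.sat_disjoint, rule notI)
      fix e g assume e: "e \<in> T n" and "g \<in> fopp A ` T n" and eg: "(e, g) \<in> E.orb"
      then obtain t where t: "t \<in> T n" "g = fopp A t" by blast
      have "fopp A t \<in> fopp A ` ?C" using t T_C by blast
      then have "e \<in> E.sat (fopp A ` ?C)" by (rule E.satI[OF eg[unfolded t(2)]])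
      then show False using e unfolding Tn by blast
    qed
    then show ?thesis by blast
  qed
  have sep_C: "(e, g) \<notin> E.orb \<and> (e, fopp A g) \<notin> E.orb" if "n < m" "e \<in> C n" "g \<in> C m" for n m e g
  proof -
    have eQ: "e \<in> Q n" using that C_Q by blast
    have gS: "g \<in> SE" and eS: "e \<in> SE" using that C_SE by blast+
    have g: "g \<notin> E.sat (Q n)" "g \<notin> E.sat (fopp A ` Q n)" using that unfolding C_def by blast+
    show ?thesis
    proof (intro conjI notI)
      assume "(e, g) \<in> E.orb"
      then have "(g, e) \<in> E.orb" by (rule E.orb_sym)
      then have "g \<in> E.sat (Q n)" unfolding E.sat_iff by (rule bexI[OF _ eQ])
      with g(1) show False ..
    next
      assume "(e, fopp A g) \<in> E.orb"
      then have "(fopp A g, e) \<in> E.orb" by (rule E.orb_sym)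
      then have "(g, fopp A e) \<in> E.orb" using opp_orb_iff[OF gS eS] by blast
      then have "g \<in> E.sat (fopp A ` Q n)" unfolding E.sat_iff by (rule bexI[OF _ imageI[OF eQ]])
      with g(2) show False ..
    qed
  qed
  have sep_split: "(e, g) \<notin> E.orb \<and> (e, fopp A g) \<notin> E.orb"
    if "e \<in> C n \<inter> E.sat (fopp A ` C n)" "g \<in> C n - E.sat (fopp A ` C n)" for n e g
  proof -
    have gS: "g \<in> SE" and eS: "e \<in> SE" using that C_SE by blast+
    show ?thesis
    proof (intro conjI notI)
      assume "(e, g) \<in> E.orb"
      with E.sat_invariant[of e "fopp A ` C n" g] that show False by blast
    next
      assume "(e, fopp A g) \<in> E.orb"
      then have "(fopp A g, e) \<in> E.orb" by (rule E.orb_sym)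
      moreover have "e \<in> C n" using that by blast
      ultimately have "fopp A g \<in> E.sat (C n)" unfolding E.sat_iff by (rule bexI)
      then show False using C_mem[OF gS] that by blast
    qed
  qed
  have sym: "(g, e) \<notin> E.orb \<and> (g, fopp A e) \<notin> E.orb"
    if "(e, g) \<notin> E.orb \<and> (e, fopp A g) \<notin> E.orb" "e \<in> SE" "g \<in> SE" for e g
    using that E.orb_sym[of g e] E.orb_sym[of g "fopp A e"] opp_orb_iff[of e g] by blast
  have T_sep: "(e, g) \<notin> E.orb \<and> (e, fopp A g) \<notin> E.orb" if "n \<noteq> m" "e \<in> T n" "g \<in> T m" for n m e g
  proof -
    have SE: "e \<in> SE" "g \<in> SE" using that T_SE by blast+
    have eg: "e \<in> C (n div 2)" "g \<in> C (m div 2)" using that T_C by blast+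
    consider "n div 2 < m div 2" | "m div 2 < n div 2" | "n div 2 = m div 2" by linarith
    then show ?thesis
    proof cases
      case 1
      then show ?thesis using sep_C eg by blast
    next
      case 2
      then show ?thesis using sym[OF sep_C[OF 2 eg(2,1)] SE(2,1)] by blast
    next
      case 3
      then have "even n \<noteq> even m" using that(1) by presburger
      then consider "even n" "odd m" | "odd n" "even m" by blast
      then show ?thesis
      proof cases
        case 1
        then show ?thesis using sep_split[of e "n div 2" g] that 3 unfolding T_def by simp
      next
        case 2
        have "(g, e) \<notin> E.orb \<and> (g, fopp A e) \<notin> E.orb"
          using sep_split[of g "n div 2" e] that 3 2 unfolding T_def by simp
        then show ?thesis by (rule sym[OF _ SE(2,1)])
      qed
    qed
  qed
  have cover: "(\<Union>n. E.sat (T n) \<union> E.sat (fopp A ` T n)) = rest"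
  proof (intro subset_antisym subsetI)
    fix e assume "e \<in> (\<Union>n. E.sat (T n) \<union> E.sat (fopp A ` T n))"
    then obtain n where "e \<in> E.sat (T n) \<or> e \<in> E.sat (fopp A ` T n)" by blast
    then obtain g where "g \<in> T n" "(e, g) \<in> E.orb \<or> (e, fopp A g) \<in> E.orb"
      unfolding E.sat_iff by blast
    then show "e \<in> rest"
      using rest_invariant E.orb_sym rest_opp Q_rest T_Q by (meson subsetD)
  next
    fix e assume er: "e \<in> rest"
    then have e: "e \<in> SE" using rest_SE by blast
    have "\<exists>i. e \<in> E.sat (Q i)"
    proof -
      obtain a where "forg A e \<in> V.sat (V a)" using V_cover org_space[OF e] by blast
      then obtain g where g: "g \<in> V a" "(forg A e, g) \<in> V.orb" unfolding V.sat_iff by (rule bexE)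
      obtain e' where e': "(e', e) \<in> E.orb" "forg A e' = g"
        using translate_edge[OF e g(2)] by (elim exE conjE)
      have e'S: "e' \<in> SE" using E.orb_space[OF e'(1)] by blast
      have e'r: "e' \<in> rest" by (rule rest_invariant[OF er E.orb_sym[OF e'(1)]])
      obtain k where k: "e' \<in> P k" using P(3) e'S by blast
      obtain b where "fter A e' \<in> V.sat (V b)" using V_cover ter_space[OF e'S] by blast
      then obtain h where h: "h \<in> V b" "(fter A e', h) \<in> V.orb" unfolding V.sat_iff by (rule bexE)
      have "(pe e', pv h) \<in> R" using V.orb_space[OF h(2)] ter_proj[OF e'S] by simp
      then obtain j where j: "pe e' \<in> D j" "\<phi> j (pe e') = pv h" using cov by blast
      have "act (vfib A) (pv h) (pe e') (fter A e') = h"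
        using V.orb_sym[OF h(2)] ter_proj[OF e'S] by (simp add: V.orb_iff)
      then have "e' \<in> S a b k j" unfolding S_def using k e'r e'(2) g(1) j h(1) by simp
      then have "e' \<in> Q (prod_encode (a, prod_encode (b, prod_encode (k, j))))" unfolding Q_all .
      then have "e \<in> E.sat (Q (prod_encode (a, prod_encode (b, prod_encode (k, j)))))"
        by (rule E.satI[OF E.orb_sym[OF e'(1)]])
      then show ?thesis by (rule exI)
    qed
    then have ex: "\<exists>i. e \<in> E.sat (Q i) \<or> e \<in> E.sat (fopp A ` Q i)" by blast
    \<comment> \<open>For the least such \<open>i\<close> the representative \<open>s\<close> in
      \<open>Q i\<close> survives all removals: membership in an earlier saturation would pass to
      \<open>e\<close>, directly or after reversal.\<close>
    define i where "i = (LEAST i. e \<in> E.sat (Q i) \<or> e \<in> E.sat (fopp A ` Q i))"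
    have i: "e \<in> E.sat (Q i) \<or> e \<in> E.sat (fopp A ` Q i)" unfolding i_def by (rule LeastI_ex[OF ex])
    have less: "e \<notin> E.sat (Q m)" "e \<notin> E.sat (fopp A ` Q m)" if "m < i" for m
      using not_less_Least[OF that[unfolded i_def]] by blast+
    obtain s where s: "s \<in> Q i" "(e, s) \<in> E.orb \<or> (e, fopp A s) \<in> E.orb"
      using i unfolding E.sat_iff by blast
    have sS: "s \<in> SE" using s(1) Q_SE by blast
    have "s \<notin> E.sat (Q m) \<union> E.sat (fopp A ` Q m)" if "m < i" for m
    proof
      assume sm: "s \<in> E.sat (Q m) \<union> E.sat (fopp A ` Q m)"
      have os: "fopp A s \<in> E.sat (Q m) \<union> E.sat (fopp A ` Q m)"
        using sm sat_opp_iff[OF Q_SE, of s] sat_opp_iff[OF Q_SE, of "fopp A s"] sS opp_opp[OF sS] opp_space[OF sS]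
        by auto
      have "e \<in> E.sat (Q m) \<union> E.sat (fopp A ` Q m)"
        using s(2)
      proof
        assume "(e, s) \<in> E.orb"
        from E.sat_invariant[OF _ E.orb_sym[OF this]] sm show ?thesis by blast
      next
        assume "(e, fopp A s) \<in> E.orb"
        from E.sat_invariant[OF _ E.orb_sym[OF this]] os show ?thesis by blast
      qed
      then show False using less[OF that] by blast
    qed
    then have sC: "s \<in> C i" unfolding C_def using s(1) by blast
    have "\<exists>n. s \<in> T n"
    proof (cases "s \<in> E.sat (fopp A ` C i)")
      case True
      then have "s \<in> T (2 * i)" using sC by (simp add: T_def)
      then show ?thesis by (rule exI)
    next
      case False
      then have "s \<in> T (Suc (2 * i))" using sC by (simp add: T_def)
      then show ?thesis by (rule exI)
    qed
    then obtain n where n: "s \<in> T n" by (rule exE)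
    have "e \<in> E.sat (T n) \<or> e \<in> E.sat (fopp A ` T n)"
      unfolding E.sat_iff using s(2) n by blast
    then show "e \<in> (\<Union>n. E.sat (T n) \<union> E.sat (fopp A ` T n))" by blast
  qed
  have base: "pe ` T n \<subseteq> D (ij (n div 2))" for n
    using T_Q[of n] unfolding Q_def S_def by blast
  have phi_meas: "\<phi> (ij (n div 2)) \<in> measurable (restrict_space X (pe ` T n)) X" for n
    by (rule measurable_restrict_mono[OF _ base]) (use D in blast)
  have "T n \<in> sets E.tot \<and> T n \<subseteq> rest \<and> inj_on pe (T n) \<and> forg A ` T n \<subseteq> V (ia (n div 2)) \<and>
      \<phi> (ij (n div 2)) \<in> measurable (restrict_space X (pe ` T n)) X \<and> inj_on (\<phi> (ij (n div 2))) (pe ` T n) \<and>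
      (\<forall>x\<in>pe ` T n. (x, \<phi> (ij (n div 2)) x) \<in> R) \<and>
      (\<forall>e\<in>T n. act (vfib A) (\<phi> (ij (n div 2)) (pe e)) (pe e) (fter A e) \<in> V (ib (n div 2))) \<and>
      (E.sat (T n) \<inter> E.sat (fopp A ` T n) = {} \<or> E.sat (T n) = E.sat (fopp A ` T n))" for n
  proof (intro conjI)
    show "T n \<in> sets E.tot" "\<phi> (ij (n div 2)) \<in> measurable (restrict_space X (pe ` T n)) X"
      "E.sat (T n) \<inter> E.sat (fopp A ` T n) = {} \<or> E.sat (T n) = E.sat (fopp A ` T n)"
      by (rule T_sets phi_meas T_split)+
    show "T n \<subseteq> rest" using T_Q Q_rest by blast
    show "inj_on pe (T n)"
      by (rule inj_on_subset[OF P(2)[of "ik (n div 2)"]]) (use T_Q[of n] in \<open>auto simp: Q_def S_def\<close>)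
    show "forg A ` T n \<subseteq> V (ia (n div 2))" using T_Q[of n] unfolding Q_def S_def by blast
    show "inj_on (\<phi> (ij (n div 2))) (pe ` T n)" by (rule inj_on_subset[OF _ base]) (use D in blast)
    show "\<forall>x\<in>pe ` T n. (x, \<phi> (ij (n div 2)) x) \<in> R" using D base[of n] by blast
    show "\<forall>e\<in>T n. act (vfib A) (\<phi> (ij (n div 2)) (pe e)) (pe e) (fter A e) \<in> V (ib (n div 2))"
      using T_Q[of n] unfolding Q_def S_def by blast
  qed
  then have "desing_data X R A V E p T (\<lambda>n. ia (n div 2)) (\<lambda>n. ib (n div 2)) (\<lambda>n. \<phi> (ij (n div 2)))"
    using cover T_sep by unfold_locales simp_all
  then show ?thesis by (intro exI)
qed

section \<open>Sums of Borel spaces\<close>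

lemma space_borel_sum: "space (borel_sum I M) = (SIGMA i:I. space (M i))"
  unfolding borel_sum_def by (rule space_measure_of) blast

lemma sets_borel_sumI:
  assumes "S \<subseteq> (SIGMA i:I. space (M i))" "\<And>i. i \<in> I \<Longrightarrow> Pair i -` S \<in> sets (M i)"
  shows "S \<in> sets (borel_sum I M)"
proof -
  have "{S. S \<subseteq> (SIGMA i:I. space (M i)) \<and> (\<forall>i\<in>I. Pair i -` S \<in> sets (M i))} \<subseteq> Pow (SIGMA i:I. space (M i))"
    by blast
  then show ?thesis
    unfolding borel_sum_def by (simp only: sets_measure_of) (rule sigma_sets.Basic, use assms in simp)
qed

text \<open>The inverse pulls a set of the sum back to the union of the images of its slices. Each
  image is Borel because the inverse of \<open>h i\<close> is measurable and \<open>W i\<close> is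
  Borel, and there are countably many slices.\<close>

lemma borel_iso_sum:
  assumes I: "countable I" and N: "\<And>i. i \<in> I \<Longrightarrow> W i \<in> sets N"
    and disj: "\<And>i j. i \<in> I \<Longrightarrow> j \<in> I \<Longrightarrow> i \<noteq> j \<Longrightarrow> W i \<inter> W j = {}"
    and iso: "\<And>i. i \<in> I \<Longrightarrow> borel_iso (M i) (restrict_space N (W i)) (h i)"
  shows "borel_iso (borel_sum I M) (restrict_space N (\<Union>i\<in>I. W i)) (\<lambda>(i, x). h i x)"
proof -
  let ?\<Omega> = "SIGMA i:I. space (M i)" and ?W = "\<Union>i\<in>I. W i" and ?h = "\<lambda>(i, x). h i x"
  have W: "?W \<in> sets N" by (rule sets.countable_UN''[OF I N])
  have spW: "space (restrict_space N (W i)) = W i" if "i \<in> I" for i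
    using sets.sets_into_space[OF N[OF that]] by (auto simp: space_restrict_space)
  have sp: "space (restrict_space N ?W) = ?W"
    using sets.sets_into_space[OF W] by (auto simp: space_restrict_space)
  have hm: "h i \<in> measurable (M i) (restrict_space N (W i))" and hb: "bij_betw (h i) (space (M i)) (W i)"
    and hi: "the_inv_into (space (M i)) (h i) \<in> measurable (restrict_space N (W i)) (M i)" if "i \<in> I" for i
    using iso[OF that] unfolding borel_iso_def spW[OF that] by blast+
  have hW: "h i x \<in> W i" if "i \<in> I" "x \<in> space (M i)" for i x
    using measurable_space[OF hm[OF that(1)] that(2)] spW[OF that(1)] by simp
  have inj: "inj_on ?h ?\<Omega>"
  proof (rule inj_onI)
    fix u v assume uv: "u \<in> ?\<Omega>" "v \<in> ?\<Omega>" "?h u = ?h v"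
    then obtain i x j y where u: "u = (i, x)" "i \<in> I" "x \<in> space (M i)"
      and v: "v = (j, y)" "j \<in> I" "y \<in> space (M j)" by blast
    have "h i x = h j y" using uv(3) u(1) v(1) by simp
    moreover from this have "i = j" using disj[OF u(2) v(2)] hW[OF u(2,3)] hW[OF v(2,3)] by auto
    ultimately show "u = v" using inj_onD[OF bij_betw_imp_inj_on[OF hb[OF u(2)]]] u v by simp
  qed
  have surj: "?h ` ?\<Omega> = ?W"
  proof (intro subset_antisym subsetI)
    fix y assume "y \<in> ?h ` ?\<Omega>"
    then show "y \<in> ?W" using hW by auto
  next
    fix y assume "y \<in> ?W"
    then obtain i where i: "i \<in> I" "y \<in> W i" by blast
    then obtain x where "x \<in> space (M i)" "y = h i x" using bij_betw_imp_surj_on[OF hb[OF i(1)]] by blast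
    then show "y \<in> ?h ` ?\<Omega>" using i by (intro image_eqI[of _ _ "(i, x)"]) auto
  qed
  have meas: "?h \<in> measurable (borel_sum I M) N"
  proof (rule measurableI)
    fix u assume "u \<in> space (borel_sum I M)"
    then show "?h u \<in> space N" using hW N[THEN sets.sets_into_space] unfolding space_borel_sum by fastforce
  next
    fix S assume S: "S \<in> sets N"
    show "?h -` S \<inter> space (borel_sum I M) \<in> sets (borel_sum I M)"
      unfolding space_borel_sum
    proof (rule sets_borel_sumI)
      fix i assume i: "i \<in> I"
      have "h i \<in> measurable (M i) N" using hm[OF i] measurable_restrict_space2_iff by blast
      from measurable_sets[OF this S] show "Pair i -` (?h -` S \<inter> ?\<Omega>) \<in> sets (M i)"
        using i by (simp add: vimage_def Int_def)
    qed blast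
  qed
  have img: "h i ` B \<in> sets N" if i: "i \<in> I" and B: "B \<in> sets (M i)" for i B
  proof -
    have Bs: "B \<subseteq> space (M i)" by (rule sets.sets_into_space[OF B])
    have "the_inv_into (space (M i)) (h i) -` B \<inter> W i \<in> sets (restrict_space N (W i))"
      using measurable_sets[OF hi[OF i] B] spW[OF i] by simp
    moreover have "the_inv_into (space (M i)) (h i) -` B \<inter> W i = h i ` B"
    proof (intro subset_antisym subsetI)
      fix y assume "y \<in> the_inv_into (space (M i)) (h i) -` B \<inter> W i"
      then show "y \<in> h i ` B"
        using f_the_inv_into_f_bij_betw[OF hb[OF i], of y] by (metis IntE image_eqI vimageE)
    next
      fix y assume "y \<in> h i ` B"
      then obtain x where "x \<in> B" "y = h i x" by blast
      then show "y \<in> the_inv_into (space (M i)) (h i) -` B \<inter> W i"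
        using the_inv_into_f_f[OF bij_betw_imp_inj_on[OF hb[OF i]], of x] Bs hW[OF i] by auto
    qed
    ultimately show ?thesis
      using sets_restrict_space_iff[of "W i" N] N[OF i] sets.sets_into_space[OF N[OF i]] by (simp add: Int_absorb2)
  qed
  show ?thesis
    unfolding borel_iso_def sp space_borel_sum
  proof (intro conjI)
    show "?h \<in> measurable (borel_sum I M) (restrict_space N ?W)"
      by (rule measurable_restrict_space2[OF _ meas]) (use surj in \<open>auto simp: space_borel_sum\<close>)
    show "bij_betw ?h ?\<Omega> ?W" using inj surj by (simp add: bij_betw_def)
    show "the_inv_into ?\<Omega> ?h \<in> measurable (restrict_space N ?W) (borel_sum I M)"
      unfolding borel_sum_def
    proof (rule measurable_measure_of)
      show "the_inv_into ?\<Omega> ?h \<in> space (restrict_space N ?W) \<rightarrow> ?\<Omega>"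
        unfolding sp by (intro funcsetI the_inv_into_into[OF inj]) (use surj in auto)
      fix S assume S: "S \<in> {S. S \<subseteq> ?\<Omega> \<and> (\<forall>i\<in>I. Pair i -` S \<in> sets (M i))}"
      then have S\<Omega>: "S \<subseteq> ?\<Omega>" by blast
      have "the_inv_into ?\<Omega> ?h -` S \<inter> ?W = ?h ` S"
      proof (intro subset_antisym subsetI)
        fix y assume y: "y \<in> the_inv_into ?\<Omega> ?h -` S \<inter> ?W"
        then have "?h (the_inv_into ?\<Omega> ?h y) = y" using surj by (intro f_the_inv_into_f[OF inj]) simp
        then show "y \<in> ?h ` S" using y by (intro image_eqI[of _ _ "the_inv_into ?\<Omega> ?h y"]) simp_all
      next
        fix y assume "y \<in> ?h ` S"
        then obtain u where u: "u \<in> S" "y = ?h u" by blast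
        then have "the_inv_into ?\<Omega> ?h y = u" using the_inv_into_f_f[OF inj, of u] S\<Omega> by blast
        moreover have "y \<in> ?h ` ?\<Omega>" using u S\<Omega> by blast
        ultimately show "y \<in> the_inv_into ?\<Omega> ?h -` S \<inter> ?W" using u(1) surj by simp
      qed
      also have "?h ` S = (\<Union>i\<in>I. h i ` (Pair i -` S))" using S\<Omega> by force
      finally have eq: "the_inv_into ?\<Omega> ?h -` S \<inter> ?W = (\<Union>i\<in>I. h i ` (Pair i -` S))" .
      have "(\<Union>i\<in>I. h i ` (Pair i -` S)) \<in> sets N"
        by (rule sets.countable_UN''[OF I]) (use img S in blast)
      then show "the_inv_into ?\<Omega> ?h -` S \<inter> space (restrict_space N ?W) \<in> sets (restrict_space N ?W)"
        unfolding sp eq[symmetric] using sets_restrict_space_iff[of ?W N] W sets.sets_into_space[OF W]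
        by (simp add: Int_absorb2)
    qed blast
  qed
qed

lemma borel_iso_id: "borel_iso M M (\<lambda>x. x)"
proof -
  have "the_inv_into (space M) (\<lambda>x. x) x = x" if "x \<in> space M" for x
    by (rule the_inv_into_f_f[OF inj_on_id2 that])
  then have "the_inv_into (space M) (\<lambda>x. x) \<in> measurable M M"
    using measurable_cong[of M "the_inv_into (space M) (\<lambda>x. x)" "\<lambda>x. x" M] by simp
  then show ?thesis by (simp add: borel_iso_def bij_betw_def)
qed

section \<open>The desingularization\<close>

context desing_data
begin

text \<open>An edge of the graph is a triple: whether it lies in the tree, its direction, its number.\<close>

definition L :: "bool \<Rightarrow> nat \<Rightarrow> 'c set" where "L tr n = (if tr then E n else T n)"
definition lo :: "bool \<Rightarrow> nat \<Rightarrow> nat" where "lo tr n = (if tr then p n else a n)"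
definition hi :: "bool \<Rightarrow> nat \<Rightarrow> nat" where "hi tr n = (if tr then Suc n else b n)"
text \<open>With the identity as displacement of tree edges, both kinds of edges satisfy the same
  statements \<open>\<psi>_R\<close> and \<open>L_ter\<close>.\<close>

definition \<psi> :: "bool \<Rightarrow> nat \<Rightarrow> 'a \<Rightarrow> 'a" where "\<psi> tr n x = (if tr then x else \<phi> n x)"

lemma L_sets: "L tr n \<in> sets E.tot" and L_inj: "inj_on pe (L tr n)"
  and L_org: "forg A ` L tr n \<subseteq> V (lo tr n)"
  using E_sets E_inj org_E T[of n] by (auto simp: L_def lo_def)

lemma L_SE: "L tr n \<subseteq> SE" by (rule sets.sets_into_space[OF L_sets])

lemma L_base_sets: "pe ` L tr n \<in> sets X" by (rule E.base_sets[OF L_sets L_inj])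

lemma \<psi>_measurable: "\<psi> tr n \<in> measurable (restrict_space X (pe ` L tr n)) X"
  and \<psi>_inj: "inj_on (\<psi> tr n) (pe ` L tr n)"
proof -
  have "(\<lambda>x. x) \<in> measurable (restrict_space X (pe ` E n)) X" by (rule measurable_restrict_space1) simp
  then show "\<psi> tr n \<in> measurable (restrict_space X (pe ` L tr n)) X"
    using T[of n] by (cases tr) (simp_all add: \<psi>_def[abs_def] L_def)
  show "inj_on (\<psi> tr n) (pe ` L tr n)"
    using T[of n] by (cases tr) (simp_all add: \<psi>_def[abs_def] L_def)
qed

lemma \<psi>_R: "x \<in> pe ` L tr n \<Longrightarrow> (x, \<psi> tr n x) \<in> R"
proof (cases tr)
  case True
  assume "x \<in> pe ` L tr n"
  then have "x \<in> space X" using L_SE E.proj_space by blast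
  then show ?thesis using True by (simp add: \<psi>_def E.R_refl)
next
  case False
  assume "x \<in> pe ` L tr n"
  then show ?thesis using False T[of n] by (auto simp: \<psi>_def L_def)
qed

lemma L_ter:
  assumes "e \<in> L tr n"
  shows "act (vfib A) (\<psi> tr n (pe e)) (pe e) (fter A e) \<in> V (hi tr n)"
proof (cases tr)
  case True
  have e: "e \<in> SE" using assms L_SE by blast
  have "act (vfib A) (pe e) (pe e) (fter A e) = fter A e"
    using V.act_id[OF ter_space[OF e]] ter_proj[OF e] by simp
  then show ?thesis using True assms ter_E[of n] by (auto simp: \<psi>_def L_def hi_def)
next
  case False
  then show ?thesis using assms T[of n] by (simp add: \<psi>_def L_def hi_def)
qed

text \<open>Comparing both pairs of ends would give \<open>p n = Suc m\<close> and
  \<open>p m = Suc n\<close>, hence \<open>m < n\<close> and \<open>n < m\<close>.\<close>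

lemma E_opp_sep: "e \<in> E n \<Longrightarrow> g \<in> E m \<Longrightarrow> (e, fopp A g) \<notin> E.orb"
proof
  assume eg: "e \<in> E n" "g \<in> E m" "(e, fopp A g) \<in> E.orb"
  then have S: "g \<in> SE" using E_SE by blast
  have "(forg A e, fter A g) \<in> V.orb" using org_orb[OF eg(3)] org_opp[OF S] by simp
  then have "p n = Suc m" using V_unique org_E[of n] ter_E[of m] eg by blast
  moreover have "(fter A e, forg A g) \<in> V.orb" using ter_orb[OF eg(3)] ter_opp[OF S] by simp
  then have "Suc n = p m" using V_unique ter_E[of n] org_E[of m] eg by blast
  ultimately show False using p_le[of n] p_le[of m] by simp
qed

lemma E_rest: "e \<in> E n \<Longrightarrow> e \<notin> rest"
  unfolding rest_def using E.subset_sat[OF E_SE[of n]] by blast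

text \<open>Two tree edges are told apart by the numbers of their ends, two other edges by
  \<open>T_sep\<close>, and edges of different kinds by membership in \<open>rest\<close>.\<close>

lemma L_sep:
  assumes ne: "(tr, n) \<noteq> (tr', m)" and e: "e \<in> L tr n" and g: "g \<in> L tr' m"
  shows "(e, g) \<notin> E.orb \<and> (e, fopp A g) \<notin> E.orb"
proof -
  have S: "e \<in> SE" "g \<in> SE" using e g L_SE by blast+
  consider "tr" "tr'" | "\<not> tr" "\<not> tr'" | "tr" "\<not> tr'" | "\<not> tr" "tr'" by blast
  then show ?thesis
  proof cases
    case 1
    then have eg: "e \<in> E n" "g \<in> E m" "n \<noteq> m" using e g ne by (auto simp: L_def)
    have "(e, g) \<notin> E.orb"
    proof
      assume "(e, g) \<in> E.orb"
      then have "(fter A e, fter A g) \<in> V.orb" by (rule ter_orb)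
      then have "Suc n = Suc m" using V_unique[of "fter A e" "Suc n" "fter A g" "Suc m"] ter_E[of n] ter_E[of m] eg by blast
      then show False using eg(3) by simp
    qed
    then show ?thesis using E_opp_sep[OF eg(1,2)] by blast
  next
    case 2
    then have eg: "e \<in> T n" "g \<in> T m" "n \<noteq> m" using e g ne by (auto simp: L_def)
    show ?thesis by (rule T_sep[OF eg(3,1,2)])
  next
    case 3
    then have eg: "e \<in> E n" "g \<in> rest" using e g T[of m] by (auto simp: L_def)
    show ?thesis
      using E_rest[OF eg(1)] rest_invariant[OF eg(2) E.orb_sym, of e]
        rest_invariant[OF rest_opp[OF eg(2)] E.orb_sym, of e] by blast
  next
    case 4
    then have eg: "e \<in> rest" "g \<in> E m" using e g T[of n] by (auto simp: L_def)
    have "(e, fopp A g) \<notin> E.orb"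
    proof
      assume "(e, fopp A g) \<in> E.orb"
      then have "(fopp A e, g) \<in> E.orb" using opp_orb_iff[OF S] by blast
      from rest_invariant[OF rest_opp[OF eg(1)] this] E_rest[OF eg(2)] show False by blast
    qed
    then show ?thesis using E_rest[OF eg(2)] rest_invariant[OF eg(1), of g] by blast
  qed
qed

definition rep :: "bool \<times> bool \<times> nat \<Rightarrow> 'c set" where
  "rep k = (case k of (tr, up, n) \<Rightarrow> if up then L tr n else fopp A ` L tr n)"

lemma rep_SE: "rep k \<subseteq> SE"
  using L_SE opp_space by (cases k) (auto simp: rep_def)

lemma rep_sets: "rep k \<in> sets E.tot"
  using L_sets opp_image_sets[OF L_sets] by (cases k) (simp add: rep_def)

lemma rep_cover: "(\<Union>k. E.sat (rep k)) = SE"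
proof (intro subset_antisym subsetI)
  fix e assume "e \<in> (\<Union>k. E.sat (rep k))"
  then show "e \<in> SE" using E.sat_space by blast
next
  fix e assume e: "e \<in> SE"
  have "\<exists>tr n. e \<in> E.sat (L tr n) \<union> E.sat (fopp A ` L tr n)"
  proof (cases "e \<in> rest")
    case True
    then obtain n where "e \<in> E.sat (T n) \<union> E.sat (fopp A ` T n)" unfolding T_cover[symmetric] by (rule UN_E)
    then show ?thesis by (intro exI[of _ False] exI[of _ n]) (simp add: L_def)
  next
    case False
    then obtain n where "e \<in> E.sat (E n) \<union> E.sat (fopp A ` E n)" using e unfolding rest_def by blast
    then show ?thesis by (intro exI[of _ True] exI[of _ n]) (simp add: L_def)
  qed
  then obtain tr n where "e \<in> E.sat (rep (tr, True, n)) \<or> e \<in> E.sat (rep (tr, False, n))"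
    by (auto simp: rep_def)
  then show "e \<in> (\<Union>k. E.sat (rep k))" by blast
qed

lemma rep_sep:
  assumes "(tr, n) \<noteq> (tr', m)"
  shows "E.sat (rep (tr, up, n)) \<inter> E.sat (rep (tr', up', m)) = {}"
proof (rule E.sat_disjoint, rule notI)
  fix f h assume f: "f \<in> rep (tr, up, n)" and h: "h \<in> rep (tr', up', m)" and fh: "(f, h) \<in> E.orb"
  obtain e where e: "e \<in> L tr n" "f = (if up then e else fopp A e)" using f by (auto simp: rep_def split: if_splits)
  obtain g where g: "g \<in> L tr' m" "h = (if up' then g else fopp A g)" using h by (auto simp: rep_def split: if_splits)
  have S: "e \<in> SE" "g \<in> SE" using e(1) g(1) L_SE by blast+
  have "(e, g) \<in> E.orb \<or> (e, fopp A g) \<in> E.orb"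
    using fh opp_orb[OF fh] opp_opp[OF S(1)] opp_opp[OF S(2)] unfolding e(2) g(2)
    by (cases up; cases up') simp_all
  then show False using L_sep[OF assms e(1) g(1)] by blast
qed

lemma rep_opp:
  "E.sat (rep (tr, up, n)) \<inter> E.sat (rep (tr, \<not> up, n)) = {} \<or> E.sat (rep (tr, up, n)) = E.sat (rep (tr, \<not> up, n))"
proof -
  have "E.sat (L tr n) \<inter> E.sat (fopp A ` L tr n) = {} \<or> E.sat (L tr n) = E.sat (fopp A ` L tr n)"
  proof (cases tr)
    case True
    have "E.sat (E n) \<inter> E.sat (fopp A ` E n) = {}"
      by (rule E.sat_disjoint) (use E_opp_sep in blast)
    then show ?thesis using True by (simp add: L_def)
  next
    case False
    then show ?thesis using T[of n] by (simp add: L_def)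
  qed
  then show ?thesis by (cases up) (auto simp: rep_def)
qed

text \<open>Inside the tree even opposite edges have disjoint saturations, by
  \<open>E_opp_sep\<close>. This makes the representation injective on the sum of the edge
  spaces.\<close>

lemma tree_rep_disjoint:
  assumes "k \<noteq> l" "fst k" "fst l"
  shows "E.sat (rep k) \<inter> E.sat (rep l) = {}"
proof -
  obtain up n up' m where kl: "k = (True, up, n)" "l = (True, up', m)"
    using assms(2,3) by (cases k; cases l) auto
  show ?thesis
  proof (cases "n = m")
    case False
    then show ?thesis unfolding kl by (intro rep_sep) simp
  next
    case True
    have "E.sat (E n) \<inter> E.sat (fopp A ` E n) = {}"
      by (rule E.sat_disjoint) (use E_opp_sep in blast)
    then show ?thesis using assms(1) True unfolding kl by (cases up; cases up') (auto simp: rep_def L_def)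
  qed
qed

definition chi :: "bool \<times> bool \<times> nat \<Rightarrow> 'a \<Rightarrow> 'c" where
  "chi k x = (case k of (tr, up, n) \<Rightarrow> if up then E.sec (L tr n) x else fopp A (E.sec (L tr n) x))"

definition base :: "bool \<times> bool \<times> nat \<Rightarrow> 'a set" where
  "base k = (case k of (tr, up, n) \<Rightarrow> pe ` L tr n)"

lemma base_sets: "base k \<in> sets X"
  using L_base_sets by (cases k) (simp add: base_def)

lemma chi_image: "chi k ` base k = rep k"
proof -
  obtain tr up n where k: "k = (tr, up, n)" by (cases k)
  have "(\<lambda>x. fopp A (E.sec (L tr n) x)) ` pe ` L tr n = fopp A ` E.sec (L tr n) ` pe ` L tr n"
    by (simp only: image_image)
  then show ?thesis
    unfolding k using E.sec_image[OF L_sets L_inj, of tr n]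
    by (cases up) (simp_all add: chi_def[abs_def] base_def rep_def)
qed

lemma chi_proj: "x \<in> base k \<Longrightarrow> pe (chi k x) = x"
  using E.proj_sec[OF L_sets L_inj] opp_proj E.sec_space[OF L_sets L_inj]
  by (cases k) (simp add: chi_def base_def)

lemma chi_iso: "borel_iso (restrict_space X (base k)) (restrict_space E.tot (rep k)) (chi k)"
proof -
  obtain tr up n where k: "k = (tr, up, n)" by (cases k)
  have "chi k \<in> measurable (restrict_space X (base k)) E.tot"
    using E.sec_measurable[OF L_sets L_inj, of tr n]
      measurable_compose[OF E.sec_measurable[OF L_sets L_inj, of tr n] opp_measurable]
    unfolding k chi_def[abs_def] base_def by (cases up) simp_all
  moreover have "inj_on (chi k) (base k)" using chi_proj by (metis inj_onI)
  ultimately show ?thesis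
    using borel_iso_image[OF X E.tot_standard base_sets, of "chi k" k] unfolding chi_image by blast
qed

text \<open>Reversal commutes with the action, so the two directions of an edge carry the same
  relation.\<close>

lemma chi_orb:
  assumes "x \<in> base (tr, up, n)" "y \<in> base (tr, up, n)"
  shows "(chi (tr, up, n) x, chi (tr, up, n) y) \<in> E.orb \<longleftrightarrow> (x, y) \<in> E.sec_rel (L tr n)"
proof -
  have xy: "x \<in> pe ` L tr n" "y \<in> pe ` L tr n" using assms by (simp_all add: base_def)
  have S: "E.sec (L tr n) x \<in> SE" "E.sec (L tr n) y \<in> SE" using E.sec_space[OF L_sets L_inj] xy by blast+
  have "(fopp A (E.sec (L tr n) x), fopp A (E.sec (L tr n) y)) \<in> E.orb \<longleftrightarrow>
      (E.sec (L tr n) x, E.sec (L tr n) y) \<in> E.orb"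
    using opp_orb_iff[OF S(1) opp_space[OF S(2)]] opp_opp[OF S(2)] by simp
  then show ?thesis
    using xy by (cases up) (simp_all add: chi_def E.sec_rel_def[OF L_sets L_inj])
qed

end

text \<open>All spaces of the construction are subsets of \<open>X\<close>, so the identifications
  in the third block of the definition agree with the identity.\<close>

lemma rel_iso_identity:
  assumes "\<And>u. u \<in> space M \<Longrightarrow> f u = u"
  shows "rel_iso M S M S f"
proof -
  have inj: "inj_on f (space M)" using assms by (simp add: inj_on_def)
  have "the_inv_into (space M) f x = x" if "x \<in> space M" for x
    using the_inv_into_f_f[OF inj that] assms[OF that] by simp
  then have "the_inv_into (space M) f \<in> measurable M M"
    using measurable_cong[of M "the_inv_into (space M) f" "\<lambda>x. x" M] by simp
  moreover have "f \<in> measurable M M"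
    using measurable_cong[of M f "\<lambda>x. x" M] assms by simp
  moreover have "bij_betw f (space M) (space M)"
    using inj assms by (simp add: bij_betw_def)
  ultimately show ?thesis using assms by (simp add: rel_iso_def borel_iso_def)
qed

lemma restrict_restrict_subset:
  assumes "B \<in> sets M" "C \<in> sets M" "C \<subseteq> B"
  shows "restrict_space (restrict_space M B) C = restrict_space M C"
  using assms restrict_restrict_space[of B M C] sets.sets_into_space[OF assms(1)] sets.sets_into_space[OF assms(2)]
  by (simp add: Int_absorb1 Int_absorb2)

lemma graph_of_relations_restrict:
  assumes "graph_of_relations G" "serre_graph (restrict_graph (graph G) V E)"
    "V \<subseteq> verts (graph G)" "E \<subseteq> edges (graph G)"
  shows "graph_of_relations (restrict_rel_graph G V E)"
proof -
  have s: "verts (restrict_graph (graph G) V E) = V" "edges (restrict_graph (graph G) V E) = E"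
    "opp (restrict_graph (graph G) V E) = opp (graph G)" "ter (restrict_graph (graph G) V E) = ter (graph G)"
    by (simp_all add: restrict_graph_def)
  have t: "graph (restrict_rel_graph G V E) = restrict_graph (graph G) V E"
    "vspace (restrict_rel_graph G V E) = vspace G" "vrel (restrict_rel_graph G V E) = vrel G"
    "espace (restrict_rel_graph G V E) = espace G" "erel (restrict_rel_graph G V E) = erel G"
    "ginj (restrict_rel_graph G V E) = ginj G"
    by (simp_all add: restrict_rel_graph_def)
  show ?thesis
    using assms countable_subset[OF assms(3)] countable_subset[OF assms(4)]
    unfolding graph_of_relations_def s t by (auto simp: subset_iff)
qed

section \<open>The graph of relations\<close>

context desing_data
begin

definition korg :: "bool \<times> bool \<times> nat \<Rightarrow> nat" where
  "korg k = (case k of (tr, up, n) \<Rightarrow> if up then lo tr n else hi tr n)"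
definition kter :: "bool \<times> bool \<times> nat \<Rightarrow> nat" where
  "kter k = (case k of (tr, up, n) \<Rightarrow> if up then hi tr n else lo tr n)"
definition kopp :: "bool \<times> bool \<times> nat \<Rightarrow> bool \<times> bool \<times> nat" where
  "kopp k = (case k of (tr, up, n) \<Rightarrow> (tr, \<not> up, n))"
text \<open>In the \<open>up\<close> direction the end of an edge is a chosen vertex only after
  displacement by \<open>\<psi>\<close>. In the other direction it is the origin of the section, a
  chosen vertex already, hence the inclusion.\<close>

definition kinj :: "bool \<times> bool \<times> nat \<Rightarrow> 'a \<Rightarrow> 'a" where
  "kinj k x = (case k of (tr, up, n) \<Rightarrow> if up then \<psi> tr n x else x)"
definition krel :: "bool \<times> bool \<times> nat \<Rightarrow> ('a \<times> 'a) set" where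
  "krel k = (case k of (tr, up, n) \<Rightarrow> E.sec_rel (L tr n))"

lemma kopp_simps [simp]: "kopp (kopp k) = k" "kopp k \<noteq> k" "korg (kopp k) = kter k" "kter (kopp k) = korg k"
  "base (kopp k) = base k" "krel (kopp k) = krel k" "fst (kopp k) = fst k"
  by (cases k; simp add: kopp_def korg_def kter_def base_def krel_def)+

lemma tree_kinj [simp]: "fst k \<Longrightarrow> kinj k x = x"
  by (cases k) (simp add: kinj_def \<psi>_def)

lemma chi_mem: "x \<in> base k \<Longrightarrow> chi k x \<in> rep k"
  using chi_image by blast

lemma chi_opp: "x \<in> base k \<Longrightarrow> chi (kopp k) x = fopp A (chi k x)"
  using opp_opp[OF E.sec_space[OF L_sets L_inj]] by (cases k) (auto simp: chi_def kopp_def base_def)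

text \<open>The displaced end lies in \<open>V (kter k)\<close>, by \<open>L_ter\<close> or because
  the section starts there. As \<open>pv\<close> is injective on that set, the end is recovered from
  the displaced base point.\<close>

lemma sec_kinj:
  assumes x: "x \<in> base k"
  shows "kinj k x \<in> pv ` V (kter k)" "(x, kinj k x) \<in> R"
    "V.sec (V (kter k)) (kinj k x) = act (vfib A) (kinj k x) x (fter A (chi k x))"
proof -
  obtain tr up n where k: "k = (tr, up, n)" by (cases k)
  have cS: "chi k x \<in> SE" using chi_mem[OF x] rep_SE by blast
  then have px: "pv (fter A (chi k x)) = x" using ter_proj chi_proj[OF x] by simp
  have xX: "x \<in> space X" using sets.sets_into_space[OF base_sets] x by blast
  have "act (vfib A) (kinj k x) x (fter A (chi k x)) \<in> V (kter k) \<and> (x, kinj k x) \<in> R"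
  proof (cases up)
    case True
    have c: "chi k x \<in> L tr n" using chi_mem[OF x] True by (simp add: k rep_def)
    have "x \<in> pe ` L tr n" using x by (simp add: k base_def)
    then show ?thesis using L_ter[OF c] chi_proj[OF x] \<psi>_R True by (simp add: k kinj_def kter_def)
  next
    case False
    have "fter A (chi k x) \<in> V (lo tr n)"
    proof -
      obtain e where "e \<in> L tr n" "chi k x = fopp A e" using chi_mem[OF x] False by (auto simp: k rep_def)
      moreover from this(1) have "e \<in> SE" using L_SE by blast
      ultimately show ?thesis using ter_opp[of e] L_org[of tr n] by auto
    qed
    moreover have "act (vfib A) x x (fter A (chi k x)) = fter A (chi k x)"
      using V.act_id[OF ter_space[OF cS]] px by simp
    ultimately show ?thesis using False V.R_refl[OF xX] by (simp add: k kinj_def kter_def)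
  qed
  then have m: "act (vfib A) (kinj k x) x (fter A (chi k x)) \<in> V (kter k)" and r: "(x, kinj k x) \<in> R" by blast+
  show "(x, kinj k x) \<in> R" by (rule r)
  have pr: "pv (act (vfib A) (kinj k x) x (fter A (chi k x))) = kinj k x"
    by (rule V.act_proj[OF V.R_sym[OF r] ter_space[OF cS] px])
  show "kinj k x \<in> pv ` V (kter k)" using imageI[OF m, of pv] unfolding pr .
  show "V.sec (V (kter k)) (kinj k x) = act (vfib A) (kinj k x) x (fter A (chi k x))"
    using V.sec_proj[OF V_sets V_inj m] pr by simp
qed

text \<open>Equivalent edges have equivalent ends, and displacement stays within the orbit of the
  end.\<close>

lemma kinj_rel:
  assumes uv: "(u, v) \<in> krel k"
  shows "(kinj k u, kinj k v) \<in> V.sec_rel (V (kter k))"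
proof -
  obtain tr up n where k: "k = (tr, up, n)" by (cases k)
  have b: "u \<in> base k" "v \<in> base k"
    using uv by (auto simp: k krel_def base_def E.sec_rel_def[OF L_sets L_inj])
  have "(chi k u, chi k v) \<in> E.orb" using chi_orb[of u tr up n v] b uv by (simp add: k krel_def)
  then have t: "(fter A (chi k u), fter A (chi k v)) \<in> V.orb" by (rule ter_orb)
  have o: "(V.sec (V (kter k)) (kinj k x), fter A (chi k x)) \<in> V.orb" if x: "x \<in> base k" for x
  proof -
    have cS: "chi k x \<in> SE" using chi_mem[OF x] rep_SE by blast
    then have px: "pv (fter A (chi k x)) = x" using ter_proj chi_proj[OF x] by simp
    show ?thesis
      unfolding sec_kinj(3)[OF x]
      using V.orb_act[of "kinj k x" "fter A (chi k x)"] V.R_sym[OF sec_kinj(2)[OF x]] ter_space[OF cS] px by simp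
  qed
  have "(V.sec (V (kter k)) (kinj k u), V.sec (V (kter k)) (kinj k v)) \<in> V.orb"
    by (rule V.orb_trans[OF o[OF b(1)] V.orb_trans[OF t V.orb_sym[OF o[OF b(2)]]]])
  then show ?thesis
    using sec_kinj(1)[OF b(1)] sec_kinj(1)[OF b(2)] by (simp add: V.sec_rel_def[OF V_sets V_inj])
qed

lemma V_base_sets: "pv ` V n \<in> sets X" by (rule V.base_sets[OF V_sets V_inj])

lemma kinj_measurable:
  "kinj k \<in> measurable (restrict_space X (base k)) (restrict_space X (pv ` V (kter k)))"
  and kinj_inj: "inj_on (kinj k) (base k)"
proof -
  obtain tr up n where k: "k = (tr, up, n)" by (cases k)
  have "(\<lambda>x. x) \<in> measurable (restrict_space X (base k)) X" by (rule measurable_restrict_space1) simp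
  then have "kinj k \<in> measurable (restrict_space X (base k)) X"
    using \<psi>_measurable[of tr n] by (cases up) (simp_all add: k kinj_def[abs_def] base_def)
  then show "kinj k \<in> measurable (restrict_space X (base k)) (restrict_space X (pv ` V (kter k)))"
    by (rule measurable_restrict_space2[rotated])
      (use sec_kinj(1) in \<open>auto simp: E.restrict_base_space[OF base_sets]\<close>)
  show "inj_on (kinj k) (base k)"
    using \<psi>_inj[of tr n] by (cases up) (simp_all add: k kinj_def[abs_def] base_def)
qed

abbreviation enc :: "bool \<times> bool \<times> nat \<Rightarrow> nat" where "enc \<equiv> to_nat"
abbreviation dec :: "nat \<Rightarrow> bool \<times> bool \<times> nat" where "dec \<equiv> from_nat"

text \<open>Triples are encoded as natural numbers; the encoding is not assumed to be onto, hence
  \<open>range enc\<close>.\<close>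

definition quotient_graph :: "(nat, nat) sgraph" where
  "quotient_graph = \<lparr>verts = UNIV, edges = range enc, org = \<lambda>e. korg (dec e), ter = \<lambda>e. kter (dec e),
     opp = \<lambda>e. enc (kopp (dec e))\<rparr>"

definition quotient_relations :: "(nat, nat, 'a, 'a) rel_graph" where
  "quotient_relations = \<lparr>graph = quotient_graph, vspace = \<lambda>n. restrict_space X (pv ` V n),
     vrel = \<lambda>n. V.sec_rel (V n), espace = \<lambda>e. restrict_space X (base (dec e)),
     erel = \<lambda>e. krel (dec e), ginj = \<lambda>e. kinj (dec e)\<rparr>"

definition D :: "('a, 'b, 'c, nat, nat, 'a, 'a) desing" where
  "D = \<lparr>rgraph = quotient_relations, orient = enc ` {k. fst (snd k)}, tverts = UNIV, tedges = enc ` {k. fst k},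
     root = 0, root_iso = \<lambda>x. x, vchi = \<lambda>(n, x). V.sec (V n) x, echi = \<lambda>(e, x). chi (dec e) x,
     src = \<lambda>e. base (dec e), phi = \<lambda>e. kinj (dec e), sect = \<lambda>e. chi (dec e)\<rparr>"

lemmas D_simps = D_def quotient_relations_def quotient_graph_def

lemma D_sel: "root D = 0" "root_iso D = (\<lambda>x. x)" "vchi D = (\<lambda>(n, x). V.sec (V n) x)"
  "echi D = (\<lambda>(e, x). chi (dec e) x)" "src D = (\<lambda>e. base (dec e))" "phi D = (\<lambda>e. kinj (dec e))"
  "sect D = (\<lambda>e. chi (dec e))" "orient D = enc ` {k. fst (snd k)}"
  by (simp_all add: D_def)

abbreviation "G \<equiv> rgraph D"
abbreviation "G' \<equiv> restrict_rel_graph G (tverts D) (tedges D)"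

lemma graph_of_relations_G: "graph_of_relations G"
proof -
  have "serre_graph quotient_graph"
    by (auto simp: serre_graph_def quotient_graph_def)
  moreover have "standard_borel (restrict_space X (pv ` V n))" for n
    by (rule standard_borel_restrict[OF X V_base_sets])
  moreover have "borel_equiv (restrict_space X (pv ` V n)) (V.sec_rel (V n))" for n
    by (rule V.sec_rel_borel_equiv[OF V_sets V_inj])
  moreover have "standard_borel (restrict_space X (base k))" for k
    by (rule standard_borel_restrict[OF X base_sets])
  moreover have "borel_equiv (restrict_space X (base k)) (krel k)" for k
    using E.sec_rel_borel_equiv[OF L_sets L_inj] by (cases k) (simp add: base_def krel_def)
  moreover have "inj_on (kinj k) (space (restrict_space X (base k)))" for k
    unfolding E.restrict_base_space[OF base_sets] by (rule kinj_inj)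
  ultimately show ?thesis
    using kinj_measurable kinj_rel
    by (auto simp: graph_of_relations_def D_def quotient_relations_def quotient_graph_def)
qed

lemma G'_simps:
  "verts (graph G') = UNIV" "edges (graph G') = enc ` {k. fst k}"
  "org (graph G') e = korg (dec e)" "ter (graph G') e = kter (dec e)" "opp (graph G') e = enc (kopp (dec e))"
  "vspace G' n = restrict_space X (pv ` V n)" "vrel G' n = V.sec_rel (V n)"
  "espace G' e = restrict_space X (base (dec e))" "erel G' e = krel (dec e)" "ginj G' e = kinj (dec e)"
  by (simp_all add: restrict_rel_graph_def restrict_graph_def D_simps)

lemma serre_G': "serre_graph (graph G')"
  unfolding serre_graph_def G'_simps by auto

text \<open>The vertex \<open>Suc n\<close> has \<open>p n\<close> as its only smaller neighbour, so
  descending reaches the root 0, and \<open>parent_graph_no_circuit\<close> excludes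
  circuits.\<close>

lemma tree_G': "is_tree (graph G')"
  unfolding is_tree_def
proof (intro conjI notI serre_G')
  have "\<exists>q. walk (graph G') v q 0" for v
  proof (induction v rule: less_induct)
    case (less v)
    show ?case
    proof (cases v)
      case 0
      then show ?thesis by (intro exI[of _ "[]"]) (simp add: G'_simps)
    next
      case (Suc n)
      let ?e = "enc (True, False, n)"
      have "p n < v" using p_le[of n] Suc by simp
      from less[OF this] obtain q where "walk (graph G') (p n) q 0" by (rule exE)
      moreover have "org (graph G') ?e = v" "ter (graph G') ?e = p n" "?e \<in> edges (graph G')"
        by (simp_all add: G'_simps korg_def kter_def hi_def lo_def Suc)
      ultimately have "walk (graph G') v (?e # q) 0" by simp
      then show ?thesis by (rule exI)
    qed
  qed
  then show "graph_connected (graph G')"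
    by (intro graph_connected_root[OF serre_G', of 0]) (simp_all add: G'_simps)
  assume "\<exists>q. circuit (graph G') q"
  then obtain q where q: "circuit (graph G') q" by (rule exE)
  have "\<not> circuit (graph G') q"
  proof (rule parent_graph_no_circuit[OF serre_G'])
    fix e assume "e \<in> edges (graph G')"
    then obtain up n where "e = enc (True, up, n)" unfolding G'_simps by auto
    then show "org (graph G') e \<noteq> ter (graph G') e"
      using p_le[of n] by (simp add: G'_simps korg_def kter_def lo_def hi_def)
  next
    fix e f assume "e \<in> edges (graph G')" "f \<in> edges (graph G')"
    then obtain up n up' m where ef: "e = enc (True, up, n)" "f = enc (True, up', m)" unfolding G'_simps by auto
    assume h: "ter (graph G') e = org (graph G') f" "org (graph G') e < ter (graph G') e"
      "ter (graph G') f < org (graph G') f"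
    have "up" using h(2) p_le[of n] by (cases up) (simp_all add: ef G'_simps korg_def kter_def lo_def hi_def)
    moreover have "\<not> up'" using h(3) p_le[of m] by (cases up') (simp_all add: ef G'_simps korg_def kter_def lo_def hi_def)
    ultimately show "f = opp (graph G') e"
      using h(1) by (simp add: ef G'_simps korg_def kter_def lo_def hi_def kopp_def)
  qed
  with q show False by blast
qed

lemma graph_of_relations_G': "graph_of_relations G'"
  by (rule graph_of_relations_restrict[OF graph_of_relations_G])
    (use serre_G' in \<open>auto simp: restrict_rel_graph_def D_simps\<close>)

lemma space_vsum: "space (vsum G') = (SIGMA n:UNIV. pv ` V n)"
  unfolding vsum_def space_borel_sum G'_simps E.restrict_base_space[OF V_base_sets] ..

lemma space_esum: "space (esum G') = (SIGMA e:enc ` {k. fst k}. base (dec e))"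
  unfolding esum_def space_borel_sum G'_simps E.restrict_base_space[OF base_sets] ..

lemma sum_ends:
  assumes "fst k"
  shows "sum_org G' (enc k, x) = (korg k, x)" "sum_ter G' (enc k, x) = (kter k, x)"
  using assms by (simp_all add: sum_org_def sum_ter_def G'_simps)

lemma tree_base: "fst k \<Longrightarrow> x \<in> base k \<Longrightarrow> x \<in> pv ` V (korg k) \<and> x \<in> pv ` V (kter k)"
  using sec_kinj(1)[of x k] sec_kinj(1)[of x "kopp k"] by simp

text \<open>Every vertex of \<open>V (Suc n)\<close> ends an edge of \<open>E n\<close>, so every
  point of that vertex space has a way to the parent.\<close>

lemma base_tree: "base (True, up, n) = pv ` V (Suc n)"
proof -
  have "pe ` E n = pv ` fter A ` E n"
    unfolding image_image by (rule image_cong[OF refl]) (simp add: ter_proj subsetD[OF E_SE])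
  then show ?thesis using ter_E[of n] by (simp add: base_def L_def)
qed

text \<open>Along tree edges both morphisms are inclusions, so the base point never changes.
  Conversely \<open>base_tree\<close> lets every point descend to the root, where all occurrences of
  one base point are joined.\<close>

lemma generated_rel_G':
  "generated_rel G' = {((n, x), (m, y)). x = y \<and> x \<in> pv ` V n \<and> x \<in> pv ` V m}"
proof -
  let ?S = "(\<lambda>e. (sum_org G' e, sum_ter G' e)) ` space (esum G')"
  let ?C = "(?S \<union> ?S\<inverse>)\<^sup>*"
  have S: "((korg k, x), (kter k, x)) \<in> ?S" if "fst k" "x \<in> base k" for k x
    using that sum_ends[OF that(1), of x]
    by (intro image_eqI[of _ _ "(enc k, x)"]) (auto simp: space_esum)
  have snd: "snd u = snd v" if "(u, v) \<in> ?C" for u v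
    using that
  proof (induction rule: rtrancl_induct)
    case (step v w)
    have st: "snd c = snd d" if "(c, d) \<in> ?S" for c d
    proof -
      from that obtain e where e: "e \<in> space (esum G')" "(c, d) = (sum_org G' e, sum_ter G' e)" by blast
      from e(1) obtain k x where "e = (enc k, x)" "fst k" unfolding space_esum by blast
      then show ?thesis using sum_ends[of k x] e(2) by simp
    qed
    from step(2) have "(v, w) \<in> ?S \<or> (w, v) \<in> ?S" by blast
    then have "snd v = snd w" by (elim disjE) (rule st, assumption, rule st[symmetric], assumption)
    then show ?case using step.IH by simp
  qed simp
  have root: "((n, x), (0, x)) \<in> ?C" if "x \<in> pv ` V n" for n x
    using that
  proof (induction n rule: less_induct)
    case (less n)
    show ?case
    proof (cases n)
      case (Suc m)
      let ?k = "(True, False, m)"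
      have x: "x \<in> base ?k" using less.prems Suc base_tree by simp
      have k: "korg ?k = n" "kter ?k = p m" by (simp_all add: korg_def kter_def hi_def lo_def Suc)
      have "((n, x), (p m, x)) \<in> ?S" using S[OF _ x] unfolding k by simp
      moreover have "((p m, x), (0, x)) \<in> ?C"
        by (rule less.IH) (use p_le[of m] Suc tree_base[OF _ x] k in simp_all)
      ultimately show ?thesis by (intro converse_rtrancl_into_rtrancl[of "(n, x)" "(p m, x)"]) simp_all
    qed simp
  qed
  have "sym ?C" by (intro sym_rtrancl) (auto simp: sym_def)
  then have conn: "((n, x), (m, x)) \<in> ?C" if "x \<in> pv ` V n" "x \<in> pv ` V m" for n m x
    using root[OF that(1)] root[OF that(2)] by (meson rtrancl_trans symD)
  have gen: "generated_rel G' = ?C \<inter> (space (vsum G') \<times> space (vsum G'))"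
    by (simp add: generated_rel_def Let_def)
  show ?thesis
  proof (intro subset_antisym subsetI)
    fix q assume q: "q \<in> generated_rel G'"
    obtain n x m y where e: "q = ((n, x), (m, y))" by (metis prod.exhaust)
    have "x = y" using q snd[of "(n, x)" "(m, y)"] unfolding gen e by simp
    then show "q \<in> {((n, x), (m, y)). x = y \<and> x \<in> pv ` V n \<and> x \<in> pv ` V m}"
      using q unfolding gen e space_vsum by simp
  next
    fix q assume "q \<in> {((n, x), (m, y)). x = y \<and> x \<in> pv ` V n \<and> x \<in> pv ` V m}"
    then obtain n m x where "q = ((n, x), (m, x))" "x \<in> pv ` V n" "x \<in> pv ` V m" by blast
    then show "q \<in> generated_rel G'" using conn[of x n m] unfolding gen space_vsum by simp
  qed
qed

lemma V_base_space: "pv ` V n \<subseteq> pv ` V 0"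
  unfolding V_0 using sets.sets_into_space[OF V_base_sets] .

lemma root_proj_G': "x \<in> pv ` V n \<Longrightarrow> root_proj G' 0 (n, x) = x"
  unfolding root_proj_def generated_rel_G' G'_simps E.restrict_base_space[OF V_base_sets]
  using V_base_space[of n] by (intro the_equality) auto

lemma rooted_tree_G': "rooted_tree_of_relations G' 0"
  unfolding rooted_tree_of_relations_def fundamental_domain_def
proof (intro conjI ballI graph_of_relations_G' tree_G')
  show "0 \<in> verts (graph G')" by (simp add: G'_simps)
  have sp: "space (vspace G' n) = pv ` V n" for n
    unfolding G'_simps by (rule E.restrict_base_space[OF V_base_sets])
  show "{0} \<times> space (vspace G' 0) \<in> sets (vsum G')"
    unfolding vsum_def
  proof (rule sets_borel_sumI)
    show "{0} \<times> space (vspace G' 0) \<subseteq> (SIGMA i:verts (graph G'). space (vspace G' i))"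
      by (auto simp: G'_simps)
    fix i :: nat
    have "Pair i -` ({0} \<times> space (vspace G' 0)) = (if i = 0 then space (vspace G' 0) else {})" by auto
    then show "Pair i -` ({0} \<times> space (vspace G' 0)) \<in> sets (vspace G' i)" by simp
  qed
  fix w assume "w \<in> space (vsum G')"
  then obtain n x where w: "w = (n, x)" "x \<in> pv ` V n" unfolding space_vsum by blast
  show "\<exists>!y. y \<in> {0} \<times> space (vspace G' 0) \<and> (w, y) \<in> generated_rel G'"
    unfolding sp generated_rel_G' using w V_base_space[of n] by (intro ex1I[of _ "(0, x)"]) auto
qed

text \<open>Tree edges involve no displacement: their ends lie in the chosen sets themselves, so the
  representatives form a subgraph.\<close>

lemma rep_ends:
  assumes "fst k" "e \<in> rep k"
  shows "forg A e \<in> V (korg k)" "fter A e \<in> V (kter k)" "fopp A e \<in> rep (kopp k)"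
proof -
  obtain up n where k: "k = (True, up, n)" using assms(1) by (cases k) auto
  have "forg A e \<in> V (korg k) \<and> fter A e \<in> V (kter k) \<and> fopp A e \<in> rep (kopp k)"
  proof (cases up)
    case True
    then have "e \<in> E n" using assms(2) by (simp add: k rep_def L_def)
    then show ?thesis using org_E[of n] ter_E[of n] True
      by (auto simp: k korg_def kter_def kopp_def rep_def L_def lo_def hi_def)
  next
    case False
    then obtain g where g: "g \<in> E n" "e = fopp A g" using assms(2) by (auto simp: k rep_def L_def)
    then have "g \<in> SE" using E_SE by blast
    then show ?thesis using g org_E[of n] ter_E[of n] False org_opp[of g] ter_opp[of g] opp_opp[of g]
      by (auto simp: k korg_def kter_def kopp_def rep_def L_def lo_def hi_def)
  qed
  then show "forg A e \<in> V (korg k)" "fter A e \<in> V (kter k)" "fopp A e \<in> rep (kopp k)" by blast+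
qed

section \<open>The representation in the field of trees\<close>

definition tree_V :: "'b set" where "tree_V = (\<Union>n. V n)"
definition tree_E :: "'c set" where "tree_E = (\<Union>k\<in>{k. fst k}. rep k)"

lemma tree_serre: "serre_graph (graph_on A tree_V tree_E)"
proof -
  have "forg A e \<in> tree_V \<and> fter A e \<in> tree_V \<and> fopp A e \<in> tree_E \<and> e \<in> SE" if e: "e \<in> tree_E" for e
  proof -
    obtain k where k: "fst k" "e \<in> rep k" using e unfolding tree_E_def by blast
    have "fopp A e \<in> tree_E" using rep_ends(3)[OF k] k(1) unfolding tree_E_def by (intro UN_I[of "kopp k"]) simp_all
    then show ?thesis using rep_ends(1,2)[OF k] rep_SE k(2) unfolding tree_V_def by blast
  qed
  then show ?thesis using opp_opp opp_neq org_opp by (simp add: serre_graph_def graph_on_def)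
qed

text \<open>Circuits are excluded because the whole fibre of \<open>A\<close> is a tree.
  Connectedness comes from walking back along the edges of \<open>E m\<close> to the vertex of
  \<open>V 0\<close> over \<open>x\<close>.\<close>

lemma tree_fibre:
  assumes x: "x \<in> space X"
  shows "is_tree (fibre_on A tree_V tree_E x)"
  unfolding is_tree_def
proof (intro conjI notI)
  let ?F = "fibre_on A tree_V tree_E x"
  have eS: "e \<in> tree_E \<Longrightarrow> e \<in> SE" for e unfolding tree_E_def using rep_SE by blast
  have s: "verts ?F = {v \<in> tree_V. pv v = x}" "edges ?F = {e \<in> tree_E. pe e = x}"
    "org ?F = forg A" "ter ?F = fter A" "opp ?F = fopp A"
    by (simp_all add: fibre_on_def graph_on_def)
  show serre: "serre_graph ?F"
    using tree_serre eS org_proj ter_proj opp_proj unfolding serre_graph_def s by (simp add: graph_on_def)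
  have walk: "\<exists>q. walk ?F v q (V.sec (V 0) x)" if "v \<in> V n" "pv v = x" for v n
    using that
  proof (induction n arbitrary: v rule: less_induct)
    case (less n)
    have "v \<in> tree_V" using less.prems(1) unfolding tree_V_def by blast
    then have v: "v \<in> verts ?F" using less.prems(2) by (simp add: s)
    show ?case
    proof (cases n)
      case 0
      then have "V.sec (V 0) x = v" using V.sec_proj[OF V_sets V_inj, of v 0] less.prems by simp
      then show ?thesis using v by (intro exI[of _ "[]"]) simp
    next
      case (Suc m)
      then obtain e where e: "e \<in> E m" "v = fter A e" using ter_E[of m] less.prems(1) by blast
      have eSE: "e \<in> SE" using e(1) E_SE by blast
      let ?e = "fopp A e"
      have "?e \<in> rep (True, False, m)" using e(1) by (simp add: rep_def L_def)
      then have "?e \<in> tree_E" unfolding tree_E_def by (intro UN_I[of "(True, False, m)"]) simp_all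
      moreover have "pe ?e = x" using opp_proj[OF eSE] ter_proj[OF eSE] less.prems(2) e(2) by simp
      moreover have "forg A e \<in> V (p m)" "pv (forg A e) = x"
        using org_E[of m] e org_proj[OF eSE] ter_proj[OF eSE] less.prems(2) by auto
      then obtain q where "walk ?F (forg A e) q (V.sec (V 0) x)"
        using less.IH[of "p m" "forg A e"] p_le[of m] Suc by auto
      ultimately have "walk ?F v (?e # q) (V.sec (V 0) x)"
        using org_opp[OF eSE] ter_opp[OF eSE] e(2) by (simp add: s)
      then show ?thesis by (rule exI)
    qed
  qed
  have xV: "x \<in> pv ` V 0" using x V_0 by simp
  have "V.sec (V 0) x \<in> tree_V" using V.sec_mem[OF V_sets V_inj xV] unfolding tree_V_def by blast
  then have r: "V.sec (V 0) x \<in> verts ?F" using V.proj_sec[OF V_sets V_inj xV] by (simp add: s)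
  show "graph_connected ?F"
  proof (rule graph_connected_root[OF serre r])
    fix v assume "v \<in> verts ?F"
    then have v: "v \<in> tree_V" "pv v = x" by (simp_all add: s)
    from v(1) obtain n where "v \<in> V n" unfolding tree_V_def by blast
    from walk[OF this v(2)] show "\<exists>q. walk ?F v q (V.sec (V 0) x)" .
  qed
  assume "\<exists>q. circuit ?F q"
  then obtain q where "circuit ?F q" by (rule exE)
  moreover have "tree_V \<subseteq> SV" unfolding tree_V_def using V_SV by blast
  ultimately have "circuit (fibre_on A SV SE x) q"
    by (intro circuit_mono[of ?F "fibre_on A SV SE x"]) (use eS in \<open>auto simp: fibre_on_def graph_on_def\<close>)
  then show False using trees[OF x] unfolding is_tree_def by blast
qed

lemma sub_arboretum_tree: "sub_arboretum A (space X) tree_V tree_E"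
  unfolding sub_arboretum_def
proof (intro conjI ballI tree_serre tree_fibre)
  show "tree_V \<in> sets V.tot" unfolding tree_V_def by (intro sets.countable_UN'' countableI_type V_sets)
  show "tree_E \<in> sets E.tot" unfolding tree_E_def by (intro sets.countable_UN'' countableI_type rep_sets)
  show "pv ` tree_V \<subseteq> space X" unfolding tree_V_def using V_SV V.proj_space by blast
  show "pe ` tree_E \<subseteq> space X" unfolding tree_E_def using rep_SE E.proj_space by blast
qed

lemma rep_tree_disjoint:
  assumes "e \<in> enc ` {k. fst k}" "f \<in> enc ` {k. fst k}" "e \<noteq> f"
  shows "rep (dec e) \<inter> rep (dec f) = {}"
proof -
  obtain k l where "e = enc k" "f = enc l" "fst k" "fst l" using assms(1,2) by blast
  then show ?thesis
    using tree_rep_disjoint[of k l] assms(3) E.subset_sat[OF rep_SE[of k]] E.subset_sat[OF rep_SE[of l]] by auto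
qed

text \<open>Both isomorphisms are glued from sections by \<open>borel_iso_sum\<close>. They respect
  ends because a vertex of \<open>V n\<close> is determined by its base point and tree edges keep
  the base point.\<close>

lemma iso_over: "arboretum_iso_over (root_iso D) (tree_arboretum G' 0) A tree_V tree_E (vchi D) (echi D)"
  unfolding arboretum_iso_over_def
proof (intro conjI ballI)
  have "borel_iso (borel_sum UNIV (vspace G')) (restrict_space V.tot (\<Union>n\<in>UNIV. V n)) (\<lambda>(n, x). V.sec (V n) x)"
  proof (rule borel_iso_sum)
    show "V n \<inter> V m = {}" if "n \<noteq> m" for n m
      using V_disj[OF that] V.subset_sat[OF V_SV[of n]] V.subset_sat[OF V_SV[of m]] by blast
    show "borel_iso (vspace G' n) (restrict_space V.tot (V n)) (V.sec (V n))" for n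
      unfolding G'_simps by (rule V.sec_borel_iso[OF V_sets V_inj])
  qed (simp_all add: V_sets)
  then show "borel_iso (total_space (vfib (tree_arboretum G' 0))) (restrict_space V.tot tree_V) (vchi D)"
    by (simp add: tree_arboretum_def vsum_def G'_simps tree_V_def D_sel)
  have "borel_iso (borel_sum (enc ` {k. fst k}) (espace G')) (restrict_space E.tot (\<Union>e\<in>enc ` {k. fst k}. rep (dec e)))
      (\<lambda>(e, x). chi (dec e) x)"
  proof (rule borel_iso_sum)
    show "borel_iso (espace G' e) (restrict_space E.tot (rep (dec e))) (chi (dec e))" for e
      unfolding G'_simps by (rule chi_iso)
  qed (simp_all add: rep_sets rep_tree_disjoint countableI_type)
  moreover have "(\<Union>e\<in>enc ` {k. fst k}. rep (dec e)) = tree_E" by (simp add: tree_E_def)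
  ultimately show "borel_iso (total_space (efib (tree_arboretum G' 0))) (restrict_space E.tot tree_E) (echi D)"
    by (simp add: tree_arboretum_def esum_def G'_simps D_sel)
next
  fix w assume "w \<in> space (total_space (vfib (tree_arboretum G' 0)))"
  then have "w \<in> space (vsum G')" by (simp add: tree_arboretum_def)
  then obtain n x where w: "w = (n, x)" "x \<in> pv ` V n" unfolding space_vsum by blast
  then show "pv (vchi D w) = root_iso D (proj (vfib (tree_arboretum G' 0)) w)"
    using V.proj_sec[OF V_sets V_inj w(2)] root_proj_G'[OF w(2)]
    by (simp add: tree_arboretum_def D_sel)
next
  fix w assume "w \<in> space (total_space (efib (tree_arboretum G' 0)))"
  then have "w \<in> space (esum G')" by (simp add: tree_arboretum_def)
  then obtain k x where w: "w = (enc k, x)" "fst k" "x \<in> base k" unfolding space_esum by auto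
  have cr: "chi k x \<in> rep k" by (rule chi_mem[OF w(3)])
  then have cS: "chi k x \<in> SE" using rep_SE by blast
  have ch: "echi D w = chi k x" by (simp add: D_sel w(1))
  have vc: "vchi D (n, x) = V.sec (V n) x" for n by (simp add: D_sel)
  have fo: "forg (tree_arboretum G' 0) w = (korg k, x)" and ft: "fter (tree_arboretum G' 0) w = (kter k, x)"
    using sum_ends[OF w(2), of x] by (simp_all add: tree_arboretum_def w(1))
  show "pe (echi D w) = root_iso D (proj (efib (tree_arboretum G' 0)) w)"
  proof -
    have "proj (efib (tree_arboretum G' 0)) w = root_proj G' 0 (korg k, x)"
      using sum_ends[OF w(2), of x] by (simp add: tree_arboretum_def w(1))
    also have "\<dots> = x" using tree_base[OF w(2,3)] by (intro root_proj_G') blast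
    finally show ?thesis unfolding ch chi_proj[OF w(3)] by (simp add: D_sel)
  qed
  show "forg A (echi D w) = vchi D (forg (tree_arboretum G' 0) w)"
    unfolding ch fo vc using V.sec_proj[OF V_sets V_inj rep_ends(1)[OF w(2) cr]] org_proj[OF cS] chi_proj[OF w(3)] by simp
  show "fter A (echi D w) = vchi D (fter (tree_arboretum G' 0) w)"
    unfolding ch ft vc using V.sec_proj[OF V_sets V_inj rep_ends(2)[OF w(2) cr]] ter_proj[OF cS] chi_proj[OF w(3)] by simp
  have "fopp (tree_arboretum G' 0) w = (enc (kopp k), x)"
    by (simp add: tree_arboretum_def w(1) G'_simps)
  then show "fopp A (echi D w) = echi D (fopp (tree_arboretum G' 0) w)"
    using chi_opp[OF w(3)] unfolding ch by (simp add: D_sel)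
qed

text \<open>\<open>H\<close> stands for the graph of relations or its restriction to the tree, which
  carry the same spaces.\<close>

lemma vrep_D: "vrep H (vchi D) n = V n" if "space (vspace H n) = pv ` V n"
proof -
  have "vchi D ` ({n} \<times> pv ` V n) = V.sec (V n) ` pv ` V n" by (force simp: D_def)
  then show ?thesis unfolding vrep_def that using V.sec_image[OF V_sets V_inj] by simp
qed

lemma vrep_G: "vrep G (vchi D) n = V n" and vrep_G': "vrep G' (vchi D) n = V n"
  by (rule vrep_D, simp add: D_simps E.restrict_base_space[OF V_base_sets])
    (rule vrep_D, unfold G'_simps, rule E.restrict_base_space[OF V_base_sets])

lemma erep_D: "erep H (echi D) (enc k) = rep k" if "space (espace H (enc k)) = base k"
proof -
  have "echi D ` ({enc k} \<times> base k) = chi k ` base k" by (force simp: D_def)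
  then show ?thesis unfolding erep_def that using chi_image by simp
qed

lemma erep_G: "erep G (echi D) (enc k) = rep k" and erep_G': "erep G' (echi D) (enc k) = rep k"
  by (rule erep_D, simp add: D_simps E.restrict_base_space[OF base_sets])
    (rule erep_D, unfold G'_simps from_nat_to_nat, rule E.restrict_base_space[OF base_sets])

lemma representatives:
  "arboretum_of_representatives X R A G' (root D) (space X) (root_iso D) (vchi D) (echi D)"
  unfolding arboretum_of_representatives_def representation_def
proof (intro conjI ballI)
  show "rooted_tree_of_relations G' (root D)" using rooted_tree_G' by (simp add: D_sel)
  show "space X \<in> sets X" by simp
  have "borel_iso (restrict_space X (space X)) (restrict_space X (space X)) (\<lambda>x. x)" by (rule borel_iso_id)
  then show "borel_iso (vspace G' (root D)) (restrict_space X (space X)) (root_iso D)"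
    unfolding G'_simps by (simp add: D_sel V_0)
  have "root D = 0" by (simp add: D_sel)
  then show "\<exists>V E. sub_arboretum A (space X) V E \<and>
      arboretum_iso_over (root_iso D) (tree_arboretum G' (root D)) A V E (vchi D) (echi D)"
    using sub_arboretum_tree iso_over by auto
  fix n
  show "rel_iso (vspace G' n) (vrel G' n) (restrict_space V.tot (vrep G' (vchi D) n))
      (Restr V.orb (vrep G' (vchi D) n)) (\<lambda>u. vchi D (n, u))"
    unfolding vrep_G' G'_simps using V.sec_rel_iso[OF V_sets V_inj, of n] by (simp add: D_sel)
next
  fix e assume "e \<in> edges (graph G')"
  then obtain k where k: "e = enc k" unfolding G'_simps by blast
  obtain tr up n where kk: "k = (tr, up, n)" by (cases k)
  have "rel_iso (restrict_space X (base k)) (krel k) (restrict_space E.tot (rep k)) (Restr E.orb (rep k)) (chi k)"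
    unfolding rel_iso_def E.restrict_base_space[OF base_sets]
    using chi_iso[of k] chi_orb[of _ tr up n] chi_mem by (auto simp: kk krel_def)
  then show "rel_iso (espace G' e) (erel G' e) (restrict_space E.tot (erep G' (echi D) e))
      (Restr E.orb (erep G' (echi D) e)) (\<lambda>u. echi D (e, u))"
    unfolding k erep_G' G'_simps by (simp add: D_sel)
next
  show "disjoint_family_on (\<lambda>P. V.sat (vrep G' (vchi D) P)) (verts (graph G'))"
    unfolding vrep_G' disjoint_family_on_def using V_disj by blast
  show "(\<Union>P\<in>verts (graph G'). V.sat (vrep G' (vchi D) P)) = SV"
    unfolding vrep_G' G'_simps by (rule V_cover)
qed

text \<open>The three branches of \<open>edge_rep\<close> agree with \<open>rep\<close>; the last
  one reverses the section of the opposite edge, as \<open>rep\<close> does for directions that are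
  not \<open>up\<close>.\<close>

lemma edge_rep_D: "edge_rep A D (enc k) = rep k"
proof -
  obtain tr up n where k: "k = (tr, up, n)" by (cases k)
  have inj: "enc k \<in> enc ` S \<longleftrightarrow> k \<in> S" for S by (auto simp: inj_image_mem_iff)
  have sect: "sect D (enc l) ` src D (enc l) = rep l" for l using chi_image[of l] by (simp add: D_def)
  have te: "enc k \<in> tedges D \<longleftrightarrow> tr" and oe: "enc k \<in> orient D \<longleftrightarrow> up"
    using inj[of "{k. fst k}"] inj[of "{k. fst (snd k)}"] by (simp_all add: D_def k)
  have op: "opp (graph G) (enc k) = enc (kopp k)" by (simp add: D_simps)
  show ?thesis
    unfolding edge_rep_def te oe erep_G op sect by (simp add: k kopp_def rep_def)
qed

theorem desingularization_D: "desingularization X R A D"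
proof -
  have gG: "graph G = quotient_graph" by (simp add: D_def quotient_relations_def)
  have edges: "edges (graph G) = range enc" by (simp add: D_simps)
  have orgG: "org (graph G) (enc k) = korg k" and terG: "ter (graph G) (enc k) = kter k"
    and oppG: "opp (graph G) (enc k) = enc (kopp k)" for k by (simp_all add: D_simps)
  have serre: "serre_graph (graph G)" using graph_of_relations_G unfolding graph_of_relations_def by blast
  have restr: "restrict_graph (graph G) (tverts D) (tedges D) = graph G'"
    by (simp add: restrict_rel_graph_def)
  have max: "maximal_subtree (graph G) (tverts D) (tedges D)"
  proof (rule maximal_subtree_spanning[OF serre])
    show "is_subtree (graph G) (tverts D) (tedges D)"
      unfolding is_subtree_def restr using tree_G' by (auto simp: D_simps)
    show "tverts D = verts (graph G)" by (simp add: D_simps)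
  qed
  have conn: "graph_connected (graph G)"
    unfolding graph_connected_def
  proof (intro conjI ballI)
    show "verts (graph G) \<noteq> {}" by (simp add: D_simps)
    fix u v
    have "graph_connected (graph G')" using tree_G' unfolding is_tree_def by (elim conjE)
    then have "\<exists>q. walk (graph G') u q v" by (simp add: graph_connected_def G'_simps(1))
    then obtain q where "walk (graph G') u q v" by (rule exE)
    then have "walk (graph G) u q v" by (rule walk_mono[rotated -1]) (auto simp: D_simps restrict_rel_graph_def restrict_graph_def)
    then show "\<exists>q. walk (graph G) u q v" by (rule exI)
  qed
  have orient: "orientation (graph G) (orient D)"
  proof -
    have o: "opp (graph G) ` orient D = enc ` {k. \<not> fst (snd k)}"
    proof -
      have "opp (graph G) ` orient D = enc ` kopp ` {k. fst (snd k)}"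
        unfolding image_image[of enc kopp] by (simp add: D_simps image_image)
      moreover have "kopp ` {k. fst (snd k)} = {k. \<not> fst (snd k)}"
      proof (intro subset_antisym subsetI)
        fix k :: "bool \<times> bool \<times> nat" assume "k \<in> {k. \<not> fst (snd k)}"
        then show "k \<in> kopp ` {k. fst (snd k)}"
          by (intro image_eqI[of _ _ "kopp k"]) (auto simp: kopp_def split: prod.splits)
      qed (auto simp: kopp_def)
      ultimately show ?thesis by simp
    qed
    have od: "orient D = enc ` {k. fst (snd k)}" by (simp add: D_def)
    show ?thesis
      unfolding orientation_def edges o unfolding od by (auto simp: image_iff)
  qed
  have nontree: "\<exists>n. e = enc (False, True, n)" if "e \<in> orient D - tedges D" for e
  proof -
    from that have "e \<in> enc ` {k. fst (snd k)}" by (simp add: D_sel)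
    then obtain k where k: "e = enc k" "fst (snd k)" by blast
    then have "\<not> fst k" using that by (auto simp: D_def)
    then show ?thesis using k by (cases k) auto
  qed
  have ps: "partial_section X (efib A) (src D e) (sect D e) \<and>
      (\<forall>x\<in>src D e. forg A (sect D e x) \<in> vrep G (vchi D) (org (graph G) e) \<and>
        act (vfib A) (phi D e x) x (fter A (sect D e x)) \<in> vrep G (vchi D) (ter (graph G) e))"
    if e: "e \<in> orient D - tedges D" for e
  proof -
    obtain n where en: "e = enc (False, True, n)" using nontree[OF e] by (rule exE)
    let ?k = "(False, True, n)"
    have s: "src D e = base ?k" "sect D e = chi ?k" "phi D e = kinj ?k" by (simp_all add: D_def en)
    have "chi ?k \<in> measurable (restrict_space X (base ?k)) E.tot"
      using E.sec_measurable[OF L_sets L_inj, of False n] by (simp add: chi_def[abs_def] base_def)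
    moreover have "forg A (chi ?k x) \<in> V (korg ?k)" if "x \<in> base ?k" for x
      using chi_mem[OF that] L_org[of False n] by (auto simp: rep_def korg_def)
    moreover have "act (vfib A) (kinj ?k x) x (fter A (chi ?k x)) \<in> V (kter ?k)" if "x \<in> base ?k" for x
      using V.sec_mem[OF V_sets V_inj sec_kinj(1)[OF that]] unfolding sec_kinj(3)[OF that] .
    ultimately show ?thesis
      unfolding partial_section_def s vrep_G using base_sets chi_proj by (simp add: en orgG terG)
  qed
  have kinj_img: "kinj k ` base k \<in> sets X" and kinj_iso:
      "borel_iso (restrict_space X (base k)) (restrict_space X (kinj k ` base k)) (kinj k)" for k
  proof -
    have m: "kinj k \<in> measurable (restrict_space X (base k)) X"
      using kinj_measurable[of k] measurable_restrict_space2_iff by blast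
    show "kinj k ` base k \<in> sets X" by (rule lusin_souslin[OF X X base_sets m kinj_inj])
    show "borel_iso (restrict_space X (base k)) (restrict_space X (kinj k ` base k)) (kinj k)"
      by (rule borel_iso_image[OF X X base_sets m kinj_inj])
  qed
  have pseudo: "full_pseudogroup X R (src D e) (phi D e)" for e
    unfolding full_pseudogroup_def
    using base_sets kinj_img kinj_iso sec_kinj(2) by (simp add: D_def)
  \<comment> \<open>Stated for any relation \<open>S\<close> and for terminal vertices only: an
    origin is the terminal vertex of the opposite edge, whose morphism is the inclusion.\<close>
  have iso: "rel_iso (restrict_space (vspace G (ter (graph G) (enc k))) (ginj G (enc k) ` space (espace G (enc k))))
      S (restrict_space X (kinj k ` base k)) S (\<lambda>u. pv (vchi D (ter (graph G) (enc k), u)))" for k S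
  proof -
    have sub: "kinj k ` base k \<subseteq> pv ` V (kter k)" using sec_kinj(1) by blast
    have "restrict_space (vspace G (ter (graph G) (enc k))) (ginj G (enc k) ` space (espace G (enc k))) =
        restrict_space X (kinj k ` base k)"
      using restrict_restrict_subset[OF V_base_sets kinj_img sub]
      by (simp add: D_simps E.restrict_base_space[OF base_sets])
    moreover have "pv (vchi D (ter (graph G) (enc k), u)) = u" if "u \<in> space (restrict_space X (kinj k ` base k))" for u
    proof -
      have "u \<in> pv ` V (kter k)" using that sub unfolding E.restrict_base_space[OF kinj_img] by blast
      then show ?thesis using V.proj_sec[OF V_sets V_inj] by (simp add: D_simps)
    qed
    ultimately show ?thesis by (simp add: rel_iso_identity)
  qed
  have isos: "rel_iso
        (restrict_space (vspace G (org (graph G) e)) (ginj G (opp (graph G) e) ` space (espace G (opp (graph G) e))))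
        (image_rel (ginj G (opp (graph G) e)) (erel G (opp (graph G) e)))
        (restrict_space X (src D e)) (Stab R (efib A) (src D e) (sect D e))
        (\<lambda>u. pv (vchi D (org (graph G) e, u))) \<and>
      rel_iso
        (restrict_space (vspace G (ter (graph G) e)) (ginj G e ` space (espace G e)))
        (image_rel (ginj G e) (erel G e))
        (restrict_space X (phi D e ` src D e)) (image_rel (phi D e) (Stab R (efib A) (src D e) (sect D e)))
        (\<lambda>u. pv (vchi D (ter (graph G) e, u)))"
    if e: "e \<in> orient D - tedges D" for e
  proof -
    obtain n where en: "e = enc (False, True, n)" using nontree[OF e] by (rule exE)
    let ?k = "(False, True, n)"
    have stab: "Stab R (efib A) (src D e) (sect D e) = krel ?k"
      using E.sec_rel_Stab[OF L_sets L_inj, of False n]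
      by (simp add: D_def en krel_def base_def chi_def[abs_def])
    have s: "src D e = base ?k" "phi D e = kinj ?k" "erel G e = krel ?k" "ginj G e = kinj ?k"
      "ginj G (enc (kopp ?k)) = kinj (kopp ?k)" "erel G (enc (kopp ?k)) = krel ?k"
      by (simp_all add: D_simps en)
    have id: "kinj (kopp ?k) = (\<lambda>x. x)" by (simp add: kinj_def[abs_def] kopp_def)
    show ?thesis
    proof
      have im: "image_rel (ginj G (opp (graph G) e)) (erel G (opp (graph G) e)) = krel ?k"
        by (simp add: en oppG s(5,6) id image_rel_def)
      have img: "kinj (kopp ?k) ` base (kopp ?k) = base ?k" by (simp add: id)
      have o: "ter (graph G) (enc (kopp ?k)) = org (graph G) e" by (simp add: en terG orgG)
      have opp: "enc (kopp ?k) = opp (graph G) e" by (simp add: en oppG)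
      show "rel_iso
        (restrict_space (vspace G (org (graph G) e)) (ginj G (opp (graph G) e) ` space (espace G (opp (graph G) e))))
        (image_rel (ginj G (opp (graph G) e)) (erel G (opp (graph G) e)))
        (restrict_space X (src D e)) (Stab R (efib A) (src D e) (sect D e))
        (\<lambda>u. pv (vchi D (org (graph G) e, u)))"
        using iso[of "kopp ?k" "krel ?k"] unfolding im stab unfolding s(1) img o unfolding opp .
      show "rel_iso
        (restrict_space (vspace G (ter (graph G) e)) (ginj G e ` space (espace G e)))
        (image_rel (ginj G e) (erel G e))
        (restrict_space X (phi D e ` src D e)) (image_rel (phi D e) (Stab R (efib A) (src D e) (sect D e)))
        (\<lambda>u. pv (vchi D (ter (graph G) e, u)))"
        using iso[of ?k "image_rel (kinj ?k) (krel ?k)"] unfolding stab unfolding s(1-4) en[symmetric] .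
    qed
  qed
  have cover: "(\<Union>e\<in>edges (graph G). E.sat (edge_rep A D e)) = SE"
    unfolding edges using rep_cover by (simp add: edge_rep_D)
  have part: "E.sat (edge_rep A D e) \<inter> E.sat (edge_rep A D f) = {} \<or>
      f = opp (graph G) e \<and> E.sat (edge_rep A D e) = E.sat (edge_rep A D f)"
    if ef: "e \<in> edges (graph G)" "f \<in> edges (graph G)" "e \<noteq> f" for e f
  proof -
    obtain tr up n tr' up' m where k: "e = enc (tr, up, n)" "f = enc (tr', up', m)"
      using ef(1,2) unfolding edges by auto
    show ?thesis
    \<comment> \<open>If kind or number differ the orbits are separated; otherwise the two edges are
      opposite, and \<open>rep_opp\<close> gives the alternative.\<close>
    proof (cases "(tr, n) = (tr', m)")
      case False
      then show ?thesis unfolding k edge_rep_D using rep_sep by blast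
    next
      case True
      then have "up' = (\<not> up)" using ef(3) k by auto
      then show ?thesis using True rep_opp[of tr up n] unfolding k edge_rep_D oppG by (auto simp: kopp_def)
    qed
  qed
  have "root D \<in> tverts D" by (simp add: D_def)
  then show ?thesis
    unfolding desingularization_def Let_def
    using graph_of_relations_G conn orient max pseudo representatives ps isos cover part by (intro conjI ballI impI) blast+
qed

end

theorem mainTheorem5:
  fixes X :: "'x measure" and R :: "('x \<times> 'x) set" and A :: "('x, 'w, 'f) graph_field"
  assumes "standard_borel X"
    and "borel_equiv X R"
    and "\<And>x. x \<in> space X \<Longrightarrow> countable (R `` {x})"
    and "R_arboretum X R A"
  shows "\<exists>D :: ('x, 'w, 'f, nat, nat, 'x, 'x) desing. desingularization X R A D"
proof -
  interpret arboretum_action X R A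
    by (rule arboretum_action.intro[OF assms(1,2) _ assms(4)]) (rule assms(3))
  obtain V E p where "tree_representatives X R A V E p" using vertex_representatives by (elim exE)
  then interpret tree_representatives X R A V E p .
  obtain T a b \<phi> where "desing_data X R A V E p T a b \<phi>" using edge_representatives by (elim exE)
  then interpret desing_data X R A V E p T a b \<phi> .
  from desingularization_D show ?thesis by (rule exI)
qed

end
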